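(* For any $d,n\in\mathbb{N}$ and $C,\alpha,D>0$ there exists $\varepsilon_0=\varepsilon_0(n,C,\alpha,D)>0$ (depending only on $n,C,\alpha,D$) with the following property. Whenever $\nu$ is a Radon measure on $F^d$, $U\subseteq F^d$ is an open set with $\nu(U)>0$ such that $\nu$ is $D$-Federer on $U$, and $\mathbf{f}:U\to F^n$ is a continuous map such that $(\mathbf{f},\nu)$ is $(C,\alpha)$-good on $U$ and nonplanar, then for every $\varepsilon\in(0,\tfrac1e]$ with $\varepsilon<\varepsilon_0$, $$\mathbf{f}_*\nu\big(DI_\varepsilon(\mathcal{T})\big)=\nu\big(\{\mathbf{x}\in U:\mathbf{f}(\mathbf{x})\in DI_\varepsilon(\mathcal{T})\}\big)=0\quad\text{for every unbounded } \mathcal{T}\subseteq\mathfrak{a}^+.$$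
   Context: Let $\mathbb{F}_q$ be the finite field with $q$ elements ($q$ a power of a prime), $\Lambda=\mathbb{F}_q[T]$, and $F=\mathbb{F}_q((T^{-1}))$ with absolute value $|a|=e^{\deg a}$ for $a\neq0$ (where $\deg a$ is the largest exponent of $T$ with nonzero coefficient) and $|0|=0$. $F^d$ carries the supremum norm $\|\mathbf{x}\|=\max_i|x_i|$ and the induced metric and topology. For a ball $B=B(x;r)$ and $m\in\mathbb{N}$, $3^mB$ denotes $B(x;3^mr)$. Put $\mathfrak{a}^+=\{\mathbf{t}=(t_0,t_1,\dots,t_n)\in\mathbb{Z}_{\ge0}^{n+1}: t_0=t_1+\dots+t_n\}$ and $\|\mathbf{t}\|=\max_i t_i$. For unbounded $\mathcal{T}\subseteq\mathfrak{a}^+$ and $0<\varepsilon\le\frac1e$, $DI_\varepsilon(\mathcal{T})\subseteq F^n$ is the set of vectors $\mathbf{y}=(y_1,\dots,y_n)$ that are Dirichlet $\varepsilon$-improvable along $\mathcal{T}$, i.e. for which there is $s_0>0$ such that for every $\mathbf{t}\in\mathcal{T}$ with $\|\mathbf{t}\|>s_0$ there is a nonzero $(p,q_1,\dots,q_n)\in\Lambda\times\Lambda^n$ with $$|y_1q_1+\dots+y_nq_n-p|<\frac{\varepsilon}{e^{t_0}}\quad\text{and}\quad|q_j|<\varepsilon e^{t_j}\ \text{ for } j=1,\dots,n.$$ Let $\nu$ be a Radon measure on $F^d$ and $U\subseteq F^d$ open. For $B\subseteq F^d$ and a function $f$ to $F$ put $\|f\|_{\nu,B}=\sup_{x\in B\cap\mathrm{supp}(\nu)}|f(x)|$.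 - A function $f:U\to F$ with $|f|$ measurable is $(C,\alpha)$-good on $U$ with respect to $\nu$ if for every ball $B\subseteq U$ with center in $\mathrm{supp}(\nu)$ and every $\varepsilon>0$, $$\nu(\{x\in B:|f(x)|<\varepsilon\})\le C\left(\frac{\varepsilon}{\|f\|_{\nu,B}}\right)^{\alpha}\nu(B),$$ the right-hand side being read as $+\infty$ if $\|f\|_{\nu,B}=0$. - For $\mathbf{f}=(f_1,\dots,f_n):U\to F^n$, $(\mathbf{f},\nu)$ is $(C,\alpha)$-good on $U$ if every $F$-linear combination of $1,f_1,\dots,f_n$ is $(C,\alpha)$-good on $U$ with respect to $\nu$. - $(\mathbf{f},\nu)$ is nonplanar if for every ball $B\subseteq U$ with center in $\mathrm{supp}(\nu)$, the restrictions of $1,f_1,\dots,f_n$ to $B\cap\mathrm{supp}(\nu)$ are linearly independent over $F$. - $\nu$ is $D$-Federer on $U$ if $\nu(3B)/\nu(B)\le D$ for every ball $B$ with center in $\mathrm{supp}(\nu)$ such that $3B\subseteq U$. *)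

theory Defs
  imports
    "HOL-Analysis.Analysis"
    "HOL-Algebra.Ring"
    "HOL-Computational_Algebra.Formal_Laurent_Series"
begin

text \<open>
  The finite field is a finite subset \<open>K\<close> of a commutative ring type that is a field under the
  operations of the type. The unit element of \<open>K\<close> is \<^emph>\<open>not\<close> required to be the \<open>1\<close> of the type.
  Thus one ring type can contain finite fields of every order and characteristic (a product of
  finite fields contains each of its factors), and quantifying over \<open>K\<close> inside a formula
  expresses uniformity in the order of the field. If the type is itself a finite field,
  \<open>K = UNIV\<close> is allowed.
\<close>

definition finite_field_on :: "'k::comm_ring_1 set \<Rightarrow> bool" where
  "finite_field_on K \<longleftrightarrow> finite K \<and>
     (\<exists>e. field \<lparr>carrier = K, monoid.mult = (*), one = e, ring.zero = 0, ring.add = (+)\<rparr>)"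

text \<open>
  A formal Laurent series is read as a series in \<open>T\<^sup>-\<^sup>1\<close>: the coefficient \<open>fls_nth a i\<close> belongs
  to the power \<open>T\<^sup>-\<^sup>i\<close>, so that the degree of \<open>a \<noteq> 0\<close> is \<open>- fls_subdegree a\<close>.
\<close>

definition laurent_field :: "'k::comm_ring_1 set \<Rightarrow> 'k fls set" where
  "laurent_field K = {a. \<forall>i. fls_nth a i \<in> K}"

definition poly_subring :: "'k::comm_ring_1 set \<Rightarrow> 'k fls set" where
  "poly_subring K = {a \<in> laurent_field K. \<forall>i>0. fls_nth a i = 0}"

text \<open>The metric that the library puts on formal Laurent series has base 2 instead of \<open>e\<close>; it is not used.\<close>

definition fls_abs :: "'k::comm_ring_1 fls \<Rightarrow> real" where
  "fls_abs a = (if a = 0 then 0 else exp (- real_of_int (fls_subdegree a)))"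

text \<open>Vectors with \<open>d\<close> entries are indexed by \<open>1, \<dots>, d\<close> (with \<open>d \<ge> 1\<close>) and are \<open>undefined\<close> elsewhere.\<close>

definition vec_space :: "'k::comm_ring_1 set \<Rightarrow> nat \<Rightarrow> (nat \<Rightarrow> 'k fls) set" where
  "vec_space K d = (\<Pi>\<^sub>E i\<in>{1..d}. laurent_field K)"

definition vec_dist :: "nat \<Rightarrow> (nat \<Rightarrow> 'k::comm_ring_1 fls) \<Rightarrow> (nat \<Rightarrow> 'k fls) \<Rightarrow> real" where
  "vec_dist d x y = Max ((\<lambda>i. fls_abs (x i - y i)) ` {1..d})"

definition vec_top :: "'k::comm_ring_1 set \<Rightarrow> nat \<Rightarrow> (nat \<Rightarrow> 'k fls) topology" where
  "vec_top K d = Metric_space.mtopology (vec_space K d) (vec_dist d)"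

definition vec_ball ::
    "'k::comm_ring_1 set \<Rightarrow> nat \<Rightarrow> (nat \<Rightarrow> 'k fls) \<Rightarrow> real \<Rightarrow> (nat \<Rightarrow> 'k fls) set" where
  "vec_ball K d x r = Metric_space.mball (vec_space K d) (vec_dist d) x r"

definition radon_measure :: "'a topology \<Rightarrow> 'a measure \<Rightarrow> bool" where
  "radon_measure X \<nu> \<longleftrightarrow>
     space \<nu> = topspace X \<and>
     sets \<nu> = sigma_sets (topspace X) {V. openin X V} \<and>
     (\<forall>C. compactin X C \<longrightarrow> emeasure \<nu> C < \<infinity>) \<and>
     (\<forall>A\<in>sets \<nu>. emeasure \<nu> A = (INF V\<in>{V. openin X V \<and> A \<subseteq> V}. emeasure \<nu> V)) \<and>
     (\<forall>V. openin X V \<longrightarrow> emeasure \<nu> V = (SUP C\<in>{C. compactin X C \<and> C \<subseteq> V}. emeasure \<nu> C))"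

definition measure_supp :: "'a topology \<Rightarrow> 'a measure \<Rightarrow> 'a set" where
  "measure_supp X \<nu> = {x \<in> topspace X. \<forall>V. openin X V \<and> x \<in> V \<longrightarrow> 0 < emeasure \<nu> V}"

definition sup_on_supp ::
    "'a topology \<Rightarrow> 'a measure \<Rightarrow> 'a set \<Rightarrow> ('a \<Rightarrow> 'k::comm_ring_1 fls) \<Rightarrow> ennreal" where
  "sup_on_supp X \<nu> B g = (SUP x\<in>B \<inter> measure_supp X \<nu>. ennreal (fls_abs (g x)))"

text \<open>
  The supremum may be infinite for a general \<open>g\<close>; then \<open>ennreal \<epsilon> / \<infinity> = 0\<close> and the
  right-hand side is \<open>0\<close>, as \<open>\<alpha> > 0\<close>.
\<close>

definition good_fun ::
    "'k::comm_ring_1 set \<Rightarrow> nat \<Rightarrow> (nat \<Rightarrow> 'k fls) measure \<Rightarrow> (nat \<Rightarrow> 'k fls) set \<Rightarrow>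
      real \<Rightarrow> real \<Rightarrow> ((nat \<Rightarrow> 'k fls) \<Rightarrow> 'k fls) \<Rightarrow> bool" where
  "good_fun K d \<nu> U C \<alpha> g \<longleftrightarrow>
     (\<lambda>x. fls_abs (g x)) \<in> borel_measurable (restrict_space \<nu> U) \<and>
     (\<forall>x\<in>measure_supp (vec_top K d) \<nu>. \<forall>r>0. vec_ball K d x r \<subseteq> U \<longrightarrow>
       (\<forall>\<epsilon>>0.
          emeasure \<nu> {z \<in> vec_ball K d x r. fls_abs (g z) < \<epsilon>} \<le>
          (let s = sup_on_supp (vec_top K d) \<nu> (vec_ball K d x r) g in
             if s = 0 then \<infinity>
             else ennreal (C * enn2real (ennreal \<epsilon> / s) powr \<alpha>) * emeasure \<nu> (vec_ball K d x r))))"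

definition affine_comb ::
    "nat \<Rightarrow> (nat \<Rightarrow> 'k::comm_ring_1 fls) \<Rightarrow> (nat \<Rightarrow> 'k fls) \<Rightarrow> 'k fls" where
  "affine_comb n c y = c 0 + (\<Sum>i=1..n. c i * y i)"

definition good_map ::
    "'k::comm_ring_1 set \<Rightarrow> nat \<Rightarrow> nat \<Rightarrow> (nat \<Rightarrow> 'k fls) measure \<Rightarrow> (nat \<Rightarrow> 'k fls) set \<Rightarrow>
      real \<Rightarrow> real \<Rightarrow> ((nat \<Rightarrow> 'k fls) \<Rightarrow> (nat \<Rightarrow> 'k fls)) \<Rightarrow> bool" where
  "good_map K d n \<nu> U C \<alpha> f \<longleftrightarrow>
     (\<forall>c\<in>{0..n} \<rightarrow> laurent_field K. good_fun K d \<nu> U C \<alpha> (\<lambda>x. affine_comb n c (f x)))"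

definition nonplanar ::
    "'k::comm_ring_1 set \<Rightarrow> nat \<Rightarrow> nat \<Rightarrow> (nat \<Rightarrow> 'k fls) measure \<Rightarrow> (nat \<Rightarrow> 'k fls) set \<Rightarrow>
      ((nat \<Rightarrow> 'k fls) \<Rightarrow> (nat \<Rightarrow> 'k fls)) \<Rightarrow> bool" where
  "nonplanar K d n \<nu> U f \<longleftrightarrow>
     (\<forall>x\<in>measure_supp (vec_top K d) \<nu>. \<forall>r>0. vec_ball K d x r \<subseteq> U \<longrightarrow>
       (\<forall>c\<in>{0..n} \<rightarrow> laurent_field K.
          (\<forall>z\<in>vec_ball K d x r \<inter> measure_supp (vec_top K d) \<nu>. affine_comb n c (f z) = 0) \<longrightarrow>
          (\<forall>i\<in>{0..n}. c i = 0)))"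

definition federer ::
    "'k::comm_ring_1 set \<Rightarrow> nat \<Rightarrow> (nat \<Rightarrow> 'k fls) measure \<Rightarrow> (nat \<Rightarrow> 'k fls) set \<Rightarrow> real \<Rightarrow> bool" where
  "federer K d \<nu> U D \<longleftrightarrow>
     (\<forall>x\<in>measure_supp (vec_top K d) \<nu>. \<forall>r>0. vec_ball K d x (3 * r) \<subseteq> U \<longrightarrow>
        emeasure \<nu> (vec_ball K d x (3 * r)) / emeasure \<nu> (vec_ball K d x r) \<le> ennreal D)"

definition a_plus :: "nat \<Rightarrow> (nat \<Rightarrow> nat) set" where
  "a_plus n = {t \<in> {0..n} \<rightarrow>\<^sub>E UNIV. t 0 = (\<Sum>i=1..n. t i)}"

definition t_norm :: "nat \<Rightarrow> (nat \<Rightarrow> nat) \<Rightarrow> nat" where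
  "t_norm n t = Max (t ` {0..n})"

definition dirichlet_improvable ::
    "'k::comm_ring_1 set \<Rightarrow> nat \<Rightarrow> real \<Rightarrow> (nat \<Rightarrow> nat) set \<Rightarrow> (nat \<Rightarrow> 'k fls) set" where
  "dirichlet_improvable K n \<epsilon> \<T> =
     {y \<in> vec_space K n. \<exists>s\<^sub>0>0. \<forall>t\<in>\<T>. s\<^sub>0 < real (t_norm n t) \<longrightarrow>
        (\<exists>p\<in>poly_subring K. \<exists>q\<in>{1..n} \<rightarrow> poly_subring K.
           (p \<noteq> 0 \<or> (\<exists>j\<in>{1..n}. q j \<noteq> 0)) \<and>
           fls_abs ((\<Sum>j=1..n. y j * q j) - p) < \<epsilon> / exp (real (t 0)) \<and>
           (\<forall>j\<in>{1..n}. fls_abs (q j) < \<epsilon> * exp (real (t j))))}"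

end

theory Submission
  imports Defs "Jordan_Normal_Form.Determinant"
begin

text \<open>
  The theorem is an instance of quantitative nondivergence for the flow on lattices in
  \<open>F\<^sup>n\<^sup>+\<^sup>1\<close>, combined with a density argument.

  \<^emph>\<open>Translation into lattices.\<close> For \<open>v = (-p, q\<^sub>1, \<dots>, q\<^sub>n)\<close> the vector \<open>shear n y v\<close> has the
  entries \<open>y\<^sub>1 q\<^sub>1 + \<dots> + y\<^sub>n q\<^sub>n - p, q\<^sub>1, \<dots>, q\<^sub>n\<close>. With the weights \<open>e\<^bsup>t\<^sub>0\<^esup>, e\<^bsup>-t\<^sub>1\<^esup>, \<dots>, e\<^bsup>-t\<^sub>n\<^esup>\<close> on
  these entries, the two inequalities in the definition of improvability at \<open>t\<close> say that the
  sheared and rescaled lattice has a nonzero vector of norm less than \<open>\<epsilon>\<close> (\<open>short_vector\<close>).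

  \<^emph>\<open>A flag of subspaces excludes short vectors.\<close> Every rational subspace \<open>V\<close> has a covolume
  \<open>covol n t V y\<close>, and adding a vector to a subspace multiplies the covolume by at most the norm
  of that vector. Suppose that there is a flag whose members have covolume in \<open>[\<epsilon>, 1)\<close>, such that
  every further subspace that is comparable with all of them has covolume at least \<open>1\<close>.
  Take a vector \<open>v\<close> of norm less than \<open>\<epsilon>\<close> and the largest member \<open>W\<close> of the flag that does not
  contain \<open>v\<close>. Then \<open>W + v\<close> has covolume less than \<open>\<epsilon>\<close> and is comparable with the whole flag, which is absurd
  (\<open>no_short_vector_if_marked\<close>).

  \<^emph>\<open>Most points have such a flag.\<close> At a point that has none, some subspace has covolume less
  than \<open>1\<close>. Around the point there is a largest ball on which some covolume stays below \<open>1\<close>; in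
  the next larger ball all covolumes reach \<open>1\<close> somewhere, so goodness bounds the part of it where
  the covolume of the chosen subspace is less than \<open>\<epsilon>\<close>, and the subspaces comparable with it form
  a family with shorter flags. Induction on the length of flags, which is at most \<open>n + 1\<close>, bounds
  the measure of the bad points by \<open>C \<epsilon>\<^sup>\<alpha> (D + \<dots> + D\<^sup>n\<^sup>+\<^sup>1)\<close> times that of the ball
  (\<open>nondivergence\<close>). Two balls are nested or disjoint, so different maximal balls are disjoint
  and the estimates add up (\<open>maximal_ball_cover\<close>).

  \<^emph>\<open>Covolumes are large somewhere.\<close> The induction starts because, on a given ball, every covolume
  reaches \<open>1\<close> once \<open>t\<close> is large: a covolume either is at least \<open>1\<close> everywhere, or is at least
  \<open>e\<^bsup>t\<^sub>m\<^esup>\<close> times an affine form in \<open>f\<close> with a coefficient of absolute value at least \<open>1\<close>, where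
  \<open>t\<^sub>m\<close> is the largest of \<open>t\<^sub>1, \<dots>, t\<^sub>n\<close>; and nonplanarity bounds all these forms from
  below at suitable points of the ball (\<open>vol_lower_bound\<close>, \<open>affine_forms_bounded_below\<close>).

  \<^emph>\<open>Conclusion.\<close> For small \<open>\<epsilon>\<close> the points with a short vector fill at most half of each ball once
  \<open>t\<close> is large. The improvable points are a countable union of sets that are contained in these
  for all large \<open>t\<close>, and a set that fills at most half of every ball around a point of
  the support is null (\<open>null_set_if_sparse\<close>). The bound \<open>\<epsilon>\<^sub>0\<close> comes from
  \<open>C \<epsilon>\<^sup>\<alpha> (D + \<dots> + D\<^sup>n\<^sup>+\<^sup>1) \<le> 1/2\<close> alone, whence
  the uniformity in the field, the dimension \<open>d\<close> and the measure.
\<close>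

section \<open>The absolute value and the coefficient field\<close>

lemma fls_abs_nonneg [simp]: "0 \<le> fls_abs a"
  by (simp add: fls_abs_def)

lemma fls_abs_0 [simp]: "fls_abs 0 = 0"
  by (simp add: fls_abs_def)

lemma fls_abs_eq_0_iff [simp]: "fls_abs a = 0 \<longleftrightarrow> a = 0"
  by (simp add: fls_abs_def)

lemma fls_abs_uminus [simp]: "fls_abs (- a) = fls_abs a"
  by (simp add: fls_abs_def)

lemma fls_abs_commute: "fls_abs (a - b) = fls_abs (b - a)"
  by (metis fls_abs_uminus minus_diff_eq)

text \<open>
  Balls of radius \<open>e\<^sup>k\<close> thereby become sets of series with prescribed coefficients up to the index
  \<open>-k\<close>, which is the form in which they are handled below.
\<close>

lemma fls_abs_less_exp_iff:
  "fls_abs a < exp (real_of_int k) \<longleftrightarrow> (\<forall>i\<le>-k. fls_nth a i = 0)"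
proof (cases "a = 0")
  case False
  then have "fls_abs a < exp (real_of_int k) \<longleftrightarrow> -k < fls_subdegree a"
    by (simp add: fls_abs_def) linarith
  also have "\<dots> \<longleftrightarrow> (\<forall>i\<le>-k. fls_nth a i = 0)"
    using fls_subdegree_greaterI[OF False, of "-k"] by auto
  finally show ?thesis .
qed auto

lemma fls_abs_add_le: "fls_abs (a + b) \<le> max (fls_abs a) (fls_abs b)"
proof (cases "a = 0 \<or> b = 0 \<or> a + b = 0")
  case False
  then have "fls_subdegree a \<le> fls_subdegree (a + b) \<or> fls_subdegree b \<le> fls_subdegree (a + b)"
    using fls_plus_subdegree[of a b] by linarith
  then show ?thesis using False by (auto simp: fls_abs_def le_max_iff_disj)
qed (auto simp: le_max_iff_disj)

lemma fls_abs_sum_less: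
  assumes "\<And>i. i \<in> I \<Longrightarrow> fls_abs (g i) < r" "0 < r"
  shows "fls_abs (sum g I) < r"
  using assms
proof (induction I rule: infinite_finite_induct)
  case (insert x I)
  then have "fls_abs (g x) < r" "fls_abs (sum g I) < r" by auto
  then show ?case using fls_abs_add_le[of "g x" "sum g I"] insert.hyps by auto
qed auto

lemma fls_abs_mult_le: "fls_abs (a * b) \<le> fls_abs a * fls_abs b"
proof (cases "a * b = 0")
  case False
  then have nz: "a \<noteq> 0" "b \<noteq> 0" by auto
  have "fls_subdegree a + fls_subdegree b \<le> fls_subdegree (a * b)"
    using fls_mult_subdegree_ge[OF False] .
  then have "exp (- real_of_int (fls_subdegree (a * b)))
      \<le> exp (- real_of_int (fls_subdegree a) + - real_of_int (fls_subdegree b))"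
    by (subst exp_le_cancel_iff) linarith
  then show ?thesis using False nz unfolding fls_abs_def exp_add by (simp only: if_False)
qed simp

lemma fls_abs_1 [simp]: "fls_abs 1 = 1"
  by (simp add: fls_abs_def)

locale coefficient_field =
  fixes K :: "'k::comm_ring_1 set"
  assumes finite_field: "finite_field_on K"
begin

lemma finite_K: "finite K"
  using finite_field by (simp add: finite_field_on_def)

text \<open>
  The unit of \<open>K\<close> can differ from the \<open>1\<close> of the type (take a factor of a product ring), so it is
  recovered from the field structure.
\<close>

definition unit :: 'k where
  "unit = (SOME e. field \<lparr>carrier = K, monoid.mult = (*), one = e, ring.zero = 0, ring.add = (+)\<rparr>)"

lemma field_K:
  "field \<lparr>carrier = K, monoid.mult = (*), one = unit, ring.zero = 0, ring.add = (+)\<rparr>"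
  using someI_ex[of "\<lambda>e. field \<lparr>carrier = K, monoid.mult = (*), one = e, ring.zero = 0, ring.add = (+)\<rparr>"]
    finite_field by (simp add: finite_field_on_def unit_def)

lemma zero_in_K: "0 \<in> K"
  and unit_in_K: "unit \<in> K"
  and unit_nonzero: "unit \<noteq> 0"
  and add_in_K: "\<And>a b. a \<in> K \<Longrightarrow> b \<in> K \<Longrightarrow> a + b \<in> K"
  and mult_in_K: "\<And>a b. a \<in> K \<Longrightarrow> b \<in> K \<Longrightarrow> a * b \<in> K"
  and unit_mult: "\<And>a. a \<in> K \<Longrightarrow> unit * a = a"
  and K_integral: "\<And>a b. a \<in> K \<Longrightarrow> b \<in> K \<Longrightarrow> a * b = 0 \<Longrightarrow> a = 0 \<or> b = 0"
  and uminus_in_K: "\<And>a. a \<in> K \<Longrightarrow> - a \<in> K"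
proof -
  interpret R: field "\<lparr>carrier = K, monoid.mult = (*), one = unit, ring.zero = 0, ring.add = (+)\<rparr>"
    by (rule field_K)
  show "0 \<in> K" "unit \<in> K" "unit \<noteq> 0"
    using R.zero_closed R.one_closed R.one_not_zero by auto
  show "a + b \<in> K" if "a \<in> K" "b \<in> K" for a b using R.add.m_closed[of a b] that by simp
  show "a * b \<in> K" if "a \<in> K" "b \<in> K" for a b using R.m_closed[of a b] that by simp
  show "unit * a = a" if "a \<in> K" for a using R.l_one[of a] that by simp
  show "a = 0 \<or> b = 0" if "a \<in> K" "b \<in> K" "a * b = 0" for a b
    using R.integral[of a b] that by simp
  show "- a \<in> K" if a: "a \<in> K" for a
  proof -
    obtain b where "b \<in> K" "a + b = 0"
      using R.add.r_inv_ex[of a] a by auto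
    then show ?thesis using minus_unique[of a b] by simp
  qed
qed

abbreviation F where "F \<equiv> laurent_field K"
abbreviation \<Lambda> where "\<Lambda> \<equiv> poly_subring K"

lemma F_iff: "a \<in> F \<longleftrightarrow> (\<forall>i. fls_nth a i \<in> K)"
  by (simp add: laurent_field_def)

lemma \<Lambda>_iff: "a \<in> \<Lambda> \<longleftrightarrow> a \<in> F \<and> (\<forall>i>0. fls_nth a i = 0)"
  by (simp add: poly_subring_def)

lemma \<Lambda>_in_F: "a \<in> \<Lambda> \<Longrightarrow> a \<in> F"
  by (auto simp: \<Lambda>_iff)

lemma K_sum: "(\<And>i. i \<in> I \<Longrightarrow> g i \<in> K) \<Longrightarrow> sum g I \<in> K"
  by (induction I rule: infinite_finite_induct) (auto simp: zero_in_K add_in_K)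

lemma F_0 [simp]: "0 \<in> F" and \<Lambda>_0 [simp]: "0 \<in> \<Lambda>"
  by (auto simp: F_iff \<Lambda>_iff zero_in_K)

lemma F_add: "a \<in> F \<Longrightarrow> b \<in> F \<Longrightarrow> a + b \<in> F"
  by (simp add: F_iff add_in_K)

lemma F_uminus: "a \<in> F \<Longrightarrow> - a \<in> F"
  by (simp add: F_iff uminus_in_K)

lemma F_mult: "a \<in> F \<Longrightarrow> b \<in> F \<Longrightarrow> a * b \<in> F"
  by (auto simp: F_iff fls_times_nth intro!: K_sum mult_in_K)

lemma F_sum: "(\<And>i. i \<in> I \<Longrightarrow> g i \<in> F) \<Longrightarrow> sum g I \<in> F"
  by (induction I rule: infinite_finite_induct) (auto simp: F_add)

lemma \<Lambda>_add: "a \<in> \<Lambda> \<Longrightarrow> b \<in> \<Lambda> \<Longrightarrow> a + b \<in> \<Lambda>"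
  by (simp add: \<Lambda>_iff F_add)

lemma \<Lambda>_uminus: "a \<in> \<Lambda> \<Longrightarrow> - a \<in> \<Lambda>"
  by (simp add: \<Lambda>_iff F_uminus)

lemma \<Lambda>_mult: assumes "a \<in> \<Lambda>" "b \<in> \<Lambda>" shows "a * b \<in> \<Lambda>"
proof -
  have "fls_nth (a * b) i = 0" if "i > 0" for i
    unfolding fls_times_nth(2)
  proof (rule sum.neutral, rule ballI)
    fix j
    have "0 < j \<or> 0 < i - j" using that by linarith
    then show "fls_nth a j * fls_nth b (i - j) = 0"
      using assms by (auto simp: \<Lambda>_iff)
  qed
  then show ?thesis using assms by (simp add: \<Lambda>_iff F_mult)
qed

lemma \<Lambda>_sum: "(\<And>i. i \<in> I \<Longrightarrow> g i \<in> \<Lambda>) \<Longrightarrow> sum g I \<in> \<Lambda>"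
  by (induction I rule: infinite_finite_induct) (auto simp: \<Lambda>_add)

text \<open>
  The product of the lowest coefficients is nonzero because \<open>K\<close> has no zero divisors; over the
  whole coefficient type only \<open>fls_abs_mult_le\<close> holds.
\<close>

lemma fls_abs_mult:
  assumes "a \<in> F" "b \<in> F"
  shows "fls_abs (a * b) = fls_abs a * fls_abs b"
proof (cases "a = 0 \<or> b = 0")
  case False
  have nz: "fls_nth a (fls_subdegree a) * fls_nth b (fls_subdegree b) \<noteq> 0"
    using K_integral[of "fls_nth a (fls_subdegree a)" "fls_nth b (fls_subdegree b)"] False assms
    by (auto simp: F_iff)
  have "fls_nth (a * b) (fls_subdegree a + fls_subdegree b) = fls_nth a (fls_subdegree a) * fls_nth b (fls_subdegree b)"
    by (rule fls_times_base)
  then have "a * b \<noteq> 0" using nz by (metis fls_zero_nth)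
  then show ?thesis
    using fls_mult_nonzero_base_subdegree_eq[OF nz] False by (simp add: fls_abs_def flip: exp_add)
qed auto

lemma F_mult_eq_0: "a \<in> F \<Longrightarrow> b \<in> F \<Longrightarrow> a * b = 0 \<longleftrightarrow> a = 0 \<or> b = 0"
  using fls_abs_mult[of a b] by (metis fls_abs_eq_0_iff mult_eq_0_iff)

text \<open>
  A nonzero polynomial has a degree \<open>j \<ge> 0\<close>. All lower bounds for covolumes, and the existence of
  minimal ones, rest on this discreteness.
\<close>

lemma fls_abs_poly_eq_exp:
  assumes "a \<in> \<Lambda>" "a \<noteq> 0"
  shows "\<exists>j::nat. fls_abs a = exp (real j)"
proof -
  have "fls_subdegree a \<le> 0"
    using assms nth_fls_subdegree_nonzero[of a] by (meson \<Lambda>_iff linorder_not_less)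
  then have "fls_abs a = exp (real (nat (- fls_subdegree a)))"
    using assms by (simp add: fls_abs_def)
  then show ?thesis ..
qed

text \<open>
  The \<open>1\<close> of the field \<open>F\<close>, and a nonzero constant polynomial. The \<open>1\<close> of the type of series need
  not lie in \<open>F\<close>.
\<close>

definition unit_series :: "'k fls" where "unit_series = fls_const unit"

lemma unit_series_in_\<Lambda>: "unit_series \<in> \<Lambda>"
  by (auto simp: unit_series_def \<Lambda>_iff F_iff unit_in_K zero_in_K)

lemma unit_series_mult: "a \<in> F \<Longrightarrow> unit_series * a = a"
  by (intro fls_eqI) (simp add: unit_series_def F_iff unit_mult)

lemma unit_series_nonzero: "unit_series \<noteq> 0"
  by (simp add: unit_series_def unit_nonzero)

end

section \<open>Balls in a vector space of Laurent series\<close>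

locale series_space = coefficient_field K for K :: "'k::comm_ring_1 set" +
  fixes d :: nat
  assumes dim_pos: "1 \<le> d"
begin

abbreviation S where "S \<equiv> vec_space K d"
abbreviation X where "X \<equiv> vec_top K d"

text \<open>
  Every positive distance is an integral power of \<open>e\<close>, so the radii \<open>e\<^sup>k\<close> with an integer \<open>k\<close>
  exhaust the balls. Indexing by \<open>k\<close> makes "the largest ball with a property" meaningful.
\<close>

definition lball :: "(nat \<Rightarrow> 'k fls) \<Rightarrow> int \<Rightarrow> (nat \<Rightarrow> 'k fls) set" where
  "lball y k = vec_ball K d y (exp (real_of_int k))"

lemma vec_dist_less_iff: "vec_dist d x y < r \<longleftrightarrow> (\<forall>i\<in>{1..d}. fls_abs (x i - y i) < r)"
  using dim_pos unfolding vec_dist_def by (subst Max_less_iff) auto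

lemma vec_dist_le_iff: "vec_dist d x y \<le> r \<longleftrightarrow> (\<forall>i\<in>{1..d}. fls_abs (x i - y i) \<le> r)"
  using dim_pos unfolding vec_dist_def by (subst Max_le_iff) auto

lemma coord_le_vec_dist: "i \<in> {1..d} \<Longrightarrow> fls_abs (x i - y i) \<le> vec_dist d x y"
  using vec_dist_le_iff by blast

lemma Metric_space_vec: "Metric_space S (vec_dist d)"
proof
  fix x y z :: "nat \<Rightarrow> 'k fls"
  have "fls_abs (x 1 - y 1) \<le> vec_dist d x y" using dim_pos by (intro coord_le_vec_dist) auto
  then show "0 \<le> vec_dist d x y" using fls_abs_nonneg order_trans by blast
  show "vec_dist d x y = vec_dist d y x"
    by (simp add: vec_dist_def fls_abs_commute)
  show "vec_dist d x y = 0 \<longleftrightarrow> x = y" if "x \<in> S" "y \<in> S"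
  proof
    assume "vec_dist d x y = 0"
    then have "\<forall>i\<in>{1..d}. fls_abs (x i - y i) \<le> 0" by (metis vec_dist_le_iff order_refl)
    then have "x i = y i" if "i \<in> {1..d}" for i
      using that by (metis fls_abs_nonneg fls_abs_eq_0_iff antisym right_minus_eq)
    then show "x = y" using that by (intro PiE_ext[of x "{1..d}" "\<lambda>_. F" y]) (auto simp: vec_space_def)
  next
    assume "x = y"
    then have "vec_dist d x y \<le> 0" by (simp add: vec_dist_le_iff)
    moreover have "fls_abs (x 1 - y 1) \<le> vec_dist d x y"
      using dim_pos by (intro coord_le_vec_dist) auto
    ultimately show "vec_dist d x y = 0" using fls_abs_nonneg[of "x 1 - y 1"] by linarith
  qed
  show "vec_dist d x z \<le> vec_dist d x y + vec_dist d y z"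
    unfolding vec_dist_le_iff
  proof
    fix i assume i: "i \<in> {1..d}"
    have "fls_abs (x i - z i) \<le> max (fls_abs (x i - y i)) (fls_abs (y i - z i))"
      using fls_abs_add_le[of "x i - y i" "y i - z i"] by simp
    also have "\<dots> \<le> vec_dist d x y + vec_dist d y z"
      using coord_le_vec_dist[OF i, of x y] coord_le_vec_dist[OF i, of y z]
        fls_abs_nonneg[of "x i - y i"] fls_abs_nonneg[of "y i - z i"] by linarith
    finally show "fls_abs (x i - z i) \<le> vec_dist d x y + vec_dist d y z" .
  qed
qed

sublocale M: Metric_space S "vec_dist d"
  by (rule Metric_space_vec)

lemma X_eq: "X = M.mtopology" and vec_ball_eq: "vec_ball K d y r = M.mball y r"
  by (simp_all add: vec_top_def vec_ball_def)

lemma topspace_X [simp]: "topspace X = S"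
  by (simp add: X_eq)

lemma in_lball_iff:
  "z \<in> lball y k \<longleftrightarrow> y \<in> S \<and> z \<in> S \<and> (\<forall>i\<in>{1..d}. \<forall>j\<le>-k. fls_nth (y i) j = fls_nth (z i) j)"
  by (simp add: lball_def vec_ball_eq vec_dist_less_iff fls_abs_less_exp_iff)

lemma lball_subset: "lball y k \<subseteq> S"
  by (auto simp: in_lball_iff)

lemma centre_in_lball: "y \<in> S \<Longrightarrow> y \<in> lball y k"
  by (simp add: in_lball_iff)

lemma lball_eq: "z \<in> lball y k \<Longrightarrow> lball z k = lball y k"
  by (auto simp: in_lball_iff)

lemma lball_mono: "k \<le> l \<Longrightarrow> lball y k \<subseteq> lball y l"
  by (auto simp: in_lball_iff)

lemma openin_lball: "openin X (lball y k)"
  by (simp add: X_eq lball_def vec_ball_eq)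

lemma exp_le_ex: "0 < r \<Longrightarrow> \<exists>k\<le>k0. exp (real_of_int k) \<le> r"
proof -
  assume r: "0 < r"
  define k where "k = min k0 \<lfloor>ln r\<rfloor>"
  have "real_of_int k \<le> ln r" unfolding k_def by linarith
  then have "exp (real_of_int k) \<le> r" using r by (metis exp_le_cancel_iff exp_ln)
  then show ?thesis using k_def by (intro exI[of _ k]) auto
qed

lemma openin_iff_lball:
  "openin X V \<longleftrightarrow> V \<subseteq> S \<and> (\<forall>x\<in>V. \<exists>k\<le>k0. lball x k \<subseteq> V)"
proof -
  have "(\<exists>r>0. M.mball x r \<subseteq> V) \<longleftrightarrow> (\<exists>k\<le>k0. lball x k \<subseteq> V)" for x
    unfolding lball_def vec_ball_eq
    using exp_le_ex M.mball_subset_concentric exp_gt_zero by (meson order_trans)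
  then show ?thesis unfolding X_eq M.openin_mtopology by auto
qed

text \<open>
  The smaller ball is determined by the coefficients of its centre with an index in \<open>(-k, -m]\<close>,
  for which the finite field leaves finitely many choices.
\<close>

lemma finite_sub_lballs: "finite ((\<lambda>z. lball z m) ` lball y k)"
proof -
  define g where "g z = (\<lambda>i\<in>{1..d}. \<lambda>j\<in>{-k<..-m}. fls_nth (z i) j)" for z :: "nat \<Rightarrow> 'k fls"
  have "g ` lball y k \<subseteq> ({1..d} \<rightarrow>\<^sub>E ({-k<..-m} \<rightarrow>\<^sub>E K))"
    by (auto simp: g_def in_lball_iff vec_space_def PiE_def Pi_def F_iff)
  then have fin: "finite (g ` lball y k)"
    by (rule finite_subset) (intro finite_PiE finite_K; simp)
  have "lball z m = lball z' m" if z: "z \<in> lball y k" "z' \<in> lball y k" and g: "g z = g z'" for z z'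
  proof (rule lball_eq[symmetric], unfold in_lball_iff, intro conjI ballI allI impI)
    fix i j assume i: "i \<in> {1..d}" and j: "j \<le> -m"
    show "fls_nth (z i) j = fls_nth (z' i) j"
    proof (cases "j \<le> -k")
      case True
      then show ?thesis using z i by (auto simp: in_lball_iff)
    next
      case False
      have "g z i j = g z' i j" using g by simp
      then show ?thesis using False i j by (simp add: g_def)
    qed
  qed (use z in \<open>auto simp: in_lball_iff\<close>)
  then have "lball z m = lball (SOME z'. z' \<in> lball y k \<and> g z' = g z) m" if "z \<in> lball y k" for z
    using that someI[of "\<lambda>z'. z' \<in> lball y k \<and> g z' = g z" z] by metis
  then have "(\<lambda>z. lball z m) ` lball y k
      \<subseteq> (\<lambda>c. lball (SOME z'. z' \<in> lball y k \<and> g z' = c) m) ` (g ` lball y k)"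
    by auto
  then show ?thesis using fin by (meson finite_imageI finite_subset)
qed

lemma S_eq_Union_lball: "\<exists>y\<in>S. S = (\<Union>N::nat. lball y (int N))"
proof
  define o' :: "nat \<Rightarrow> 'k fls" where "o' = (\<lambda>i\<in>{1..d}. 0)"
  show o': "o' \<in> S" by (auto simp: o'_def vec_space_def)
  show "S = (\<Union>N::nat. lball o' (int N))"
  proof (intro equalityI subsetI)
    fix z assume z: "z \<in> S"
    define N where "N = (\<Sum>i\<in>{1..d}. nat (1 - fls_subdegree (z i)))"
    have "fls_nth (z i) j = 0" if "i \<in> {1..d}" "j \<le> - int N" for i j
    proof -
      have "nat (1 - fls_subdegree (z i)) \<le> N"
        unfolding N_def using that by (intro member_le_sum) auto
      then show ?thesis using that by (intro fls_eq0_below_subdegree) linarith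
    qed
    then have "z \<in> lball o' (int N)" using z o' by (simp add: in_lball_iff o'_def)
    then show "z \<in> (\<Union>N::nat. lball o' (int N))" by blast
  qed (auto simp: in_lball_iff)
qed

lemma countable_lballs: "countable {lball z k | z k. z \<in> S}"
proof -
  obtain y where y: "S = (\<Union>N::nat. lball y (int N))" using S_eq_Union_lball by blast
  have "{lball z k | z k. z \<in> S} = (\<Union>k. \<Union>N::nat. (\<lambda>z. lball z k) ` lball y (int N))"
    by (subst y) auto
  then show ?thesis using finite_sub_lballs by (simp add: countable_finite)
qed

text \<open>
  The limit of a Cauchy sequence is taken coefficient by coefficient: the coefficient with index
  \<open>j\<close> no longer changes after the position \<open>N (nat j)\<close>. For \<open>j \<le> 0\<close> this is the position \<open>N 0\<close>,
  independent of \<open>j\<close>, and therefore the limit has only finitely many coefficients of negative index.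
\<close>

lemma mcomplete: "M.mcomplete"
  unfolding M.mcomplete_def
proof (intro allI impI)
  fix \<sigma> assume c: "M.MCauchy \<sigma>"
  have \<sigma>S: "\<sigma> m \<in> S" for m using c by (auto simp: M.MCauchy_def)
  have "\<exists>N. \<forall>m\<ge>N. \<forall>m'\<ge>N. vec_dist d (\<sigma> m) (\<sigma> m') < exp (real_of_int (- int k))" for k
    using c by (simp add: M.MCauchy_def)
  then obtain N where N: "\<And>k m m'. m \<ge> N k \<Longrightarrow> m' \<ge> N k \<Longrightarrow>
      vec_dist d (\<sigma> m) (\<sigma> m') < exp (real_of_int (- int k))" by metis
  have N: "fls_nth (\<sigma> m i) j = fls_nth (\<sigma> m' i) j"
    if "m \<ge> N k" "m' \<ge> N k" "i \<in> {1..d}" "j \<le> int k" for k m m' i j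
    using N[OF that(1,2)] that(3,4) unfolding vec_dist_less_iff fls_abs_less_exp_iff by auto
  define x where "x = (\<lambda>i\<in>{1..d}. Abs_fls (\<lambda>j. fls_nth (\<sigma> (N (nat j)) i) j))"
  have x: "fls_nth (x i) j = fls_nth (\<sigma> (N (nat j)) i) j" if i: "i \<in> {1..d}" for i j
  proof -
    have "\<forall>j<min 0 (fls_subdegree (\<sigma> (N 0) i)). fls_nth (\<sigma> (N (nat j)) i) j = 0"
      by simp
    then show ?thesis using i nth_Abs_fls_lower_bound by (simp add: x_def)
  qed
  have xS: "x \<in> S"
    using \<sigma>S x by (auto simp: vec_space_def F_iff x_def[abs_def] PiE_def Pi_def)
  have conv: "vec_dist d (\<sigma> m) x < exp (real_of_int (- int k))" if m: "m \<ge> N k" for m k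
    unfolding vec_dist_less_iff fls_abs_less_exp_iff
  proof (intro ballI allI impI)
    fix i j assume i: "i \<in> {1..d}" and "j \<le> - (- int k)"
    then have j: "j \<le> int k" by simp
    let ?m = "max m (N (nat j))"
    have "fls_nth (\<sigma> m i) j = fls_nth (\<sigma> ?m i) j" using m i j by (intro N[of k]) auto
    also have "\<dots> = fls_nth (\<sigma> (N (nat j)) i) j" using i by (intro N[of "nat j"]) auto
    finally show "fls_nth (\<sigma> m i - x i) j = 0" using x[OF i] by simp
  qed
  have "limitin M.mtopology \<sigma> x sequentially"
    unfolding M.limitin_metric
  proof (intro conjI allI impI xS)
    fix r :: real assume "0 < r"
    then obtain k where k: "k \<le> 0" "exp (real_of_int k) \<le> r" using exp_le_ex by blast
    then have "vec_dist d (\<sigma> m) x < r" if "m \<ge> N (nat (- k))" for m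
      using conv[OF that] by simp
    then show "\<forall>\<^sub>F m in sequentially. \<sigma> m \<in> S \<and> vec_dist d (\<sigma> m) x < r"
      using \<sigma>S eventually_sequentially by auto
  qed
  then show "\<exists>x. limitin M.mtopology \<sigma> x sequentially" by blast
qed

lemma mtotally_bounded_lball: "M.mtotally_bounded (lball y k)"
  unfolding M.mtotally_bounded_def
proof (intro allI impI)
  fix r :: real assume "0 < r"
  then obtain m where m: "exp (real_of_int m) \<le> r" using exp_le_ex by blast
  obtain C where C: "C \<subseteq> lball y k" "finite C" "(\<lambda>z. lball z m) ` lball y k = (\<lambda>z. lball z m) ` C"
    using finite_subset_image[OF finite_sub_lballs subset_refl] by metis
  have "lball y k \<subseteq> (\<Union>x\<in>C. lball x m)"
  proof
    fix z assume z: "z \<in> lball y k"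
    then have "z \<in> lball z m" using lball_subset centre_in_lball by blast
    then show "z \<in> (\<Union>x\<in>C. lball x m)" using C(3) z by blast
  qed
  also have "\<dots> \<subseteq> (\<Union>x\<in>C. M.mball x r)"
    using M.mball_subset_concentric[OF m] by (fastforce simp: lball_def vec_ball_eq)
  finally show "\<exists>C. finite C \<and> C \<subseteq> lball y k \<and> lball y k \<subseteq> (\<Union>x\<in>C. M.mball x r)"
    using C by blast
qed

text \<open>
  Balls are totally bounded in a complete space. This is what makes Radon measures finite on balls.
\<close>

lemma lball_subset_compact: "\<exists>C. compactin X C \<and> lball y k \<subseteq> C"
  using mtotally_bounded_lball M.mtotally_bounded_eq_compact_closure_of[OF mcomplete]
    closure_of_subset[of "lball y k" X] lball_subset unfolding X_eq by (metis X_eq topspace_X)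

end

section \<open>Coverings by maximal balls and sets of small density\<close>

lemma ex_maximal_int:
  fixes kmax :: int
  assumes "\<exists>k\<le>kmax. P k"
  shows "\<exists>k\<le>kmax. P k \<and> (\<forall>j. k < j \<longrightarrow> j \<le> kmax \<longrightarrow> \<not> P j)"
proof -
  obtain k where k: "k \<le> kmax" "P k" using assms by blast
  let ?R = "\<lambda>m. P (kmax - int m)"
  have ex: "?R (nat (kmax - k))" using k by simp
  define m where "m = (LEAST m. ?R m)"
  have "?R m" unfolding m_def by (rule LeastI[of ?R, OF ex])
  moreover have "\<not> P j" if "kmax - int m < j" "j \<le> kmax" for j
    using not_less_Least[of "nat (kmax - j)" ?R] that unfolding m_def by auto
  ultimately show ?thesis by (intro exI[of _ "kmax - int m"]) auto
qed

locale radon_series_space = series_space K d for K :: "'k::comm_ring_1 set" and d :: nat +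
  fixes \<nu> :: "(nat \<Rightarrow> 'k fls) measure"
  assumes radon: "radon_measure X \<nu>"
begin

abbreviation supp where "supp \<equiv> measure_supp X \<nu>"

lemma space_\<nu> [simp]: "space \<nu> = S"
  using radon by (simp add: radon_measure_def)

lemma open_sets: "openin X V \<Longrightarrow> V \<in> sets \<nu>"
  using radon by (auto simp: radon_measure_def)

lemma lball_sets [measurable]: "lball y k \<in> sets \<nu>"
  using openin_lball open_sets by blast

lemma supp_subset: "supp \<subseteq> S"
  by (auto simp: measure_supp_def)

lemma lball_finite: "emeasure \<nu> (lball y k) < \<infinity>"
proof -
  obtain C where C: "compactin X C" "lball y k \<subseteq> C" using lball_subset_compact by blast
  have "closedin X C"
    using C compactin_imp_closedin M.Hausdorff_space_mtopology by (metis X_eq)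
  then have "C = S - (S - C)" "openin X (S - C)"
    using closedin_subset[of X C] by (auto simp: closedin_def)
  then have "C \<in> sets \<nu>" using open_sets sets.compl_sets by (metis space_\<nu>)
  then have "emeasure \<nu> (lball y k) \<le> emeasure \<nu> C" using C emeasure_mono by blast
  also have "\<dots> < \<infinity>" using radon C by (simp add: radon_measure_def)
  finally show ?thesis .
qed

text \<open>
  Each point outside the support lies in a ball of measure zero, and there are only countably many
  balls.
\<close>

lemma null_outside_supp: "S - supp \<in> null_sets \<nu>"
proof -
  define N where "N = {B \<in> {lball z k | z k. z \<in> S}. emeasure \<nu> B = 0}"
  have "S - supp = \<Union>N"
  proof (intro equalityI subsetI)
    fix x assume x: "x \<in> S - supp"
    then obtain V where V: "openin X V" "x \<in> V" "emeasure \<nu> V = 0"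
      by (auto simp: measure_supp_def)
    then obtain k where k: "lball x k \<subseteq> V" using openin_iff_lball[of V] by blast
    have "emeasure \<nu> (lball x k) \<le> emeasure \<nu> V"
      using k V open_sets by (intro emeasure_mono) auto
    then show "x \<in> \<Union>N" using x V centre_in_lball by (auto simp: N_def)
  next
    fix x assume "x \<in> \<Union>N"
    then obtain z k where "x \<in> lball z k" "emeasure \<nu> (lball z k) = 0" by (auto simp: N_def)
    then show "x \<in> S - supp" using openin_lball[of z k] lball_subset
      by (auto simp: measure_supp_def)
  qed
  moreover have "countable N" using countable_lballs by (rule countable_subset[rotated]) (auto simp: N_def)
  moreover have "B \<in> null_sets \<nu>" if "B \<in> N" for B
    using that by (auto simp: N_def)
  ultimately show ?thesis
    using null_sets_UN'[of N "\<lambda>B. B" \<nu>] by simp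
qed

lemma supp_sets [measurable]: "supp \<in> sets \<nu>"
  using null_outside_supp sets.compl_sets[of "S - supp" \<nu>] supp_subset
  by (simp add: double_diff null_sets_def)

text \<open>
  Attach to each point of \<open>E\<close> the largest ball around it, of level at most \<open>kmax\<close>, that satisfies
  \<open>Q\<close>. If \<open>z\<close> lies in the ball of \<open>y\<close>, then from this level on the balls around \<open>z\<close> and \<open>y\<close>
  coincide, so \<open>z\<close> gets the same ball. Hence different balls of the family are disjoint, and an
  estimate that holds in each of them can be summed.
\<close>

lemma maximal_ball_cover:
  assumes E: "E \<subseteq> S" and ex: "\<And>y. y \<in> E \<Longrightarrow> \<exists>k\<le>kmax. Q (lball y k)"
    and V: "V \<in> sets \<nu>"
    and max: "\<And>y k. y \<in> E \<Longrightarrow> k \<le> kmax \<Longrightarrow> Q (lball y k) \<Longrightarrow>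
       (\<And>j. k < j \<Longrightarrow> j \<le> kmax \<Longrightarrow> \<not> Q (lball y j)) \<Longrightarrow> lball y k \<subseteq> V \<and>
       (\<exists>N\<in>sets \<nu>. E \<inter> lball y k \<subseteq> N \<and> emeasure \<nu> N \<le> c * emeasure \<nu> (lball y k))"
  shows "\<exists>N\<in>sets \<nu>. E \<subseteq> N \<and> emeasure \<nu> N \<le> c * emeasure \<nu> V"
proof -
  let ?max = "\<lambda>y k. k \<le> kmax \<and> Q (lball y k) \<and> (\<forall>j. k < j \<longrightarrow> j \<le> kmax \<longrightarrow> \<not> Q (lball y j))"
  have "\<exists>k. ?max y k" if "y \<in> E" for y
    using ex_maximal_int[OF ex[OF that]] by blast
  then obtain \<kappa> where \<kappa>: "\<And>y. y \<in> E \<Longrightarrow> ?max y (\<kappa> y)" by metis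
  have same: "\<kappa> z = \<kappa> y"
    if y: "y \<in> E" and z: "z \<in> E" and zy: "z \<in> lball y (\<kappa> y)" for y z
  proof (rule antisym)
    have eq: "lball z j = lball y j" if "\<kappa> y \<le> j" for j
      using lball_eq[of z y j] lball_mono[OF that] zy by blast
    show "\<kappa> y \<le> \<kappa> z"
      using \<kappa>[OF z] \<kappa>[OF y] eq[of "\<kappa> y"] by (metis linorder_not_less order_refl)
    show "\<kappa> z \<le> \<kappa> y"
      using \<kappa>[OF z] \<kappa>[OF y] eq[of "\<kappa> z"] by (metis linorder_not_less less_imp_le)
  qed
  define \<B> where "\<B> = (\<lambda>y. lball y (\<kappa> y)) ` E"
  have cnt: "countable \<B>"
    using countable_lballs by (rule countable_subset[rotated]) (use E in \<open>auto simp: \<B>_def\<close>)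
  have disj: "B = B'" if B: "B \<in> \<B>" "B' \<in> \<B>" and meet: "B \<inter> B' \<inter> E \<noteq> {}" for B B'
  proof -
    obtain y y' z where "y \<in> E" "B = lball y (\<kappa> y)" "y' \<in> E" "B' = lball y' (\<kappa> y')"
      "z \<in> B" "z \<in> B'" "z \<in> E" using B meet unfolding \<B>_def by blast
    then show ?thesis using same lball_eq by metis
  qed
  have disj': "B = B'" if B: "B \<in> \<B>" "B' \<in> \<B>" and meet: "B \<inter> B' \<noteq> {}" for B B'
  proof -
    obtain y y' z where y: "y \<in> E" "B = lball y (\<kappa> y)" "y' \<in> E" "B' = lball y' (\<kappa> y')"
      "z \<in> B" "z \<in> B'" using B meet unfolding \<B>_def by blast
    then have "lball z (\<kappa> y) = B" "lball z (\<kappa> y') = B'" using lball_eq by auto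
    then have "B \<subseteq> B' \<or> B' \<subseteq> B"
      using lball_mono[of "\<kappa> y" "\<kappa> y'" z] lball_mono[of "\<kappa> y'" "\<kappa> y" z] linear by metis
    moreover have "y \<in> B" "y' \<in> B'" using y E centre_in_lball by blast+
    ultimately have "B \<inter> B' \<inter> E \<noteq> {}" using y by blast
    then show ?thesis using disj B by blast
  qed
  have "\<exists>N\<in>sets \<nu>. E \<inter> B \<subseteq> N \<and> emeasure \<nu> N \<le> c * emeasure \<nu> B" if "B \<in> \<B>" for B
    using that max \<kappa> unfolding \<B>_def by blast
  then obtain N where N: "\<And>B. B \<in> \<B> \<Longrightarrow> N B \<in> sets \<nu> \<and> E \<inter> B \<subseteq> N B \<and>
      emeasure \<nu> (N B) \<le> c * emeasure \<nu> B" by metis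
  have \<B>_sets: "B \<in> sets \<nu>" if "B \<in> \<B>" for B using that by (auto simp: \<B>_def)
  let ?N = "\<Union>B\<in>\<B>. N B \<inter> B"
  have fam: "disjoint_family_on (\<lambda>B. N B \<inter> B) \<B>" "disjoint_family_on (\<lambda>B. B) \<B>"
    using disj' unfolding disjoint_family_on_def by blast+
  have "emeasure \<nu> ?N = (\<integral>\<^sup>+B. emeasure \<nu> (N B \<inter> B) \<partial>count_space \<B>)"
    using N \<B>_sets cnt fam by (intro emeasure_UN_countable) auto
  also have "\<dots> \<le> (\<integral>\<^sup>+B. c * emeasure \<nu> B \<partial>count_space \<B>)"
  proof (intro nn_integral_mono)
    fix B assume "B \<in> space (count_space \<B>)"
    then have B: "B \<in> \<B>" by simp
    have "emeasure \<nu> (N B \<inter> B) \<le> emeasure \<nu> (N B)" using N B by (intro emeasure_mono) auto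
    then show "emeasure \<nu> (N B \<inter> B) \<le> c * emeasure \<nu> B" using N B order_trans by blast
  qed
  also have "\<dots> = c * (\<integral>\<^sup>+B. emeasure \<nu> B \<partial>count_space \<B>)"
    by (intro nn_integral_cmult) auto
  also have "(\<integral>\<^sup>+B. emeasure \<nu> B \<partial>count_space \<B>) = emeasure \<nu> (\<Union>B\<in>\<B>. B)"
    using \<B>_sets cnt fam by (intro emeasure_UN_countable[symmetric]) auto
  also have "\<dots> \<le> emeasure \<nu> V"
    using max \<kappa> V by (intro emeasure_mono) (force simp: \<B>_def)+
  finally have "emeasure \<nu> ?N \<le> c * emeasure \<nu> V" by (simp add: mult_left_mono)
  moreover have "?N \<in> sets \<nu>"
    using N \<B>_sets cnt by (intro sets.countable_UN') auto
  moreover have "E \<subseteq> ?N"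
  proof
    fix y assume y: "y \<in> E"
    then have "y \<in> lball y (\<kappa> y)" "lball y (\<kappa> y) \<in> \<B>" using E centre_in_lball by (auto simp: \<B>_def)
    then show "y \<in> ?N" using N y by blast
  qed
  ultimately show ?thesis by blast
qed

text \<open>
  An open set \<open>V\<close> around the part of \<open>A\<close> in a ball is exhausted by disjoint balls, and in each of
  them \<open>A\<close> has at most half the measure; so this part of \<open>A\<close> has at most half the measure of \<open>V\<close>. By outer
  regularity the measure of \<open>V\<close> can be chosen arbitrarily close to the measure of that part, which is finite.
\<close>

lemma null_set_if_sparse:
  assumes U: "openin X U" and A: "A \<in> sets \<nu>" "A \<subseteq> U"
    and half: "\<And>y k. y \<in> supp \<Longrightarrow> lball y k \<subseteq> U \<Longrightarrow>
      emeasure \<nu> (A \<inter> lball y k) \<le> ennreal (1/2) * emeasure \<nu> (lball y k)"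
  shows "A \<in> null_sets \<nu>"
proof -
  have null: "A \<inter> lball x k \<in> null_sets \<nu>" if xU: "lball x k \<subseteq> U" for x k
  proof -
    let ?A = "A \<inter> lball x k"
    have Am: "?A \<in> sets \<nu>" using A by auto
    have fin: "emeasure \<nu> ?A < \<infinity>"
      using lball_finite[of x k] emeasure_mono[of ?A "lball x k" \<nu>] by (simp add: order_le_less_trans)
    have key: "emeasure \<nu> ?A \<le> ennreal (1/2) * emeasure \<nu> V" if V: "openin X V" "?A \<subseteq> V" for V
    proof -
      let ?V = "V \<inter> lball x k"
      have Vo: "openin X ?V" using V openin_lball by blast
      have "\<exists>N\<in>sets \<nu>. ?A \<inter> supp \<subseteq> N \<and> emeasure \<nu> N \<le> ennreal (1/2) * emeasure \<nu> ?V"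
      proof (rule maximal_ball_cover[where kmax = 0 and Q = "\<lambda>B. B \<subseteq> ?V"])
        show "?A \<inter> supp \<subseteq> S" using supp_subset by blast
        show "?V \<in> sets \<nu>" using Vo open_sets by blast
        show "\<exists>k\<le>0. lball y k \<subseteq> ?V" if "y \<in> ?A \<inter> supp" for y
          using that V Vo openin_iff_lball[of ?V 0] by blast
        show "lball y j \<subseteq> ?V \<and> (\<exists>N\<in>sets \<nu>. ?A \<inter> supp \<inter> lball y j \<subseteq> N \<and>
            emeasure \<nu> N \<le> ennreal (1/2) * emeasure \<nu> (lball y j))"
          if "y \<in> ?A \<inter> supp" "lball y j \<subseteq> ?V" for y j
          using that xU half[of y j] A by (intro conjI bexI[of _ "A \<inter> lball y j"]) auto
      qed
      then obtain N where N: "N \<in> sets \<nu>" "?A \<inter> supp \<subseteq> N"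
        "emeasure \<nu> N \<le> ennreal (1/2) * emeasure \<nu> ?V" by blast
      have "?A \<subseteq> N \<union> (S - supp)" using N lball_subset by blast
      then have "emeasure \<nu> ?A \<le> emeasure \<nu> (N \<union> (S - supp))"
        using N null_outside_supp by (intro emeasure_mono) auto
      also have "\<dots> = emeasure \<nu> N" using N null_outside_supp by (intro emeasure_Un_null_set)
      also have "\<dots> \<le> ennreal (1/2) * emeasure \<nu> ?V" by (rule N)
      also have "\<dots> \<le> ennreal (1/2) * emeasure \<nu> V"
        using V open_sets by (intro mult_left_mono emeasure_mono) auto
      finally show ?thesis .
    qed
    have "emeasure \<nu> ?A = 0"
    proof (rule ccontr)
      assume nz: "emeasure \<nu> ?A \<noteq> 0"
      obtain a where a: "emeasure \<nu> ?A = ennreal a" "0 \<le> a"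
        using fin by (cases "emeasure \<nu> ?A") auto
      then have "0 < a" using nz by (cases "a = 0") auto
      have outer: "emeasure \<nu> ?A = (INF V\<in>{V. openin X V \<and> ?A \<subseteq> V}. emeasure \<nu> V)"
        using radon Am unfolding radon_measure_def by blast
      have "emeasure \<nu> ?A < ennreal (2 * a)"
        unfolding a using \<open>0 < a\<close> by (intro ennreal_lessI) auto
      then have "(INF V\<in>{V. openin X V \<and> ?A \<subseteq> V}. emeasure \<nu> V) < ennreal (2 * a)"
        unfolding outer .
      then obtain V where V: "openin X V" "?A \<subseteq> V" "emeasure \<nu> V < ennreal (2 * a)"
        unfolding INF_less_iff by blast
      then obtain v where v: "emeasure \<nu> V = ennreal v" "0 \<le> v" by (cases "emeasure \<nu> V") auto
      have "v < 2 * a" using V(3) v \<open>0 < a\<close> by (simp add: ennreal_less_iff)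
      moreover have "ennreal a \<le> ennreal (1/2 * v)"
        using key[OF V(1,2)] unfolding a v by (subst ennreal_mult') (use v in auto)
      then have "a \<le> 1/2 * v" using v by (simp add: ennreal_le_iff)
      ultimately show False by simp
    qed
    then show ?thesis using Am by blast
  qed
  let ?\<B> = "{B \<in> {lball z k | z k. z \<in> S}. B \<subseteq> U}"
  have "A = (\<Union>B\<in>?\<B>. A \<inter> B)"
  proof (intro equalityI subsetI)
    fix x assume x: "x \<in> A"
    then obtain k where k: "lball x k \<subseteq> U" using U A openin_iff_lball[of U] by blast
    have "x \<in> S" using x A U openin_subset by fastforce
    then show "x \<in> (\<Union>B\<in>?\<B>. A \<inter> B)" using x k centre_in_lball by blast
  qed auto
  moreover have "countable ?\<B>"
    by (rule countable_subset[OF _ countable_lballs]) blast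
  then have "(\<Union>B\<in>?\<B>. A \<inter> B) \<in> null_sets \<nu>"
    using null by (intro null_sets_UN') auto
  ultimately show ?thesis by simp
qed

end

section \<open>Quantitative nondivergence for families of functions\<close>

text \<open>
  For comparability of subspaces a clique is a flag. The induction below works for any symmetric
  relation.
\<close>

definition clique :: "('s \<Rightarrow> 's \<Rightarrow> bool) \<Rightarrow> 's set \<Rightarrow> bool" where
  "clique cmp \<Sigma> \<longleftrightarrow> finite \<Sigma> \<and> (\<forall>s\<in>\<Sigma>. \<forall>t\<in>\<Sigma>. s \<noteq> t \<longrightarrow> cmp s t)"

text \<open>
  The members of the witness \<open>\<Sigma>\<close> are small at \<open>x\<close> but not too small, and \<open>\<Sigma>\<close> cannot be extended
  by a small member.
\<close>

definition marked ::
    "('s \<Rightarrow> 's \<Rightarrow> bool) \<Rightarrow> ('s \<Rightarrow> 'a \<Rightarrow> real) \<Rightarrow> real \<Rightarrow> 's set \<Rightarrow> 'a \<Rightarrow> bool" where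
  "marked cmp \<psi> \<epsilon> P x \<longleftrightarrow> (\<exists>\<Sigma>\<subseteq>P. clique cmp \<Sigma> \<and> (\<forall>s\<in>\<Sigma>. \<epsilon> \<le> \<psi> s x \<and> \<psi> s x < 1) \<and>
     (\<forall>s\<in>P - \<Sigma>. (\<forall>t\<in>\<Sigma>. cmp s t) \<longrightarrow> 1 \<le> \<psi> s x))"

context radon_series_space
begin

text \<open>
  Induction on the bound \<open>m\<close> for the size of cliques. An unmarked point \<open>y\<close> has a member of \<open>P\<close>
  that is less than \<open>1\<close> at \<open>y\<close>. Let \<open>lball y k\<close> be the largest ball on which some member \<open>s\<close> stays
  less than \<open>1\<close> on the support. In \<open>lball y (k + 1)\<close> every member reaches \<open>1\<close>. So the induction
  hypothesis applies there to the members comparable with \<open>s\<close>, and goodness bounds the set where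
  \<open>s\<close> is less than \<open>\<epsilon>\<close>. Outside these two sets a witness for the smaller family becomes a witness
  for \<open>P\<close> by adding \<open>s\<close>. Passing from \<open>lball y (k + 1)\<close> back to \<open>lball y k\<close> costs the factor \<open>D\<close>,
  and the maximal balls are disjoint. The unmarked points are only enclosed in a measurable set
  \<open>N\<close>, because \<open>P\<close> may be uncountable.
\<close>

lemma nondivergence:
  fixes \<psi> :: "'s \<Rightarrow> (nat \<Rightarrow> 'k fls) \<Rightarrow> real"
  assumes D: "0 \<le> D" and c: "0 \<le> c" and \<epsilon>: "0 < \<epsilon>" and sym: "\<And>s t. cmp s t \<Longrightarrow> cmp t s"
    and double: "\<And>y k. y \<in> supp \<Longrightarrow> lball y (k + 1) \<subseteq> U \<Longrightarrow>
      emeasure \<nu> (lball y (k + 1)) \<le> ennreal D * emeasure \<nu> (lball y k)"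
    and open_less: "\<And>s \<delta>. s \<in> P \<Longrightarrow> 0 < \<delta> \<Longrightarrow> openin X {x \<in> U. \<psi> s x < \<delta>}"
    and good: "\<And>s y k z. s \<in> P \<Longrightarrow> y \<in> supp \<Longrightarrow> lball y k \<subseteq> U \<Longrightarrow> z \<in> lball y k \<inter> supp \<Longrightarrow>
      1 \<le> \<psi> s z \<Longrightarrow> emeasure \<nu> {x \<in> lball y k. \<psi> s x < \<epsilon>} \<le> ennreal c * emeasure \<nu> (lball y k)"
    and card: "\<And>\<Sigma>. \<Sigma> \<subseteq> P \<Longrightarrow> clique cmp \<Sigma> \<Longrightarrow> card \<Sigma> \<le> m"
    and y0: "y0 \<in> supp" "lball y0 k0 \<subseteq> U"
    and large: "\<And>s. s \<in> P \<Longrightarrow> \<exists>z\<in>lball y0 k0 \<inter> supp. 1 \<le> \<psi> s z"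
  shows "\<exists>N\<in>sets \<nu>. {x \<in> lball y0 k0 \<inter> supp. \<not> marked cmp \<psi> \<epsilon> P x} \<subseteq> N \<and>
    emeasure \<nu> N \<le> ennreal (c * (\<Sum>i=1..m. D ^ i)) * emeasure \<nu> (lball y0 k0)"
  using open_less good card y0 large
proof (induction m arbitrary: P y0 k0)
  case 0
  have "P = {}"
  proof (rule ccontr)
    assume "P \<noteq> {}"
    then obtain s where "s \<in> P" by blast
    then show False using "0.prems"(3)[of "{s}"] by (auto simp: clique_def)
  qed
  then have "marked cmp \<psi> \<epsilon> P x" for x by (auto simp: marked_def clique_def)
  then show ?case by (intro bexI[of _ "{}"]) auto
next
  case (Suc m P y0 k0)
  note open_less = Suc.prems(1) and good = Suc.prems(2) and card = Suc.prems(3)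
    and y0 = Suc.prems(4,5) and large = Suc.prems(6)
  let ?E = "{x \<in> lball y0 k0 \<inter> supp. \<not> marked cmp \<psi> \<epsilon> P x}"
  let ?Q = "\<lambda>B. \<exists>s\<in>P. \<forall>z\<in>B \<inter> supp. \<psi> s z < 1"
  let ?c = "\<lambda>m. c * (\<Sum>i=1..m. D ^ i)"
  have c_nonneg: "0 \<le> ?c m" for m using c D by (intro mult_nonneg_nonneg sum_nonneg) auto
  show ?case
  proof (rule maximal_ball_cover[where kmax = k0 and Q = ?Q])
    show "?E \<subseteq> S" using lball_subset by blast
    show "lball y0 k0 \<in> sets \<nu>" by simp
    show "\<exists>k\<le>k0. ?Q (lball y k)" if y: "y \<in> ?E" for y
    proof -
      have "marked cmp \<psi> \<epsilon> P y" if "\<forall>s\<in>P. 1 \<le> \<psi> s y"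
        unfolding marked_def using that by (intro exI[of _ "{}"]) (simp add: clique_def)
      then have "\<not> (\<forall>s\<in>P. 1 \<le> \<psi> s y)" using y by blast
      then have "\<exists>s\<in>P. \<psi> s y < 1" by (simp add: not_le)
      then obtain s where s: "s \<in> P" "\<psi> s y < 1" by blast
      have "y \<in> {x \<in> U. \<psi> s x < 1}" using y s y0 by auto
      then obtain k where "k \<le> k0" "lball y k \<subseteq> {x \<in> U. \<psi> s x < 1}"
        using open_less[of s 1] s(1) openin_iff_lball[of "{x \<in> U. \<psi> s x < 1}" k0] by auto
      then show ?thesis using s by blast
    qed
    fix y k assume y: "y \<in> ?E" and k: "k \<le> k0" and Q: "?Q (lball y k)"
      and max: "\<And>j. k < j \<Longrightarrow> j \<le> k0 \<Longrightarrow> \<not> ?Q (lball y j)"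
    have eq0: "lball y k0 = lball y0 k0" using y lball_eq by blast
    have sub: "lball y k \<subseteq> lball y0 k0" using lball_mono[OF k] eq0 by blast
    \<comment> \<open>The whole ball contains points where the members of \<open>P\<close> are at least \<open>1\<close>, so the maximal ball is smaller.\<close>
    have "\<not> ?Q (lball y k0)" unfolding eq0 using large by (metis not_le)
    then have "k \<noteq> k0" using Q by blast
    then have k1: "k + 1 \<le> k0" using k by simp
    have sub': "lball y (k + 1) \<subseteq> lball y0 k0" using lball_mono[OF k1] eq0 by blast
    then have subU: "lball y (k + 1) \<subseteq> U" using y0 by blast
    have "\<not> ?Q (lball y (k + 1))" by (rule max) (use k1 in auto)
    then have large': "\<exists>z\<in>lball y (k + 1) \<inter> supp. 1 \<le> \<psi> s z" if "s \<in> P" for s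
      using that by (metis not_le)
    have ysupp: "y \<in> supp" using y by blast
    obtain s where s: "s \<in> P" and s_less: "\<And>z. z \<in> lball y k \<inter> supp \<Longrightarrow> \<psi> s z < 1"
      using Q by blast
    let ?P = "{t \<in> P - {s}. cmp t s}"
    have "\<exists>N\<in>sets \<nu>. {x \<in> lball y (k + 1) \<inter> supp. \<not> marked cmp \<psi> \<epsilon> ?P x} \<subseteq> N \<and>
      emeasure \<nu> N \<le> ennreal (?c m) * emeasure \<nu> (lball y (k + 1))"
    proof (rule Suc.IH)
      fix \<Sigma> assume \<Sigma>: "\<Sigma> \<subseteq> ?P" "clique cmp \<Sigma>"
      then have "clique cmp (insert s \<Sigma>)" "insert s \<Sigma> \<subseteq> P" "s \<notin> \<Sigma>"
        using sym s by (auto simp: clique_def)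
      then have "card (insert s \<Sigma>) \<le> Suc m" using card by blast
      then show "card \<Sigma> \<le> m" using \<Sigma> \<open>s \<notin> \<Sigma>\<close> by (simp add: clique_def)
    qed (use open_less good ysupp subU large' in auto)
    then obtain N where N: "N \<in> sets \<nu>"
      "{x \<in> lball y (k + 1) \<inter> supp. \<not> marked cmp \<psi> \<epsilon> ?P x} \<subseteq> N"
      "emeasure \<nu> N \<le> ennreal (?c m) * emeasure \<nu> (lball y (k + 1))" by blast
    let ?G = "{x \<in> lball y (k + 1). \<psi> s x < \<epsilon>}"
    have "?G = lball y (k + 1) \<inter> {x \<in> U. \<psi> s x < \<epsilon>}" using subU by blast
    then have G_sets: "?G \<in> sets \<nu>"
      using open_sets[OF open_less[OF s \<epsilon>]] by simp
    obtain z where "z \<in> lball y (k + 1) \<inter> supp" "1 \<le> \<psi> s z" using large'[OF s] by blast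
    then have G: "emeasure \<nu> ?G \<le> ennreal c * emeasure \<nu> (lball y (k + 1))"
      using good[OF s ysupp subU] by blast
    have "?E \<inter> lball y k \<subseteq> N \<union> ?G"
    proof (rule subsetI, rule ccontr)
      fix x assume x: "x \<in> ?E \<inter> lball y k" and nx: "x \<notin> N \<union> ?G"
      have x': "x \<in> lball y (k + 1) \<inter> supp" using x lball_mono[of k "k + 1" y] by auto
      then have "marked cmp \<psi> \<epsilon> ?P x" using N nx by blast
      then obtain \<Sigma> where \<Sigma>: "\<Sigma> \<subseteq> ?P" "clique cmp \<Sigma>" "\<forall>t\<in>\<Sigma>. \<epsilon> \<le> \<psi> t x \<and> \<psi> t x < 1"
        "\<forall>t\<in>?P - \<Sigma>. (\<forall>u\<in>\<Sigma>. cmp t u) \<longrightarrow> 1 \<le> \<psi> t x"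
        unfolding marked_def by blast
      have "clique cmp (insert s \<Sigma>)" "insert s \<Sigma> \<subseteq> P"
        using \<Sigma>(1,2) sym s by (auto simp: clique_def)
      moreover have "\<epsilon> \<le> \<psi> s x" "\<psi> s x < 1" using nx x' s_less[of x] x by auto
      ultimately have "marked cmp \<psi> \<epsilon> P x"
        unfolding marked_def using \<Sigma>(3,4) by (intro exI[of _ "insert s \<Sigma>"]) auto
      then show False using x by blast
    qed
    moreover have "N \<union> ?G \<in> sets \<nu>" using N G_sets by blast
    moreover have "emeasure \<nu> (N \<union> ?G) \<le> ennreal (?c (Suc m)) * emeasure \<nu> (lball y k)"
    proof -
      have "emeasure \<nu> (N \<union> ?G) \<le> emeasure \<nu> N + emeasure \<nu> ?G"
        using N G_sets by (intro emeasure_subadditive)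
      also have "\<dots> \<le> ennreal (?c m) * emeasure \<nu> (lball y (k + 1)) + ennreal c * emeasure \<nu> (lball y (k + 1))"
        using N G by (intro add_mono)
      also have "\<dots> = ennreal (?c m + c) * emeasure \<nu> (lball y (k + 1))"
        using c c_nonneg by (simp add: ennreal_plus distrib_right)
      also have "\<dots> \<le> ennreal (?c m + c) * (ennreal D * emeasure \<nu> (lball y k))"
        using double[OF ysupp subU] by (intro mult_left_mono) auto
      also have "\<dots> = ennreal ((?c m + c) * D) * emeasure \<nu> (lball y k)"
        using c c_nonneg[of m] D by (simp add: ennreal_mult mult.assoc)
      also have "(?c m + c) * D = ?c (Suc m)"
      proof -
        have "(\<Sum>i=1..Suc m. D ^ i) = D + (\<Sum>i=1..m. D ^ Suc i)"
          by (simp only: sum.atLeast_Suc_atMost[of 1 "Suc m"] sum.shift_bounds_cl_Suc_ivl) simp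
        also have "\<dots> = D * (1 + (\<Sum>i=1..m. D ^ i))"
          by (simp add: sum_distrib_left distrib_left)
        finally show ?thesis by (simp add: algebra_simps)
      qed
      finally show ?thesis .
    qed
    ultimately show "lball y k \<subseteq> lball y0 k0 \<and> (\<exists>N\<in>sets \<nu>. ?E \<inter> lball y k \<subseteq> N \<and>
        emeasure \<nu> N \<le> ennreal (?c (Suc m)) * emeasure \<nu> (lball y k))"
      using sub by blast
  qed
qed

end

section \<open>Minors and weighted volumes\<close>

text \<open>
  The columns are selected by an arbitrary function \<open>c\<close>, neither increasing nor injective. A
  repeated column gives the value \<open>0\<close>, and replacing one column by another needs no sign.
\<close>

definition minor :: "nat \<Rightarrow> (nat \<Rightarrow> nat) \<Rightarrow> (nat \<Rightarrow> nat \<Rightarrow> 'a::comm_ring_1) \<Rightarrow> 'a" where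
  "minor k c M = det (mat k k (\<lambda>(r, s). M r (c s)))"

lemma minor_cong:
  assumes "\<And>r s. r < k \<Longrightarrow> s < k \<Longrightarrow> M r (c s) = M' r (c' s)"
  shows "minor k c M = minor k c' M'"
  unfolding minor_def using assms by (intro arg_cong[of _ _ det] eq_matI) auto

lemma minor_0 [simp]: "minor 0 c M = 1"
  by (simp add: minor_def)

lemma minor_eq_0_if_not_inj:
  assumes "s < k" "s' < k" "s \<noteq> s'" "c s = c s'"
  shows "minor k c M = 0"
  unfolding minor_def
  by (rule det_identical_columns[of _ k s s']) (use assms in \<open>auto intro!: eq_vecI simp: col_def\<close>)

lemma minor_nonzero_imp_inj:
  assumes "minor k c M \<noteq> 0" shows "inj_on c {..<k}"
  using assms minor_eq_0_if_not_inj[of _ k _ c M] by (force simp: inj_on_def)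

lemma minor_last_row:
  "minor (Suc k) c M =
    (\<Sum>j<Suc k. M k (c j) * ((-1) ^ (k + j) * minor k (\<lambda>s. c (insert_index j s)) M))"
proof -
  let ?A = "mat (Suc k) (Suc k) (\<lambda>(r, s). M r (c s))"
  have "cofactor ?A k j = (-1) ^ (k + j) * minor k (\<lambda>s. c (insert_index j s)) M" if "j < Suc k" for j
  proof -
    have "mat_delete ?A k j = mat k k (\<lambda>(r, s). M r (c (insert_index j s)))"
      by (rule eq_matI) (auto simp: mat_delete_def insert_index_def)
    then show ?thesis by (simp add: cofactor_def minor_def)
  qed
  then show ?thesis
    unfolding minor_def[of "Suc k"] by (subst laplace_expansion_row[of _ "Suc k" k]) auto
qed

lemma minor_last_column:
  "minor (Suc k) c M =
    (\<Sum>i<Suc k. M i (c k) * ((-1) ^ (i + k) * minor k c (\<lambda>r. M (insert_index i r))))"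
proof -
  let ?A = "mat (Suc k) (Suc k) (\<lambda>(r, s). M r (c s))"
  have "cofactor ?A i k = (-1) ^ (i + k) * minor k c (\<lambda>r. M (insert_index i r))" if "i < Suc k" for i
  proof -
    have "mat_delete ?A i k = mat k k (\<lambda>(r, s). M (insert_index i r) (c s))"
      by (rule eq_matI) (auto simp: mat_delete_def insert_index_def)
    then show ?thesis by (simp add: cofactor_def minor_def)
  qed
  then show ?thesis
    unfolding minor_def[of "Suc k"] by (subst laplace_expansion_column[of _ "Suc k" k]) auto
qed

text \<open>
  Laplace expansion along the column \<open>s\<close>: the cofactors do not involve this column.
\<close>

lemma det_column_sum:
  fixes A :: "nat \<Rightarrow> nat \<Rightarrow> 'a::comm_ring_1"
  assumes s: "s < k"
  shows "det (mat k k (\<lambda>(r, q). if q = s then (\<Sum>i\<in>I. y i * g i r) else A r q)) =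
    (\<Sum>i\<in>I. y i * det (mat k k (\<lambda>(r, q). if q = s then g i r else A r q)))"
proof -
  let ?A = "\<lambda>h. mat k k (\<lambda>(r, q). if q = s then h r else A r q)"
  define cof where "cof r = cofactor (?A (\<lambda>_. 0)) r s" for r
  have cof: "cofactor (?A h) r s = cof r" if "r < k" for r h
  proof -
    have "mat_delete (?A h) r s = mat_delete (?A (\<lambda>_. 0)) r s"
      using that s by (intro eq_matI) (auto simp: mat_delete_def)
    then show ?thesis by (simp add: cof_def cofactor_def)
  qed
  have det: "det (?A h) = (\<Sum>r<k. h r * cof r)" for h
    using s by (subst laplace_expansion_column[of _ k s]) (auto simp: cof)
  have "det (?A (\<lambda>r. \<Sum>i\<in>I. y i * g i r)) = (\<Sum>r<k. \<Sum>i\<in>I. y i * (g i r * cof r))"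
    unfolding det by (simp add: sum_distrib_right mult.assoc)
  also have "\<dots> = (\<Sum>i\<in>I. y i * det (?A (g i)))"
    unfolding det by (subst sum.swap) (simp add: sum_distrib_left)
  finally show ?thesis .
qed

lemma minor_transform:
  fixes N N' :: "nat \<Rightarrow> nat \<Rightarrow> 'a::comm_ring_1"
  assumes "\<And>r s. r < k \<Longrightarrow> s < k \<Longrightarrow> D * N r (c s) = (\<Sum>t<k. B r t * N' t (c s))"
  shows "D ^ k * minor k c N = det (mat k k (\<lambda>(r, t). B r t)) * minor k c N'"
proof -
  let ?N = "mat k k (\<lambda>(r, s). N r (c s))" and ?N' = "mat k k (\<lambda>(r, s). N' r (c s))"
    and ?B = "mat k k (\<lambda>(r, t). B r t)"
  have "D \<cdot>\<^sub>m ?N = ?B * ?N'"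
  proof (rule eq_matI)
    fix r s assume "r < dim_row (?B * ?N')" "s < dim_col (?B * ?N')"
    then have rs: "r < k" "s < k" by auto
    then show "(D \<cdot>\<^sub>m ?N) $$ (r, s) = (?B * ?N') $$ (r, s)"
      using assms[OF rs] by (simp add: scalar_prod_def lessThan_atLeast0)
  qed auto
  then have "det (D \<cdot>\<^sub>m ?N) = det ?B * det ?N'"
    using det_mult[of ?B k ?N'] by simp
  then show ?thesis by (simp add: minor_def)
qed

text \<open>
  The unipotent matrix \<open>u\<^sub>y\<close>. On \<open>v = (-p, q\<^sub>1, \<dots>, q\<^sub>n)\<close> its entry with index \<open>0\<close> is the linear form
  \<open>y\<^sub>1 q\<^sub>1 + \<dots> + y\<^sub>n q\<^sub>n - p\<close>.
\<close>

definition shear :: "nat \<Rightarrow> (nat \<Rightarrow> 'a::comm_ring_1) \<Rightarrow> (nat \<Rightarrow> 'a) \<Rightarrow> nat \<Rightarrow> 'a" where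
  "shear n y v j = (if j = 0 then v 0 + (\<Sum>i=1..n. y i * v i) else v j)"

text \<open>
  Only the column with index \<open>0\<close> depends on \<open>y\<close>, in an affine way, and the determinant is linear in
  this column. This is why the goodness of affine forms in \<open>f\<close> carries over to covolumes.
\<close>

lemma minor_shear:
  assumes s: "s < k" "c s = 0" and others: "\<And>q. q < k \<Longrightarrow> q \<noteq> s \<Longrightarrow> c q \<noteq> 0"
  shows "minor k c (\<lambda>r. shear n y (M r)) = affine_comb n (\<lambda>i. minor k (c(s := i)) M) y"
proof -
  let ?y = "\<lambda>i. if i = 0 then 1 else y i"
  have "minor k c (\<lambda>r. shear n y (M r)) =
    det (mat k k (\<lambda>(r, q). if q = s then (\<Sum>i\<in>{0..n}. ?y i * M r i) else M r (c q)))"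
    unfolding minor_def
  proof (intro arg_cong[of _ _ det] eq_matI)
    fix r q assume "r < dim_row (mat k k (\<lambda>(r, q). if q = s then (\<Sum>i\<in>{0..n}. ?y i * M r i) else M r (c q)))"
      "q < dim_col (mat k k (\<lambda>(r, q). if q = s then (\<Sum>i\<in>{0..n}. ?y i * M r i) else M r (c q)))"
    then have rq: "r < k" "q < k" by auto
    have "(\<Sum>i\<in>{0..n}. ?y i * M r i) = M r 0 + (\<Sum>i=1..n. y i * M r i)"
      by (simp add: sum.atLeast_Suc_atMost)
    then show "mat k k (\<lambda>(r, q). shear n y (M r) (c q)) $$ (r, q) =
      mat k k (\<lambda>(r, q). if q = s then (\<Sum>i\<in>{0..n}. ?y i * M r i) else M r (c q)) $$ (r, q)"
      using rq s others[of q] by (auto simp: shear_def)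
  qed auto
  also have "\<dots> = (\<Sum>i\<in>{0..n}. ?y i * det (mat k k (\<lambda>(r, q). if q = s then M r i else M r (c q))))"
    by (rule det_column_sum[OF s(1)])
  also have "\<dots> = (\<Sum>i\<in>{0..n}. ?y i * minor k (c(s := i)) M)"
    unfolding minor_def
    by (intro sum.cong refl arg_cong2[of _ _ _ _ "(*)"] arg_cong[of _ _ det] eq_matI) auto
  also have "\<dots> = affine_comb n (\<lambda>i. minor k (c(s := i)) M) y"
    by (simp add: affine_comb_def sum.atLeast_Suc_atMost mult.commute)
  finally show ?thesis .
qed

lemma minor_shear_no_zero:
  assumes "\<And>q. q < k \<Longrightarrow> c q \<noteq> 0"
  shows "minor k c (\<lambda>r. shear n y (M r)) = minor k c M"
proof (rule minor_cong)
  fix r q assume "q < k"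
  then show "shear n y (M r) (c q) = M r (c q)" using assms[of q] by (simp add: shear_def)
qed

abbreviation col_choices :: "nat \<Rightarrow> nat \<Rightarrow> (nat \<Rightarrow> nat) set" where
  "col_choices n k \<equiv> {..<k} \<rightarrow>\<^sub>E {..n}"

text \<open>
  The logarithms of the entries of the diagonal matrix by which the sheared lattice is rescaled.
\<close>

definition weight :: "(nat \<Rightarrow> nat) \<Rightarrow> nat \<Rightarrow> real" where
  "weight t j = (if j = 0 then real (t 0) else - real (t j))"

text \<open>
  The supremum norm of \<open>v\<^sub>1 \<and> \<dots> \<and> v\<^sub>k\<close> for the rows of \<open>M\<close>, after the shear and the rescaling. The
  minors are the coordinates of this multivector. For \<open>k = 0\<close> its value is \<open>1\<close>.
\<close>

definition vol :: "nat \<Rightarrow> nat \<Rightarrow> (nat \<Rightarrow> nat \<Rightarrow> 'k::comm_ring_1 fls) \<Rightarrow> (nat \<Rightarrow> nat) \<Rightarrow> (nat \<Rightarrow> 'k fls) \<Rightarrow> real" where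
  "vol n k M t y = Max ((\<lambda>c. exp (\<Sum>s<k. weight t (c s)) * fls_abs (minor k c (\<lambda>r. shear n y (M r)))) ` col_choices n k)"

lemma col_choices_le: "c \<in> col_choices n k \<Longrightarrow> s < k \<Longrightarrow> c s \<le> n"
  by auto

lemma finite_col_choices: "finite (col_choices n k)"
  by (intro finite_PiE) auto

lemma col_choices_nonempty: "col_choices n k \<noteq> {}"
  by (auto simp: PiE_eq_empty_iff)

lemma vol_less_iff: "vol n k M t y < r \<longleftrightarrow>
    (\<forall>c\<in>col_choices n k. exp (\<Sum>s<k. weight t (c s)) * fls_abs (minor k c (\<lambda>r. shear n y (M r))) < r)"
  unfolding vol_def using finite_col_choices col_choices_nonempty by (subst Max_less_iff) auto

lemma vol_ge_iff: "r \<le> vol n k M t y \<longleftrightarrow>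
    (\<exists>c\<in>col_choices n k. r \<le> exp (\<Sum>s<k. weight t (c s)) * fls_abs (minor k c (\<lambda>r. shear n y (M r))))"
  using vol_less_iff[of n k M t y r] by (meson linorder_not_less)

lemma le_vol:
  assumes "\<And>s. s < k \<Longrightarrow> c s \<le> n"
  shows "exp (\<Sum>s<k. weight t (c s)) * fls_abs (minor k c (\<lambda>r. shear n y (M r))) \<le> vol n k M t y"
proof -
  let ?c = "restrict c {..<k}"
  have "?c \<in> col_choices n k" using assms by auto
  moreover have "minor k ?c (\<lambda>r. shear n y (M r)) = minor k c (\<lambda>r. shear n y (M r))"
    by (rule minor_cong) simp
  moreover have "(\<Sum>s<k. weight t (?c s)) = (\<Sum>s<k. weight t (c s))" by (rule sum.cong) auto
  ultimately show ?thesis using vol_ge_iff by (metis order_refl)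
qed

lemma vol_0: "vol n 0 M t y = 1"
  by (simp add: vol_def)

lemma fls_abs_minus_one_power [simp]: "fls_abs ((-1) ^ m * a) = fls_abs a"
  by (cases "even m") auto

lemma sum_insert_index:
  fixes g :: "nat \<Rightarrow> 'b::comm_monoid_add"
  assumes "j < Suc k"
  shows "(\<Sum>s<Suc k. g s) = g j + (\<Sum>s<k. g (insert_index j s))"
proof -
  have "bij_betw (insert_index j) {..<k} ({..<Suc k} - {j})"
  proof (rule bij_betwI')
    fix s assume s: "s \<in> {..<Suc k} - {j}"
    then show "\<exists>s'\<in>{..<k}. s = insert_index j s'"
      using assms by (intro bexI[of _ "if s < j then s else s - 1"]) (auto simp: insert_index_def)
  qed (use assms in \<open>auto simp: insert_index_def\<close>)
  then have "(\<Sum>s<k. g (insert_index j s)) = sum g ({..<Suc k} - {j})"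
    by (rule sum.reindex_bij_betw)
  moreover have "(\<Sum>s<Suc k. g s) = g j + sum g ({..<Suc k} - {j})"
    using assms by (intro sum.remove) auto
  ultimately show ?thesis by simp
qed

lemma exp_mult_less_iff: "exp w * a < e \<longleftrightarrow> a < e * exp (- w)" for a e w :: real
  by (simp add: exp_minus field_simps)

text \<open>
  The norm of \<open>w \<and> v\<close> is at most the product of the norms of \<open>w\<close> and \<open>v\<close>: expand the minors along
  the new row and use the ultrametric inequality, which leaves no combinatorial factor.
\<close>

lemma vol_extend_less:
  assumes le: "vol n k M t y \<le> 1" and \<epsilon>: "0 < \<epsilon>"
    and v: "\<And>j. j \<le> n \<Longrightarrow> exp (weight t j) * fls_abs (shear n y v j) < \<epsilon>"
  shows "vol n (Suc k) (M(k := v)) t y < \<epsilon>"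
  unfolding vol_less_iff
proof
  fix c assume c: "c \<in> col_choices n (Suc k)"
  let ?N = "\<lambda>r. shear n y ((M(k := v)) r)"
  let ?w = "\<Sum>s<Suc k. weight t (c s)"
  have "fls_abs (minor (Suc k) c ?N) < \<epsilon> * exp (- ?w)"
    unfolding minor_last_row
  proof (rule fls_abs_sum_less)
    fix j assume "j \<in> {..<Suc k}"
    then have j: "j < Suc k" by simp
    let ?c = "\<lambda>s. c (insert_index j s)"
    have cj: "c j \<le> n" using c j by auto
    have "?c s \<le> n" if "s < k" for s
      using c that by (auto simp: insert_index_def PiE_def Pi_def)
    then have "exp (\<Sum>s<k. weight t (?c s)) * fls_abs (minor k ?c (\<lambda>r. shear n y (M r))) \<le> vol n k M t y"
      by (rule le_vol)
    moreover have "minor k ?c (\<lambda>r. shear n y (M r)) = minor k ?c ?N" by (rule minor_cong) simp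
    ultimately have m: "exp (\<Sum>s<k. weight t (?c s)) * fls_abs (minor k ?c ?N) \<le> 1" using le by simp
    have "exp ?w = exp (weight t (c j)) * exp (\<Sum>s<k. weight t (?c s))"
      using sum_insert_index[OF j, of "\<lambda>s. weight t (c s)"] by (simp add: exp_add)
    then have "exp ?w * (fls_abs (shear n y v (c j)) * fls_abs (minor k ?c ?N)) =
      (exp (weight t (c j)) * fls_abs (shear n y v (c j))) *
      (exp (\<Sum>s<k. weight t (?c s)) * fls_abs (minor k ?c ?N))" by (simp only: ac_simps)
    also have "\<dots> \<le> (exp (weight t (c j)) * fls_abs (shear n y v (c j))) * 1"
      using m by (intro mult_left_mono) auto
    also have "\<dots> < \<epsilon>" using v[OF cj] by simp
    finally have "fls_abs (shear n y v (c j)) * fls_abs (minor k ?c ?N) < \<epsilon> * exp (- ?w)"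
      by (simp only: exp_mult_less_iff)
    moreover have "fls_abs (?N k (c j) * ((-1) ^ (k + j) * minor k ?c ?N))
        \<le> fls_abs (shear n y v (c j)) * fls_abs (minor k ?c ?N)"
      using fls_abs_mult_le[of "?N k (c j)" "(-1) ^ (k + j) * minor k ?c ?N"] by simp
    ultimately show "fls_abs (?N k (c j) * ((-1) ^ (k + j) * minor k ?c ?N)) < \<epsilon> * exp (- ?w)"
      by linarith
  qed (use \<epsilon> in simp)
  then show "exp ?w * fls_abs (minor (Suc k) c ?N) < \<epsilon>"
    by (simp only: exp_mult_less_iff)
qed

section \<open>Rational subspaces\<close>

context coefficient_field
begin

lemma prod_in_subring:
  fixes R :: "'k fls set"
  assumes mult: "\<And>a b. a \<in> R \<Longrightarrow> b \<in> R \<Longrightarrow> a * b \<in> R"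
    and I: "finite I" "I \<noteq> {}" and g: "\<And>i. i \<in> I \<Longrightarrow> g i \<in> R"
  shows "prod g I \<in> R"
  using I g by (induction I rule: finite_ne_induct) (auto intro: mult)

text \<open>
  The case \<open>k = 0\<close> is excluded because the determinant is then the \<open>1\<close> of the type, which need not
  lie in \<open>R\<close>.
\<close>

lemma det_in_subring:
  fixes R :: "'k fls set"
  assumes zero: "0 \<in> R" and add: "\<And>a b. a \<in> R \<Longrightarrow> b \<in> R \<Longrightarrow> a + b \<in> R"
    and uminus: "\<And>a. a \<in> R \<Longrightarrow> - a \<in> R"
    and mult: "\<And>a b. a \<in> R \<Longrightarrow> b \<in> R \<Longrightarrow> a * b \<in> R"
    and k: "1 \<le> k" and A: "\<And>r s. r < k \<Longrightarrow> s < k \<Longrightarrow> A r s \<in> R"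
  shows "det (mat k k (\<lambda>(r, s). A r s)) \<in> R"
proof -
  have sum: "sum g I \<in> R" if "\<And>i. i \<in> I \<Longrightarrow> g i \<in> R" for g :: "(nat \<Rightarrow> nat) \<Rightarrow> 'k fls" and I
    using that by (induction I rule: infinite_finite_induct) (auto simp: zero add)
  have "det (mat k k (\<lambda>(r, s). A r s)) =
    (\<Sum>p\<in>{p. p permutes {0..<k}}. signof p * (\<Prod>i=0..<k. mat k k (\<lambda>(r, s). A r s) $$ (i, p i)))"
    by (rule det_def') simp
  also have "\<dots> \<in> R"
  proof (rule sum)
    fix p assume "p \<in> {p. p permutes {0..<k}}"
    then have p: "p i < k" if "i < k" for i using that permutes_in_image[of p "{0..<k}" i] by simp
    have "(\<Prod>i=0..<k. mat k k (\<lambda>(r, s). A r s) $$ (i, p i)) \<in> R"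
      using k p by (intro prod_in_subring mult) (auto intro: A)
    then show "signof p * (\<Prod>i=0..<k. mat k k (\<lambda>(r, s). A r s) $$ (i, p i)) \<in> R"
      using uminus by (cases "signof p = (1 :: 'k fls)") (auto simp: sign_def)
  qed
  finally show ?thesis .
qed

lemma det_in_F: "1 \<le> k \<Longrightarrow> (\<And>r s. r < k \<Longrightarrow> s < k \<Longrightarrow> A r s \<in> F) \<Longrightarrow> det (mat k k (\<lambda>(r, s). A r s)) \<in> F"
  by (rule det_in_subring) (auto intro: F_add F_uminus F_mult)

lemma det_in_\<Lambda>: "1 \<le> k \<Longrightarrow> (\<And>r s. r < k \<Longrightarrow> s < k \<Longrightarrow> A r s \<in> \<Lambda>) \<Longrightarrow> det (mat k k (\<lambda>(r, s). A r s)) \<in> \<Lambda>"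
  by (rule det_in_subring) (auto intro: \<Lambda>_add \<Lambda>_uminus \<Lambda>_mult)

lemma power_in_\<Lambda>: "1 \<le> k \<Longrightarrow> a \<in> \<Lambda> \<Longrightarrow> a ^ k \<in> \<Lambda>"
  by (induction k rule: dec_induct) (auto intro: \<Lambda>_mult)

lemma fls_abs_power: "1 \<le> k \<Longrightarrow> a \<in> \<Lambda> \<Longrightarrow> fls_abs (a ^ k) = fls_abs a ^ k"
  by (induction k rule: dec_induct) (auto simp: fls_abs_mult power_in_\<Lambda> \<Lambda>_in_F)

lemma power_nonzero: "1 \<le> k \<Longrightarrow> a \<in> \<Lambda> \<Longrightarrow> a \<noteq> 0 \<Longrightarrow> a ^ k \<noteq> 0"
  using fls_abs_power[of k a] by (metis fls_abs_eq_0_iff power_not_zero)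

lemma fls_abs_ge_1: "a \<in> \<Lambda> \<Longrightarrow> a \<noteq> 0 \<Longrightarrow> 1 \<le> fls_abs a"
  using fls_abs_poly_eq_exp[of a] by auto

lemma minus_one_power_in_\<Lambda>: "a \<in> \<Lambda> \<Longrightarrow> (-1) ^ m * a \<in> \<Lambda>"
  by (cases "even m") (auto intro: \<Lambda>_uminus)

definition integral_rows :: "nat \<Rightarrow> nat \<Rightarrow> (nat \<Rightarrow> nat \<Rightarrow> 'k fls) \<Rightarrow> bool" where
  "integral_rows n k M \<longleftrightarrow> (\<forall>r<k. \<forall>j\<le>n. M r j \<in> \<Lambda>)"

text \<open>
  The polynomial vectors in the subspace that the rows of \<open>M\<close> span over the field of rational
  functions. A subspace is represented by this set, and a common denominator \<open>D\<close> replaces division.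
\<close>

definition rational_span :: "nat \<Rightarrow> nat \<Rightarrow> (nat \<Rightarrow> nat \<Rightarrow> 'k fls) \<Rightarrow> (nat \<Rightarrow> 'k fls) set" where
  "rational_span n k M = {v. (\<forall>j\<le>n. v j \<in> \<Lambda>) \<and>
     (\<exists>D\<in>\<Lambda>. D \<noteq> 0 \<and> (\<exists>a. (\<forall>r<k. a r \<in> \<Lambda>) \<and> (\<forall>j\<le>n. D * v j = (\<Sum>r<k. a r * M r j))))}"

definition independent_rows :: "nat \<Rightarrow> nat \<Rightarrow> (nat \<Rightarrow> nat \<Rightarrow> 'k fls) \<Rightarrow> bool" where
  "independent_rows n k M \<longleftrightarrow> integral_rows n k M \<and> (\<exists>c\<in>col_choices n k. minor k c M \<noteq> 0)"

lemma minor_in_\<Lambda>: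
  assumes "1 \<le> k" "integral_rows n k M" "\<And>s. s < k \<Longrightarrow> c s \<le> n"
  shows "minor k c M \<in> \<Lambda>"
  unfolding minor_def by (rule det_in_\<Lambda>) (use assms in \<open>auto simp: integral_rows_def\<close>)

lemma shear_in_F:
  assumes "\<And>i. i \<in> {1..n} \<Longrightarrow> y i \<in> F" "\<And>j. j \<le> n \<Longrightarrow> v j \<in> F" "j \<le> n"
  shows "shear n y v j \<in> F"
  using assms by (auto simp: shear_def intro!: F_add F_sum F_mult)

lemma minor_shear_in_F:
  assumes "1 \<le> k" "integral_rows n k M" "\<And>s. s < k \<Longrightarrow> c s \<le> n" "\<And>i. i \<in> {1..n} \<Longrightarrow> y i \<in> F"
  shows "minor k c (\<lambda>r. shear n y (M r)) \<in> F"
  unfolding minor_def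
proof (rule det_in_F)
  fix r s assume "r < k" "s < k"
  then show "shear n y (M r) (c s) \<in> F"
    using assms by (intro shear_in_F) (auto simp: integral_rows_def intro: \<Lambda>_in_F)
qed (rule assms)

lemma row_in_span:
  assumes M: "integral_rows n k M" and r: "r < k"
  shows "M r \<in> rational_span n k M"
proof -
  have "unit_series * M r j = (\<Sum>s<k. (if s = r then unit_series else 0) * M s j)" for j
  proof -
    have "(\<Sum>s<k. (if s = r then unit_series else 0) * M s j) = (\<Sum>s<k. if s = r then unit_series * M r j else 0)"
      by (intro sum.cong) auto
    then show ?thesis using r by simp
  qed
  then show ?thesis
    using M r unit_series_in_\<Lambda> unit_series_nonzero unfolding rational_span_def integral_rows_def
    by (auto intro!: bexI[of _ unit_series] exI[of _ "\<lambda>s. if s = r then unit_series else 0"])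
qed

text \<open>
  In matrix form: \<open>D M = B M'\<close> with a polynomial matrix \<open>B\<close>. All comparisons of two spans below
  take determinants in this identity.
\<close>

lemma common_denominator:
  fixes k :: nat
  assumes "\<And>r. r < k \<Longrightarrow> M r \<in> rational_span n k' M'"
  shows "\<exists>D\<in>\<Lambda>. D \<noteq> 0 \<and> (\<exists>B. (\<forall>r<k. \<forall>s<k'. B r s \<in> \<Lambda>) \<and>
    (\<forall>r<k. \<forall>j\<le>n. D * M r j = (\<Sum>s<k'. B r s * M' s j)))"
  using assms
proof (induction k)
  case 0
  then show ?case using unit_series_in_\<Lambda> unit_series_nonzero by auto
next
  case (Suc k)
  have "\<And>r. r < k \<Longrightarrow> M r \<in> rational_span n k' M'" using Suc.prems by simp
  from Suc.IH[OF this] obtain D B where D: "D \<in> \<Lambda>" "D \<noteq> 0" and B: "\<forall>r<k. \<forall>s<k'. B r s \<in> \<Lambda>"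
    "\<forall>r<k. \<forall>j\<le>n. D * M r j = (\<Sum>s<k'. B r s * M' s j)" by blast
  have "M k \<in> rational_span n k' M'" using Suc.prems by simp
  then obtain E a where E: "E \<in> \<Lambda>" "E \<noteq> 0" and a: "\<forall>s<k'. a s \<in> \<Lambda>"
    "\<forall>j\<le>n. E * M k j = (\<Sum>s<k'. a s * M' s j)" unfolding rational_span_def by blast
  let ?B = "\<lambda>r s. if r = k then D * a s else E * B r s"
  have "D * E * M r j = (\<Sum>s<k'. ?B r s * M' s j)" if "r < Suc k" "j \<le> n" for r j
  proof (cases "r = k")
    case True
    have "E * M r j = (\<Sum>s<k'. a s * M' s j)" using a(2) that True by blast
    then have "D * E * M r j = D * (\<Sum>s<k'. a s * M' s j)" by (simp only: mult.assoc)
    then show ?thesis using True by (simp add: sum_distrib_left mult.assoc)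
  next
    case False
    then have "r < k" using that by simp
    then have "D * M r j = (\<Sum>s<k'. B r s * M' s j)" using B(2) that by blast
    moreover have "D * E * M r j = E * (D * M r j)" by (simp only: ac_simps)
    ultimately have "D * E * M r j = E * (\<Sum>s<k'. B r s * M' s j)" by simp
    then show ?thesis using False by (simp add: sum_distrib_left mult.assoc)
  qed
  moreover have "\<forall>r<Suc k. \<forall>s<k'. ?B r s \<in> \<Lambda>" using B a D E by (auto intro: \<Lambda>_mult)
  moreover have "D * E \<in> \<Lambda>" "D * E \<noteq> 0"
    using D E by (auto simp: \<Lambda>_mult F_mult_eq_0 \<Lambda>_in_F)
  ultimately show ?case by (intro bexI[of _ "D * E"] conjI exI[of _ ?B]) auto
qed

lemma rational_span_subset:
  fixes k :: nat
  assumes "\<And>r. r < k \<Longrightarrow> M r \<in> rational_span n k' M'"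
  shows "rational_span n k M \<subseteq> rational_span n k' M'"
proof
  fix v assume v: "v \<in> rational_span n k M"
  obtain D B where D: "D \<in> \<Lambda>" "D \<noteq> 0" and B: "\<forall>r<k. \<forall>s<k'. B r s \<in> \<Lambda>"
    "\<forall>r<k. \<forall>j\<le>n. D * M r j = (\<Sum>s<k'. B r s * M' s j)" using common_denominator[of k M n k' M', OF assms] by blast
  obtain E a where E: "E \<in> \<Lambda>" "E \<noteq> 0" and a: "\<forall>r<k. a r \<in> \<Lambda>"
    "\<forall>j\<le>n. E * v j = (\<Sum>r<k. a r * M r j)" using v unfolding rational_span_def by blast
  have "D * E * v j = (\<Sum>s<k'. (\<Sum>r<k. a r * B r s) * M' s j)" if "j \<le> n" for j
  proof -
    have "E * v j = (\<Sum>r<k. a r * M r j)" using a(2) that by blast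
    then have "D * E * v j = D * (\<Sum>r<k. a r * M r j)" by (simp only: mult.assoc)
    also have "\<dots> = (\<Sum>r<k. a r * (D * M r j))" by (simp add: sum_distrib_left mult.left_commute)
    also have "\<dots> = (\<Sum>r<k. \<Sum>s<k'. a r * B r s * M' s j)"
      using B(2) that by (intro sum.cong refl) (simp add: sum_distrib_left mult.assoc)
    also have "\<dots> = (\<Sum>s<k'. (\<Sum>r<k. a r * B r s) * M' s j)"
      by (subst sum.swap) (simp add: sum_distrib_right)
    finally show ?thesis .
  qed
  moreover have "D * E \<in> \<Lambda>" "D * E \<noteq> 0"
    using D E by (auto simp: \<Lambda>_mult F_mult_eq_0 \<Lambda>_in_F)
  moreover have "\<forall>s<k'. (\<Sum>r<k. a r * B r s) \<in> \<Lambda>" using a B by (auto intro!: \<Lambda>_sum \<Lambda>_mult)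
  moreover have "\<forall>j\<le>n. v j \<in> \<Lambda>" using v unfolding rational_span_def by blast
  ultimately show "v \<in> rational_span n k' M'"
    unfolding rational_span_def
    by (intro CollectI conjI bexI[of _ "D * E"] exI[of _ "\<lambda>s. \<Sum>r<k. a r * B r s"]) auto
qed

text \<open>
  If \<open>k' < k\<close>, pad \<open>B\<close> by zero columns in the identity \<open>D M = B M'\<close>; then \<open>B\<close> has determinant \<open>0\<close>,
  and all maximal minors of \<open>M\<close> vanish.
\<close>

lemma rank_le:
  assumes M: "independent_rows n k M" and sub: "\<And>r. r < k \<Longrightarrow> M r \<in> rational_span n k' M'"
  shows "k \<le> k'"
proof (rule ccontr)
  assume "\<not> k \<le> k'"
  then have k: "k' < k" by simp
  obtain c where c: "c \<in> col_choices n k" "minor k c M \<noteq> 0" and int: "integral_rows n k M"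
    using M by (auto simp: independent_rows_def)
  obtain D B where D: "D \<in> \<Lambda>" "D \<noteq> 0" and B: "\<forall>r<k. \<forall>s<k'. B r s \<in> \<Lambda>"
    "\<forall>r<k. \<forall>j\<le>n. D * M r j = (\<Sum>s<k'. B r s * M' s j)"
    using common_denominator[of k M n k' M', OF sub] by blast
  let ?B = "\<lambda>r s. if s < k' then B r s else 0"
  have "D ^ k * minor k c M = det (mat k k (\<lambda>(r, t). ?B r t)) * minor k c M'"
  proof (rule minor_transform)
    fix r s assume rs: "r < k" "s < k"
    have "(\<Sum>t<k. ?B r t * M' t (c s)) = (\<Sum>t<k'. B r t * M' t (c s))"
      using k by (intro sum.mono_neutral_cong_right) auto
    moreover have "D * M r (c s) = (\<Sum>t<k'. B r t * M' t (c s))"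
      using B(2) col_choices_le[OF c(1)] rs by blast
    ultimately show "D * M r (c s) = (\<Sum>t<k. ?B r t * M' t (c s))" by simp
  qed
  moreover have "det (mat k k (\<lambda>(r, t). ?B r t)) = 0"
    using k by (subst laplace_expansion_column[of _ k k']) auto
  ultimately have "D ^ k * minor k c M = 0" by simp
  moreover have "D ^ k \<in> \<Lambda>" "minor k c M \<in> \<Lambda>"
    using k power_in_\<Lambda>[OF _ D(1)] minor_in_\<Lambda>[OF _ int col_choices_le[OF c(1)]] by simp_all
  moreover have "D ^ k \<noteq> 0"
    using k D by (intro power_nonzero) auto
  ultimately show False using c F_mult_eq_0 \<Lambda>_in_F by blast
qed

lemma same_rank_transform:
  assumes k: "1 \<le> k" and M: "independent_rows n k M"
    and sub: "\<And>r. r < k \<Longrightarrow> M r \<in> rational_span n k M'"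
  shows "\<exists>D\<in>\<Lambda>. \<exists>B. D \<noteq> 0 \<and> (\<forall>r<k. \<forall>s<k. B r s \<in> \<Lambda>) \<and> det (mat k k (\<lambda>(r, s). B r s)) \<noteq> 0 \<and>
    (\<forall>r<k. \<forall>j\<le>n. D * M r j = (\<Sum>s<k. B r s * M' s j))"
proof -
  obtain c where c: "c \<in> col_choices n k" "minor k c M \<noteq> 0" and int: "integral_rows n k M"
    using M by (auto simp: independent_rows_def)
  obtain D B where D: "D \<in> \<Lambda>" "D \<noteq> 0" and B: "\<forall>r<k. \<forall>s<k. B r s \<in> \<Lambda>"
    "\<forall>r<k. \<forall>j\<le>n. D * M r j = (\<Sum>s<k. B r s * M' s j)"
    using common_denominator[of k M n k M', OF sub] by blast
  have "D ^ k * minor k c M = det (mat k k (\<lambda>(r, t). B r t)) * minor k c M'"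
    by (rule minor_transform) (use B(2) col_choices_le[OF c(1)] in blast)
  moreover have "D ^ k \<in> \<Lambda>" "minor k c M \<in> \<Lambda>"
    using k power_in_\<Lambda>[OF _ D(1)] minor_in_\<Lambda>[OF _ int col_choices_le[OF c(1)]] by simp_all
  moreover have "D ^ k \<noteq> 0"
    using k D by (rule power_nonzero)
  ultimately have "det (mat k k (\<lambda>(r, s). B r s)) * minor k c M' \<noteq> 0"
    using c(2) F_mult_eq_0[of "D ^ k" "minor k c M"] \<Lambda>_in_F by simp
  then have "det (mat k k (\<lambda>(r, s). B r s)) \<noteq> 0" by auto
  with D B show ?thesis by (intro bexI[of _ D] exI[of _ B] conjI) assumption+
qed

text \<open>
  For equal ranks \<open>B\<close> has nonzero determinant, and the adjugate of \<open>B\<close> expresses \<open>M'\<close> in terms of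
  \<open>M\<close>.
\<close>

lemma rational_span_eqI:
  assumes k: "1 \<le> k" and M: "independent_rows n k M" and M': "integral_rows n k M'"
    and sub: "rational_span n k M \<subseteq> rational_span n k M'"
  shows "rational_span n k M = rational_span n k M'"
proof (rule antisym[OF sub rational_span_subset])
  have int: "integral_rows n k M" using M by (simp add: independent_rows_def)
  have rows: "M r \<in> rational_span n k M'" if "r < k" for r
    using sub row_in_span[OF int that] by blast
  obtain D B where D: "D \<in> \<Lambda>" "D \<noteq> 0" and B: "\<forall>r<k. \<forall>s<k. B r s \<in> \<Lambda>"
    and det: "det (mat k k (\<lambda>(r, s). B r s)) \<noteq> 0"
    and eq: "\<forall>r<k. \<forall>j\<le>n. D * M r j = (\<Sum>s<k. B r s * M' s j)"
    using same_rank_transform[OF k M, of M', OF rows] by simp (elim bexE exE conjE)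
  let ?B = "mat k k (\<lambda>(r, s). B r s)"
  fix t assume t: "t < k"
  define a where "a r = adj_mat ?B $$ (t, r) * D" for r
  have adj: "(\<Sum>r<k. adj_mat ?B $$ (t, r) * B r s) = (if s = t then det ?B else 0)" if s: "s < k" for s
  proof -
    have "(adj_mat ?B * ?B) $$ (t, s) = (det ?B \<cdot>\<^sub>m 1\<^sub>m k) $$ (t, s)"
      using adj_mat(3)[of ?B k] by simp
    moreover have "adj_mat ?B \<in> carrier_mat k k" using adj_mat(1)[of ?B k] by simp
    ultimately show ?thesis using s t by (auto simp: scalar_prod_def lessThan_atLeast0)
  qed
  have "det ?B * M' t j = (\<Sum>r<k. a r * M r j)" if j: "j \<le> n" for j
  proof -
    have "(\<Sum>r<k. a r * M r j) = (\<Sum>r<k. \<Sum>s<k. adj_mat ?B $$ (t, r) * B r s * M' s j)"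
      using eq j by (intro sum.cong refl) (simp add: a_def mult.assoc sum_distrib_left)
    also have "\<dots> = (\<Sum>s<k. (\<Sum>r<k. adj_mat ?B $$ (t, r) * B r s) * M' s j)"
      by (subst sum.swap) (simp add: sum_distrib_right)
    also have "\<dots> = (\<Sum>s<k. if s = t then det ?B * M' s j else 0)"
      by (intro sum.cong) (auto simp: adj)
    also have "\<dots> = det ?B * M' t j" using t by simp
    finally show ?thesis by simp
  qed
  moreover have "a r \<in> \<Lambda>" if r: "r < k" for r
  proof (cases "k = 1")
    case True
    \<comment> \<open>The cofactor is an empty determinant, so the factor \<open>D\<close> has to put it into \<open>\<Lambda>\<close>.\<close>
    then have rt: "r = 0" "t = 0" using r t by auto
    have "adj_mat ?B $$ (t, r) * D = D"
      using True rt by (simp add: adj_mat_def cofactor_def mat_delete_def)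
    then show ?thesis using D by (simp add: a_def)
  next
    case False
    let ?m = "\<lambda>p q. B (if p < r then p else Suc p) (if q < t then q else Suc q)"
    have "mat_delete ?B r t = mat (k - 1) (k - 1) (\<lambda>(p, q). ?m p q)"
      by (rule eq_matI) (auto simp: mat_delete_def)
    moreover have "det (mat (k - 1) (k - 1) (\<lambda>(p, q). ?m p q)) \<in> \<Lambda>"
      using False k B by (intro det_in_\<Lambda>) auto
    ultimately have "adj_mat ?B $$ (t, r) \<in> \<Lambda>"
      using r t by (simp add: adj_mat_def cofactor_def minus_one_power_in_\<Lambda>)
    then show ?thesis using D by (simp add: a_def \<Lambda>_mult)
  qed
  moreover have "det ?B \<in> \<Lambda>" by (rule det_in_\<Lambda>[OF k]) (use B in blast)
  ultimately show "M' t \<in> rational_span n k M"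
    using M' t det unfolding rational_span_def integral_rows_def
    by (intro CollectI conjI bexI[of _ "det ?B"] exI[of _ a]) auto
qed

text \<open>
  Cramer's rule. If all minors with the additional row \<open>v\<close> vanish, take a nonzero minor of \<open>M\<close> with
  columns \<open>c\<close>, adjoin a further column \<open>j\<close>, and expand along it. The cofactors do not depend on
  \<open>j\<close>, so the result is one linear relation between \<open>v\<close> and the rows of \<open>M\<close>.
\<close>

lemma independent_extend:
  assumes M: "independent_rows n k M" and v: "\<forall>j\<le>n. v j \<in> \<Lambda>" "v \<notin> rational_span n k M"
  shows "independent_rows n (Suc k) (M(k := v))"
proof -
  obtain c where c: "c \<in> col_choices n k" "minor k c M \<noteq> 0" and int: "integral_rows n k M"
    using M by (auto simp: independent_rows_def)
  let ?N = "M(k := v)"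
  have intN: "integral_rows n (Suc k) ?N" using int v by (auto simp: integral_rows_def less_Suc_eq)
  have "\<exists>c\<in>col_choices n (Suc k). minor (Suc k) c ?N \<noteq> 0"
  proof (rule ccontr)
    assume none: "\<not> ?thesis"
    define cof where "cof i = (-1) ^ (i + k) * minor k c (\<lambda>r. ?N (insert_index i r))" for i
    have cof_k: "cof k = minor k c M"
    proof -
      have "minor k c (\<lambda>r. ?N (insert_index k r)) = minor k c M"
        by (rule minor_cong) (simp add: insert_index_def)
      then show ?thesis by (simp add: cof_def)
    qed
    have rel: "(\<Sum>i<k. M i j * cof i) + v j * minor k c M = 0" if j: "j \<le> n" for j
    proof -
      have "c(k := j) \<in> col_choices n (Suc k)" using c j by (auto simp: PiE_def Pi_def extensional_def)
      then have "minor (Suc k) (c(k := j)) ?N = 0" using none by blast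
      moreover have "minor k (c(k := j)) (\<lambda>r. ?N (insert_index i r)) = minor k c (\<lambda>r. ?N (insert_index i r))" for i
        by (rule minor_cong) auto
      ultimately have "(\<Sum>i<Suc k. ?N i j * cof i) = 0"
        unfolding minor_last_column cof_def by (simp only: fun_upd_same)
      then show ?thesis by (simp add: cof_k)
    qed
    have cof_int: "unit_series * cof i \<in> \<Lambda>" if i: "i < Suc k" for i
    proof (cases "k = 0")
      case True
      then show ?thesis using i unit_series_in_\<Lambda> by (simp add: cof_def)
    next
      case False
      have "integral_rows n k (\<lambda>r. ?N (insert_index i r))"
        using intN i by (auto simp: integral_rows_def insert_index_def)
      then have "minor k c (\<lambda>r. ?N (insert_index i r)) \<in> \<Lambda>"
        using False c by (intro minor_in_\<Lambda>) auto
      then show ?thesis by (simp add: cof_def minus_one_power_in_\<Lambda> unit_series_in_\<Lambda> \<Lambda>_mult)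
    qed
    \<comment> \<open>The factor \<open>unit_series\<close> keeps the denominator in \<open>\<Lambda>\<close> for \<open>k = 0\<close> and changes nothing otherwise.\<close>
    let ?D = "unit_series * minor k c M"
    have "?D \<noteq> 0"
    proof (cases "k = 0")
      case True
      then show ?thesis using unit_series_nonzero by simp
    next
      case False
      then have "minor k c M \<in> \<Lambda>" using c int by (intro minor_in_\<Lambda>) auto
      then show ?thesis using c unit_series_mult \<Lambda>_in_F by metis
    qed
    moreover have "?D \<in> \<Lambda>" using cof_int[of k] by (simp add: cof_k)
    moreover have "?D * v j = (\<Sum>i<k. - (unit_series * cof i) * M i j)" if j: "j \<le> n" for j
    proof -
      have "v j * minor k c M = - (\<Sum>i<k. M i j * cof i)" using rel[OF j] by (simp add: eq_neg_iff_add_eq_0 add.commute)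
      moreover have "?D * v j = unit_series * (v j * minor k c M)" by (simp only: ac_simps)
      ultimately have "?D * v j = unit_series * (- (\<Sum>i<k. M i j * cof i))" by simp
      also have "\<dots> = - (\<Sum>i<k. unit_series * (M i j * cof i))" by (simp add: sum_distrib_left)
      also have "\<dots> = (\<Sum>i<k. - (unit_series * cof i) * M i j)"
        unfolding sum_negf[symmetric] by (intro sum.cong) (simp_all add: ac_simps)
      finally show ?thesis .
    qed
    moreover have "\<forall>i<k. - (unit_series * cof i) \<in> \<Lambda>" using cof_int \<Lambda>_uminus by simp
    ultimately have "v \<in> rational_span n k M"
      using v(1) unfolding rational_span_def
      by (intro CollectI conjI bexI[of _ ?D] exI[of _ "\<lambda>i. - (unit_series * cof i)"]) auto
    then show False using v by blast
  qed
  then show ?thesis using intN by (simp add: independent_rows_def)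
qed

text \<open>
  Two bases of the same subspace differ by a matrix that is independent of \<open>t\<close> and \<open>y\<close>, so their
  multivectors differ by a constant factor.
\<close>

lemma vol_proportional:
  assumes k: "1 \<le> k" and M: "independent_rows n k M" and M': "independent_rows n k M'"
    and sub: "rational_span n k M \<subseteq> rational_span n k M'"
  shows "\<exists>a>0. \<exists>b>0. \<forall>t y. (\<forall>i\<in>{1..n}. y i \<in> F) \<longrightarrow> a * vol n k M t y = b * vol n k M' t y"
proof -
  have int: "integral_rows n k M" "integral_rows n k M'" using M M' by (auto simp: independent_rows_def)
  have rows: "M r \<in> rational_span n k M'" if "r < k" for r
    using sub row_in_span[OF int(1) that] by blast
  obtain D B where D: "D \<in> \<Lambda>" "D \<noteq> 0" and B: "\<forall>r<k. \<forall>s<k. B r s \<in> \<Lambda>"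
    and det: "det (mat k k (\<lambda>(r, s). B r s)) \<noteq> 0"
    and eq: "\<forall>r<k. \<forall>j\<le>n. D * M r j = (\<Sum>s<k. B r s * M' s j)"
    using same_rank_transform[OF k M, of M', OF rows] by simp (elim bexE exE conjE)
  let ?d = "det (mat k k (\<lambda>(r, s). B r s))"
  let ?a = "fls_abs (D ^ k)" and ?b = "fls_abs ?d"
  have Dk: "D ^ k \<in> \<Lambda>" using k D(1) by (rule power_in_\<Lambda>)
  have d: "?d \<in> \<Lambda>" by (rule det_in_\<Lambda>[OF k]) (use B in blast)
  have a: "?a > 0" using power_nonzero[OF k D] by (simp add: less_le)
  have b: "?b > 0" using det by (simp add: less_le)
  have "?a * vol n k M t y = ?b * vol n k M' t y" if y: "\<forall>i\<in>{1..n}. y i \<in> F" for t y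
  proof -
    let ?g = "\<lambda>M c. exp (\<Sum>s<k. weight t (c s)) * fls_abs (minor k c (\<lambda>r. shear n y (M r)))"
    have g: "?a * ?g M c = ?b * ?g M' c" if c: "c \<in> col_choices n k" for c
    proof -
      have "D * shear n y (M r) j = (\<Sum>s<k. B r s * shear n y (M' s) j)" if "r < k" "j \<le> n" for r j
      proof (cases "j = 0")
        case True
        have "D * shear n y (M r) 0 = D * M r 0 + (\<Sum>i=1..n. y i * (D * M r i))"
          by (simp add: shear_def distrib_left sum_distrib_left mult.left_commute)
        also have "\<dots> = (\<Sum>s<k. B r s * M' s 0) + (\<Sum>i=1..n. \<Sum>s<k. y i * (B r s * M' s i))"
          using eq that by (simp add: sum_distrib_left)
        also have "\<dots> = (\<Sum>s<k. B r s * shear n y (M' s) 0)"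
          by (subst sum.swap) (simp add: shear_def distrib_left sum_distrib_left sum.distrib mult.left_commute)
        finally show ?thesis using True by simp
      qed (use eq that in \<open>simp add: shear_def\<close>)
      then have "D ^ k * minor k c (\<lambda>r. shear n y (M r)) = ?d * minor k c (\<lambda>r. shear n y (M' r))"
        using col_choices_le[OF c] by (intro minor_transform) blast
      moreover have "minor k c (\<lambda>r. shear n y (M r)) \<in> F" "minor k c (\<lambda>r. shear n y (M' r)) \<in> F"
        using k int c y by (auto intro!: minor_shear_in_F)
      ultimately have "?a * fls_abs (minor k c (\<lambda>r. shear n y (M r))) = ?b * fls_abs (minor k c (\<lambda>r. shear n y (M' r)))"
        using Dk d \<Lambda>_in_F fls_abs_mult by metis
      then show ?thesis by (simp add: mult.left_commute)
    qed
    have scale: "a * Max (g ` col_choices n k) = Max ((\<lambda>c. a * g c) ` col_choices n k)"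
      if "0 < a" for a :: real and g
    proof -
      have "mono ((*) a)" using that by (intro monoI mult_left_mono) auto
      then have "a * Max (g ` col_choices n k) = Max ((*) a ` g ` col_choices n k)"
        using finite_col_choices col_choices_nonempty by (intro mono_Max_commute) auto
      then show ?thesis by (simp add: image_image)
    qed
    have "?a * vol n k M t y = Max ((\<lambda>c. ?a * ?g M c) ` col_choices n k)"
      unfolding vol_def by (rule scale[OF a])
    also have "\<dots> = Max ((\<lambda>c. ?b * ?g M' c) ` col_choices n k)"
      using g by (intro arg_cong[of _ _ Max] image_cong) auto
    also have "\<dots> = ?b * vol n k M' t y" unfolding vol_def by (rule scale[OF b, symmetric])
    finally show ?thesis .
  qed
  then show ?thesis using a b by blast
qed

end

section \<open>Covolumes of rational subspaces\<close>

context coefficient_field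
begin

lemma independent_rank_le: "independent_rows n k M \<Longrightarrow> k \<le> Suc n"
proof -
  assume "independent_rows n k M"
  then obtain c where c: "c \<in> col_choices n k" "minor k c M \<noteq> 0"
    by (auto simp: independent_rows_def)
  have "card {..<k} \<le> card {..n}"
    using minor_nonzero_imp_inj[OF c(2)] c(1) by (intro card_inj_on_le[of c]) auto
  then show ?thesis by simp
qed

text \<open>
  Without shear and rescaling the volume is the absolute value of a nonzero polynomial. This value
  measures how far a basis is from being primitive.
\<close>

lemma vol_at_0:
  assumes k: "1 \<le> k" and M: "independent_rows n k M"
  shows "\<exists>j::nat. vol n k M (\<lambda>_. 0) (\<lambda>_. 0) = exp (real j)"
proof -
  have int: "integral_rows n k M" using M by (simp add: independent_rows_def)
  obtain c where c: "c \<in> col_choices n k" "minor k c M \<noteq> 0"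
    using M by (auto simp: independent_rows_def)
  have g: "exp (\<Sum>s<k. weight (\<lambda>_. 0) (c s)) * fls_abs (minor k c (\<lambda>r. shear n (\<lambda>_. 0) (M r)))
      = fls_abs (minor k c M)" for c
  proof -
    have "(\<lambda>r. shear n (\<lambda>_. 0) (M r)) = M" by (auto simp: shear_def fun_eq_iff)
    moreover have "weight (\<lambda>_. 0) j = 0" for j by (simp add: weight_def)
    ultimately show ?thesis by simp
  qed
  have vol: "vol n k M (\<lambda>_. 0) (\<lambda>_. 0) = Max ((\<lambda>c. fls_abs (minor k c M)) ` col_choices n k)"
    unfolding vol_def g ..
  have "vol n k M (\<lambda>_. 0) (\<lambda>_. 0) \<in> (\<lambda>c. fls_abs (minor k c M)) ` col_choices n k"
    unfolding vol using finite_col_choices col_choices_nonempty by (intro Max_in) auto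
  then obtain c' where c': "c' \<in> col_choices n k"
    and eq: "vol n k M (\<lambda>_. 0) (\<lambda>_. 0) = fls_abs (minor k c' M)" by auto
  have "0 < fls_abs (minor k c M)" using c by (simp add: less_le)
  also have "\<dots> \<le> vol n k M (\<lambda>_. 0) (\<lambda>_. 0)"
    unfolding vol using finite_col_choices c by (intro Max_ge) auto
  finally have "minor k c' M \<noteq> 0" using eq by auto
  moreover have "minor k c' M \<in> \<Lambda>"
    by (rule minor_in_\<Lambda>[OF k int col_choices_le[OF c']])
  ultimately show ?thesis using fls_abs_poly_eq_exp eq by simp
qed

definition rational_spaces :: "nat \<Rightarrow> (nat \<Rightarrow> 'k fls) set set" where
  "rational_spaces n = {rational_span n k M | k M. 1 \<le> k \<and> independent_rows n k M}"

text \<open>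
  A basis of the lattice of polynomial points of \<open>V\<close>, characterised by the fact that it minimises
  the volume among all bases of the subspace that consist of polynomial vectors.
\<close>

definition primitive_rows :: "nat \<Rightarrow> (nat \<Rightarrow> 'k fls) set \<Rightarrow> nat \<times> (nat \<Rightarrow> nat \<Rightarrow> 'k fls) \<Rightarrow> bool" where
  "primitive_rows n V = (\<lambda>(k, M). 1 \<le> k \<and> independent_rows n k M \<and> rational_span n k M = V \<and>
     (\<forall>k' M'. 1 \<le> k' \<longrightarrow> independent_rows n k' M' \<longrightarrow> rational_span n k' M' = V \<longrightarrow>
        k' = k \<and> (\<forall>t y. (\<forall>i\<in>{1..n}. y i \<in> F) \<longrightarrow> vol n k M t y \<le> vol n k' M' t y)))"

text \<open>
  Choose a basis with the smallest volume at \<open>t = 0\<close>, \<open>y = 0\<close>. As the volumes of two bases have a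
  constant ratio, it is minimal for all \<open>t\<close> and \<open>y\<close> at once.
\<close>

lemma ex_primitive_rows:
  assumes "V \<in> rational_spaces n"
  shows "\<exists>kM. primitive_rows n V kM"
proof -
  let ?R = "\<lambda>j. \<exists>k M. 1 \<le> k \<and> independent_rows n k M \<and> rational_span n k M = V \<and>
    vol n k M (\<lambda>_. 0) (\<lambda>_. 0) = exp (real j)"
  obtain k0 M0 where "1 \<le> k0" "independent_rows n k0 M0" "V = rational_span n k0 M0"
    using assms unfolding rational_spaces_def by blast
  then have "\<exists>j. ?R j" using vol_at_0[of k0 n M0] by blast
  then have R: "?R (LEAST j. ?R j)" by (rule LeastI_ex)
  define j where "j = (LEAST j. ?R j)"
  obtain k M where k: "1 \<le> k" and M: "independent_rows n k M" and V: "rational_span n k M = V"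
    and j: "vol n k M (\<lambda>_. 0) (\<lambda>_. 0) = exp (real j)" using R unfolding j_def by blast
  have "k' = k \<and> (\<forall>t y. (\<forall>i\<in>{1..n}. y i \<in> F) \<longrightarrow> vol n k M t y \<le> vol n k' M' t y)"
    if k': "1 \<le> k'" and M': "independent_rows n k' M'" and V': "rational_span n k' M' = V" for k' M'
  proof -
    have int: "integral_rows n k M" "integral_rows n k' M'"
      using M M' by (auto simp: independent_rows_def)
    have "k \<le> k'"
    proof (rule rank_le[OF M])
      show "M r \<in> rational_span n k' M'" if "r < k" for r
        using row_in_span[OF int(1) that] V V' by simp
    qed
    moreover have "k' \<le> k"
    proof (rule rank_le[OF M'])
      show "M' r \<in> rational_span n k M" if "r < k'" for r
        using row_in_span[OF int(2) that] V V' by simp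
    qed
    ultimately have kk: "k' = k" by simp
    obtain a b where ab: "0 < a" "0 < b"
      and scaled: "\<And>t y. (\<forall>i\<in>{1..n}. y i \<in> F) \<Longrightarrow> a * vol n k M t y = b * vol n k M' t y"
      using vol_proportional[OF k M, of M'] M' V V' unfolding kk by blast
    obtain j' where j': "vol n k M' (\<lambda>_. 0) (\<lambda>_. 0) = exp (real j')"
      using vol_at_0[OF k'] M' unfolding kk by blast
    then have "?R j'" using k' M' V' unfolding kk by blast
    then have "j \<le> j'" unfolding j_def by (rule Least_le)
    then have le: "exp (real j) \<le> exp (real j')" by simp
    have "a * exp (real j) = b * exp (real j')"
      using scaled[of "\<lambda>_. 0" "\<lambda>_. 0"] j j' by simp
    moreover have "b * exp (real j) \<le> b * exp (real j')" using ab le by (intro mult_left_mono) auto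
    ultimately have "b * exp (real j) \<le> a * exp (real j)" by simp
    then have "b \<le> a" by simp
    have "vol n k M t y \<le> vol n k M' t y" if y: "\<forall>i\<in>{1..n}. y i \<in> F" for t y
    proof -
      have "0 < vol n k M' t y \<or> vol n k M' t y = 0"
      proof -
        have "exp (\<Sum>s<k. weight t ((\<lambda>_. 0) s)) * fls_abs (minor k (\<lambda>_. 0) (\<lambda>r. shear n y (M' r))) \<le> vol n k M' t y"
          by (rule le_vol) simp
        then have "0 \<le> vol n k M' t y" using fls_abs_nonneg by (meson exp_ge_zero mult_nonneg_nonneg order_trans)
        then show ?thesis by linarith
      qed
      then have "b * vol n k M' t y \<le> a * vol n k M' t y"
        using \<open>b \<le> a\<close> by (intro mult_right_mono) auto
      then have "a * vol n k M t y \<le> a * vol n k M' t y" using scaled[OF y, of t] by simp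
      then show ?thesis using ab by simp
    qed
    then show ?thesis using kk by simp
  qed
  then have "primitive_rows n V (k, M)" using k M V unfolding primitive_rows_def by blast
  then show ?thesis by blast
qed

definition rank_of :: "nat \<Rightarrow> (nat \<Rightarrow> 'k fls) set \<Rightarrow> nat" where
  "rank_of n V = fst (SOME kM. primitive_rows n V kM)"

definition basis_of :: "nat \<Rightarrow> (nat \<Rightarrow> 'k fls) set \<Rightarrow> nat \<Rightarrow> nat \<Rightarrow> 'k fls" where
  "basis_of n V = snd (SOME kM. primitive_rows n V kM)"

definition covol :: "nat \<Rightarrow> (nat \<Rightarrow> nat) \<Rightarrow> (nat \<Rightarrow> 'k fls) set \<Rightarrow> (nat \<Rightarrow> 'k fls) \<Rightarrow> real" where
  "covol n t V y = vol n (rank_of n V) (basis_of n V) t y"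

lemma primitive_basis:
  assumes "V \<in> rational_spaces n"
  shows "1 \<le> rank_of n V" "independent_rows n (rank_of n V) (basis_of n V)"
    "rational_span n (rank_of n V) (basis_of n V) = V"
    and "\<And>k M t y. 1 \<le> k \<Longrightarrow> independent_rows n k M \<Longrightarrow> rational_span n k M = V \<Longrightarrow>
      (\<forall>i\<in>{1..n}. y i \<in> F) \<Longrightarrow> covol n t V y \<le> vol n k M t y"
proof -
  have "primitive_rows n V (rank_of n V, basis_of n V)"
    using someI_ex[OF ex_primitive_rows[OF assms]] by (simp add: rank_of_def basis_of_def)
  then show "1 \<le> rank_of n V" "independent_rows n (rank_of n V) (basis_of n V)"
    "rational_span n (rank_of n V) (basis_of n V) = V"
    "\<And>k M t y. 1 \<le> k \<Longrightarrow> independent_rows n k M \<Longrightarrow> rational_span n k M = V \<Longrightarrow>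
      (\<forall>i\<in>{1..n}. y i \<in> F) \<Longrightarrow> covol n t V y \<le> vol n k M t y"
    unfolding primitive_rows_def covol_def by blast+
qed

abbreviation comparable :: "'b set \<Rightarrow> 'b set \<Rightarrow> bool" where
  "comparable V W \<equiv> V \<subseteq> W \<or> W \<subseteq> V"

text \<open>
  Along a flag the rank is strictly increasing, with values in \<open>{1..n + 1}\<close>.
\<close>

lemma card_flag_le:
  assumes \<Sigma>: "\<Sigma> \<subseteq> rational_spaces n" "clique comparable \<Sigma>"
  shows "card \<Sigma> \<le> Suc n"
proof -
  have eq: "V = W" if VW: "V \<in> rational_spaces n" "W \<in> rational_spaces n"
    and sub: "V \<subseteq> W" and rk: "rank_of n V = rank_of n W" for V W
  proof -
    have "rational_span n (rank_of n V) (basis_of n V) = rational_span n (rank_of n V) (basis_of n W)"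
    proof (rule rational_span_eqI)
      show "integral_rows n (rank_of n V) (basis_of n W)"
        using primitive_basis(2)[OF VW(2)] rk by (simp add: independent_rows_def)
      show "rational_span n (rank_of n V) (basis_of n V) \<subseteq> rational_span n (rank_of n V) (basis_of n W)"
        using primitive_basis(3)[OF VW(1)] primitive_basis(3)[OF VW(2)] rk sub by simp
    qed (use primitive_basis(1,2)[OF VW(1)] in auto)
    then have "V = rational_span n (rank_of n V) (basis_of n W)"
      using primitive_basis(3)[OF VW(1)] by metis
    also have "\<dots> = W" unfolding rk by (rule primitive_basis(3)[OF VW(2)])
    finally show ?thesis .
  qed
  have "inj_on (rank_of n) \<Sigma>"
  proof (rule inj_onI)
    fix V W assume VW: "V \<in> \<Sigma>" "W \<in> \<Sigma>" "rank_of n V = rank_of n W"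
    then have "V = W \<or> V \<subseteq> W \<or> W \<subseteq> V" using \<Sigma>(2) unfolding clique_def by blast
    moreover have "V \<in> rational_spaces n" "W \<in> rational_spaces n" using VW \<Sigma> by auto
    ultimately show "V = W" using eq[of V W] eq[of W V] VW(3) by auto
  qed
  moreover have "rank_of n ` \<Sigma> \<subseteq> {1..Suc n}"
  proof
    fix k assume "k \<in> rank_of n ` \<Sigma>"
    then obtain V where V: "V \<in> rational_spaces n" "k = rank_of n V" using \<Sigma> by blast
    then show "k \<in> {1..Suc n}"
      using primitive_basis(1)[OF V(1)] independent_rank_le[OF primitive_basis(2)[OF V(1)]] by simp
  qed
  ultimately have "card \<Sigma> \<le> card {1..Suc n}" by (intro card_inj_on_le[of "rank_of n"]) auto
  then show ?thesis by simp
qed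

definition short_vector :: "nat \<Rightarrow> real \<Rightarrow> (nat \<Rightarrow> nat) \<Rightarrow> (nat \<Rightarrow> 'k fls) \<Rightarrow> (nat \<Rightarrow> 'k fls) \<Rightarrow> bool" where
  "short_vector n \<epsilon> t y v \<longleftrightarrow> (\<forall>j\<le>n. v j \<in> \<Lambda>) \<and> (\<exists>j\<le>n. v j \<noteq> 0) \<and>
     (\<forall>j\<le>n. exp (weight t j) * fls_abs (shear n y v j) < \<epsilon>)"

text \<open>
  Let \<open>\<Sigma>\<close> be the flag that marks \<open>y\<close>, and \<open>span M\<close> its largest member that does not contain the
  short vector \<open>v\<close>, or the zero space if there is none. Adding \<open>v\<close> gives a subspace of covolume less
  than \<open>\<epsilon>\<close>. It contains the members of \<open>\<Sigma>\<close> without \<open>v\<close> and is contained in the others. As a member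
  of \<open>\<Sigma>\<close> it would have covolume at least \<open>\<epsilon>\<close>, and otherwise at least \<open>1\<close>.
\<close>

lemma no_short_vector_if_marked:
  assumes y: "\<forall>i\<in>{1..n}. y i \<in> F" and \<epsilon>: "0 < \<epsilon>" "\<epsilon> \<le> 1"
    and marked: "marked comparable (covol n t) \<epsilon> (rational_spaces n) y"
  shows "\<not> short_vector n \<epsilon> t y v"
proof
  assume v: "short_vector n \<epsilon> t y v"
  obtain \<Sigma> where \<Sigma>: "\<Sigma> \<subseteq> rational_spaces n" "clique comparable \<Sigma>"
    and in_\<Sigma>: "\<And>V. V \<in> \<Sigma> \<Longrightarrow> \<epsilon> \<le> covol n t V y \<and> covol n t V y < 1"
    and out_\<Sigma>: "\<And>V. V \<in> rational_spaces n - \<Sigma> \<Longrightarrow> (\<forall>W\<in>\<Sigma>. comparable V W) \<Longrightarrow> 1 \<le> covol n t V y"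
  proof -
    obtain \<Sigma> where *: "\<Sigma> \<subseteq> rational_spaces n \<and> clique comparable \<Sigma> \<and>
        (\<forall>s\<in>\<Sigma>. \<epsilon> \<le> covol n t s y \<and> covol n t s y < 1) \<and>
        (\<forall>s\<in>rational_spaces n - \<Sigma>. (\<forall>W\<in>\<Sigma>. comparable s W) \<longrightarrow> 1 \<le> covol n t s y)"
      using marked unfolding marked_def by (elim exE)
    show ?thesis by (rule that[of \<Sigma>]) (use * in simp_all)
  qed
  have "\<exists>k M. independent_rows n k M \<and> vol n k M t y \<le> 1 \<and> v \<notin> rational_span n k M \<and>
    (\<forall>V\<in>\<Sigma>. (v \<notin> V \<longrightarrow> V \<subseteq> rational_span n k M) \<and> (v \<in> V \<longrightarrow> rational_span n k M \<subseteq> V))"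
  proof (cases "\<forall>V\<in>\<Sigma>. v \<in> V")
    case True
    let ?M = "\<lambda>_ _. 0 :: 'k fls"
    have "independent_rows n 0 ?M" by (simp add: independent_rows_def integral_rows_def)
    moreover have "v \<notin> rational_span n 0 ?M"
    proof
      assume "v \<in> rational_span n 0 ?M"
      then obtain D where "D \<in> \<Lambda>" "D \<noteq> 0" "\<forall>j\<le>n. D * v j = 0"
        unfolding rational_span_def by auto
      then have "\<forall>j\<le>n. v j = 0" using v F_mult_eq_0 \<Lambda>_in_F unfolding short_vector_def by blast
      then show False using v unfolding short_vector_def by blast
    qed
    moreover have "rational_span n 0 ?M \<subseteq> V" if V: "V \<in> \<Sigma>" for V
    proof -
      have V': "V \<in> rational_spaces n" using V \<Sigma> by blast
      have "rational_span n 0 ?M \<subseteq> rational_span n (rank_of n V) (basis_of n V)"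
        by (rule rational_span_subset) simp
      then show ?thesis using primitive_basis(3)[OF V'] by simp
    qed
    ultimately show ?thesis using True vol_0[of n ?M t y] by (intro exI[of _ 0] exI[of _ ?M]) auto
  next
    case False
    have "finite {V \<in> \<Sigma>. v \<notin> V}" "{V \<in> \<Sigma>. v \<notin> V} \<noteq> {}"
      using \<Sigma>(2) False by (auto simp: clique_def)
    from finite_has_maximal[OF this] obtain W where W: "W \<in> \<Sigma>" "v \<notin> W"
      and max: "\<And>V. V \<in> \<Sigma> \<Longrightarrow> v \<notin> V \<Longrightarrow> W \<subseteq> V \<Longrightarrow> W = V" by blast
    have W': "W \<in> rational_spaces n" using W \<Sigma> by blast
    have comp: "V \<subseteq> W \<or> W \<subseteq> V" if "V \<in> \<Sigma>" for V
      using that W \<Sigma>(2) unfolding clique_def by blast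
    have "(v \<notin> V \<longrightarrow> V \<subseteq> W) \<and> (v \<in> V \<longrightarrow> W \<subseteq> V)" if "V \<in> \<Sigma>" for V
      using comp[OF that] max[OF that] W(2) by blast
    moreover have "vol n (rank_of n W) (basis_of n W) t y \<le> 1"
      using in_\<Sigma>[OF W(1)] by (simp add: covol_def)
    ultimately show ?thesis
      using primitive_basis(2,3)[OF W'] W(2)
      by (intro exI[of _ "rank_of n W"] exI[of _ "basis_of n W"]) simp
  qed
  then obtain k M where M: "independent_rows n k M" and vol1: "vol n k M t y \<le> 1"
    and vM: "v \<notin> rational_span n k M"
    and nested: "\<forall>V\<in>\<Sigma>. (v \<notin> V \<longrightarrow> V \<subseteq> rational_span n k M) \<and> (v \<in> V \<longrightarrow> rational_span n k M \<subseteq> V)"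
    by (elim exE conjE)
  have below: "V \<subseteq> rational_span n k M" if "V \<in> \<Sigma>" "v \<notin> V" for V using nested that by simp
  have above: "rational_span n k M \<subseteq> V" if "V \<in> \<Sigma>" "v \<in> V" for V using nested that by simp
  let ?N = "M(k := v)"
  let ?W = "rational_span n (Suc k) ?N"
  have v\<Lambda>: "\<forall>j\<le>n. v j \<in> \<Lambda>" using v unfolding short_vector_def by blast
  have N: "independent_rows n (Suc k) ?N" by (rule independent_extend[OF M v\<Lambda> vM])
  have W: "?W \<in> rational_spaces n" unfolding rational_spaces_def using N by force
  have intM: "integral_rows n k M" and intN: "integral_rows n (Suc k) ?N"
    using M N by (auto simp: independent_rows_def)
  have "covol n t ?W y \<le> vol n (Suc k) ?N t y"
    by (rule primitive_basis(4)[OF W _ N refl y]) simp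
  also have "\<dots> < \<epsilon>"
    by (rule vol_extend_less[OF vol1 \<epsilon>(1)]) (use v in \<open>simp add: short_vector_def\<close>)
  finally have small: "covol n t ?W y < \<epsilon>" .
  have "comparable ?W V" if V: "V \<in> \<Sigma>" for V
  proof (cases "v \<in> V")
    case True
    have V': "V \<in> rational_spaces n" using V \<Sigma> by blast
    have "?W \<subseteq> rational_span n (rank_of n V) (basis_of n V)"
    proof (rule rational_span_subset)
      fix r assume "r < Suc k"
      then show "?N r \<in> rational_span n (rank_of n V) (basis_of n V)"
        using True above[OF V True] row_in_span[OF intM, of r] primitive_basis(3)[OF V']
        by (cases "r = k") auto
    qed
    then show ?thesis using primitive_basis(3)[OF V'] by simp
  next
    case False
    have "rational_span n k M \<subseteq> ?W"
    proof (rule rational_span_subset)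
      fix r assume "r < k"
      then show "M r \<in> ?W" using row_in_span[OF intN, of r] by simp
    qed
    then show ?thesis using below[OF V False] by blast
  qed
  then show False using in_\<Sigma>[of ?W] out_\<Sigma>[of ?W] W small \<epsilon>(2) by fastforce
qed

text \<open>
  The cases are: the column \<open>0\<close> is selected twice, exactly once, or not at all.
\<close>

lemma minor_shear_affine:
  assumes k: "1 \<le> k" and M: "integral_rows n k M" and c: "c \<in> col_choices n k"
  shows "\<exists>coef\<in>{0..n} \<rightarrow> F. \<forall>y. minor k c (\<lambda>r. shear n y (M r)) = affine_comb n coef y"
proof -
  have cn: "c s \<le> n" if "s < k" for s using col_choices_le[OF c that] .
  consider (two) s s' where "s < k" "s' < k" "s \<noteq> s'" "c s = 0" "c s' = 0"
    | (one) s where "s < k" "c s = 0" "\<And>q. q < k \<Longrightarrow> q \<noteq> s \<Longrightarrow> c q \<noteq> 0"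
    | (none) "\<And>q. q < k \<Longrightarrow> c q \<noteq> 0" by blast
  then show ?thesis
  proof cases
    case two
    have "minor k c (\<lambda>r. shear n y (M r)) = affine_comb n (\<lambda>_. 0) y" for y
      using minor_eq_0_if_not_inj[of s k s' c] two by (simp add: affine_comb_def)
    then show ?thesis by (intro bexI[of _ "\<lambda>_. 0"]) auto
  next
    case one
    have "minor k (c(s := i)) M \<in> F" if "i \<in> {0..n}" for i
      using cn that by (intro \<Lambda>_in_F minor_in_\<Lambda>[OF k M]) auto
    then show ?thesis using minor_shear[of s k c n _ M, OF one] by (intro bexI[of _ "\<lambda>i. minor k (c(s := i)) M"]) auto
  next
    case none
    let ?coef = "\<lambda>i::nat. if i = 0 then minor k c M else 0"
    have "minor k c (\<lambda>r. shear n y (M r)) = affine_comb n ?coef y" for y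
      using minor_shear_no_zero[of k c n y M, OF none] by (simp add: affine_comb_def)
    moreover have "minor k c M \<in> F" by (rule \<Lambda>_in_F[OF minor_in_\<Lambda>[OF k M cn]])
    ultimately show ?thesis by (intro bexI[of _ ?coef]) auto
  qed
qed

text \<open>
  If some nonzero minor avoids the column \<open>0\<close>, replace one of its columns by \<open>0\<close>: the column \<open>m\<close> if
  it is selected, and any other one if not. The resulting minor is an affine form in \<open>y\<close> that has the
  original minor, a nonzero polynomial, among its coefficients. In its weight
  \<open>t\<^sub>0 - \<Sum> t\<^sub>i\<close>, with the sum over the remaining columns, the term \<open>t\<^sub>m\<close> of \<open>t\<^sub>0\<close> is not cancelled.
  If all minors that avoid the column \<open>0\<close> vanish, then a nonzero minor that contains it is constant
  in \<open>y\<close> and has nonnegative weight.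
\<close>

lemma vol_lower_bound:
  assumes k: "1 \<le> k" and M: "independent_rows n k M" and t: "t 0 = (\<Sum>i=1..n. t i)"
    and m: "m \<in> {1..n}"
  shows "(\<forall>y. 1 \<le> vol n k M t y) \<or>
    (\<exists>coef\<in>{0..n} \<rightarrow> F. (\<exists>i\<in>{1..n}. 1 \<le> fls_abs (coef i)) \<and>
      (\<forall>y. exp (real (t m)) * fls_abs (affine_comb n coef y) \<le> vol n k M t y))"
proof -
  have int: "integral_rows n k M" using M by (simp add: independent_rows_def)
  have weight_ge: "real (\<Sum>i\<in>{1..n} - J. t i) \<le> (\<Sum>s<k. weight t (c s))"
    if s0: "s0 < k" "c s0 = 0" and inj: "inj_on c ({..<k} - {s0})"
      and J: "c ` ({..<k} - {s0}) \<subseteq> J" "J \<subseteq> {1..n}" for c s0 J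
  proof -
    have finJ: "finite J" using J(2) finite_subset by blast
    have "(\<Sum>s\<in>{..<k} - {s0}. t (c s)) = sum t (c ` ({..<k} - {s0}))"
      using inj by (simp add: sum.reindex)
    also have "\<dots> \<le> sum t J" using J finJ by (intro sum_mono2) auto
    finally have le: "(\<Sum>s\<in>{..<k} - {s0}. t (c s)) \<le> sum t J" .
    have "(\<Sum>s<k. weight t (c s)) = weight t (c s0) + (\<Sum>s\<in>{..<k} - {s0}. weight t (c s))"
      using s0 by (intro sum.remove) auto
    also have "(\<Sum>s\<in>{..<k} - {s0}. weight t (c s)) = (\<Sum>s\<in>{..<k} - {s0}. - real (t (c s)))"
    proof (rule sum.cong)
      fix s assume "s \<in> {..<k} - {s0}"
      then have "c s \<in> {1..n}" using J by blast
      then show "weight t (c s) = - real (t (c s))" by (simp add: weight_def)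
    qed simp
    also have "\<dots> = - real (\<Sum>s\<in>{..<k} - {s0}. t (c s))" by (simp add: sum_negf)
    finally have w: "(\<Sum>s<k. weight t (c s)) = real (t 0) - real (\<Sum>s\<in>{..<k} - {s0}. t (c s))"
      using s0 by (simp add: weight_def)
    have "sum t {1..n} = sum t ({1..n} - J) + sum t J"
      using J(2) by (intro sum.subset_diff) auto
    then have "real (t 0) = real (sum t ({1..n} - J)) + real (sum t J)" using t by simp
    moreover have "real (\<Sum>s\<in>{..<k} - {s0}. t (c s)) \<le> real (sum t J)"
      using le by (rule of_nat_mono)
    ultimately show ?thesis unfolding w by linarith
  qed
  show ?thesis
  proof (cases "\<exists>c\<in>col_choices n k. (\<forall>s<k. c s \<noteq> 0) \<and> minor k c M \<noteq> 0")
    case True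
    then obtain c where c: "c \<in> col_choices n k" and c0: "\<And>s. s < k \<Longrightarrow> c s \<noteq> 0" and nz: "minor k c M \<noteq> 0"
      by blast
    have cn: "c s \<le> n" if "s < k" for s using col_choices_le[OF c that] .
    have inj: "inj_on c {..<k}" by (rule minor_nonzero_imp_inj[OF nz])
    obtain s0 where s0: "s0 < k" "\<And>s. s < k \<Longrightarrow> s \<noteq> s0 \<Longrightarrow> c s \<noteq> m"
    proof (cases "m \<in> c ` {..<k}")
      case True
      then obtain s0 where "s0 < k" "c s0 = m" by auto
      then show ?thesis using that[of s0] inj by (auto simp: inj_on_def)
    next
      case False
      then show ?thesis using that[of 0] k by auto
    qed
    let ?c = "c(s0 := 0)"
    let ?coef = "\<lambda>i. minor k (?c(s0 := i)) M"
    have sh: "minor k ?c (\<lambda>r. shear n y (M r)) = affine_comb n ?coef y" for y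
      by (rule minor_shear[of s0]) (use s0 c0 in auto)
    have coef\<Lambda>: "?coef i \<in> \<Lambda>" if "i \<in> {0..n}" for i
      using cn that by (intro minor_in_\<Lambda>[OF k int]) auto
    have cs0: "c s0 \<in> {1..n}" using c0[OF s0(1)] cn[OF s0(1)] by simp
    have "?coef (c s0) = minor k c M" by (rule minor_cong) auto
    then have "1 \<le> fls_abs (?coef (c s0))"
      using coef\<Lambda>[of "c s0"] cs0 nz by (intro fls_abs_ge_1) auto
    moreover have "exp (real (t m)) * fls_abs (affine_comb n ?coef y) \<le> vol n k M t y" for y
    proof -
      have "real (\<Sum>i\<in>{1..n} - ({1..n} - {m}). t i) \<le> (\<Sum>s<k. weight t (?c s))"
      proof (rule weight_ge[OF s0(1)])
        show "inj_on ?c ({..<k} - {s0})" using inj by (auto simp: inj_on_def)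
        show "?c ` ({..<k} - {s0}) \<subseteq> {1..n} - {m}"
          using s0 c0 cn by (auto simp: Suc_le_eq)
      qed auto
      moreover have "{1..n} - ({1..n} - {m}) = {m}" using m by blast
      ultimately have "exp (real (t m)) \<le> exp (\<Sum>s<k. weight t (?c s))" by simp
      then have "exp (real (t m)) * fls_abs (affine_comb n ?coef y)
          \<le> exp (\<Sum>s<k. weight t (?c s)) * fls_abs (minor k ?c (\<lambda>r. shear n y (M r)))"
        unfolding sh by (intro mult_right_mono) auto
      also have "\<dots> \<le> vol n k M t y" by (rule le_vol) (use cn in auto)
      finally show ?thesis .
    qed
    ultimately show ?thesis using coef\<Lambda> \<Lambda>_in_F cs0 by (intro disjI2 bexI[of _ ?coef] conjI bexI[of _ "c s0"]) auto
  next
    case False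
    obtain c where c: "c \<in> col_choices n k" and nz: "minor k c M \<noteq> 0"
      using M by (auto simp: independent_rows_def)
    have cn: "c s \<le> n" if "s < k" for s using col_choices_le[OF c that] .
    have inj: "inj_on c {..<k}" by (rule minor_nonzero_imp_inj[OF nz])
    obtain s0 where s0: "s0 < k" "c s0 = 0" using False c nz by blast
    have others: "c s \<noteq> 0" if "s < k" "s \<noteq> s0" for s
      using inj_onD[OF inj, of s s0] s0 that by auto
    have zero: "minor k (c(s0 := i)) M = 0" if i: "i \<in> {1..n}" for i
    proof -
      have "c(s0 := i) \<in> col_choices n k" using c i s0 by (auto simp: PiE_def Pi_def extensional_def)
      moreover have "(c(s0 := i)) s \<noteq> 0" if "s < k" for s using others that i by auto
      ultimately show ?thesis using False by blast
    qed
    have "1 \<le> vol n k M t y" for y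
    proof -
      have "minor k c (\<lambda>r. shear n y (M r)) = affine_comb n (\<lambda>i. minor k (c(s0 := i)) M) y"
        using minor_shear[of s0 k c n y M, OF s0 others] .
      also have "\<dots> = minor k (c(s0 := 0)) M" using zero by (simp add: affine_comb_def)
      also have "c(s0 := 0) = c" using s0 by auto
      finally have sh: "minor k c (\<lambda>r. shear n y (M r)) = minor k c M" .
      have "real (\<Sum>i\<in>{1..n} - {1..n}. t i) \<le> (\<Sum>s<k. weight t (c s))"
      proof (rule weight_ge[of s0 c "{1..n}", OF s0])
        show "inj_on c ({..<k} - {s0})" using inj by (rule inj_on_subset) auto
        show "c ` ({..<k} - {s0}) \<subseteq> {1..n}"
        proof (rule image_subsetI)
          fix s assume "s \<in> {..<k} - {s0}"
          then show "c s \<in> {1..n}" using others[of s] cn[of s] by simp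
        qed
      qed auto
      then have "0 \<le> (\<Sum>s<k. weight t (c s))" by simp
      then have "1 \<le> exp (\<Sum>s<k. weight t (c s))" by simp
      moreover have "1 \<le> fls_abs (minor k c M)"
        by (rule fls_abs_ge_1[OF minor_in_\<Lambda>[OF k int cn] nz])
      ultimately have "1 * 1 \<le> exp (\<Sum>s<k. weight t (c s)) * fls_abs (minor k c (\<lambda>r. shear n y (M r)))"
        unfolding sh by (intro mult_mono) auto
      also have "\<dots> \<le> vol n k M t y" by (rule le_vol) (use cn in auto)
      finally show ?thesis by simp
    qed
    then show ?thesis by blast
  qed
qed

text \<open>
  Linear independence of \<open>1, f\<^sub>1, \<dots>, f\<^sub>n\<close> on \<open>Z\<close> gives \<open>n + 1\<close> points of \<open>Z\<close> whose matrix of values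
  has a nonzero determinant: if the first \<open>k + 1\<close> points and functions are settled, expanding along a
  new last row gives a nontrivial affine form in the values at the new point, which is nonzero
  somewhere on \<open>Z\<close>. By Cramer's rule the coefficients of a form are bounded in terms of its values at
  these points.
\<close>

lemma affine_forms_bounded_below:
  fixes f :: "'p \<Rightarrow> nat \<Rightarrow> 'k fls"
  assumes f: "\<And>z i. z \<in> Z \<Longrightarrow> i \<in> {1..n} \<Longrightarrow> f z i \<in> F"
    and indep: "\<And>coef. coef \<in> {0..n} \<rightarrow> F \<Longrightarrow> (\<forall>z\<in>Z. affine_comb n coef (f z) = 0) \<Longrightarrow>
      (\<forall>i\<in>{0..n}. coef i = 0)"
  shows "\<exists>b>0. \<forall>coef\<in>{0..n} \<rightarrow> F. (\<exists>i\<in>{1..n}. 1 \<le> fls_abs (coef i)) \<longrightarrow>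
    (\<exists>z\<in>Z. b \<le> fls_abs (affine_comb n coef (f z)))"
proof -
  define h where "h z j = (if j = 0 then unit_series else f z j)" for z j
  have hF: "h z j \<in> F" if "z \<in> Z" "j \<le> n" for z j
    using f[of z j] that unit_series_in_\<Lambda> \<Lambda>_in_F by (auto simp: h_def)
  have affine: "(\<Sum>j\<in>{0..n}. h z j * coef j) = affine_comb n coef (f z)" if "coef \<in> {0..n} \<rightarrow> F" for z coef
  proof -
    have "coef 0 \<in> F" using that by auto
    then have "h z 0 * coef 0 = coef 0" by (simp add: h_def unit_series_mult)
    moreover have "(\<Sum>j\<in>{0..n}. h z j * coef j) = h z 0 * coef 0 + (\<Sum>j=1..n. h z j * coef j)"
      by (simp add: sum.atLeast_Suc_atMost)
    moreover have "(\<Sum>j=1..n. h z j * coef j) = (\<Sum>j=1..n. coef j * f z j)"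
      by (intro sum.cong) (auto simp: h_def mult.commute)
    ultimately show ?thesis by (simp add: affine_comb_def)
  qed
  have "\<exists>zs. (\<forall>r<Suc k. zs r \<in> Z) \<and> minor (Suc k) (\<lambda>s. s) (\<lambda>r. h (zs r)) \<noteq> 0" if "k \<le> n" for k
    using that
  proof (induction k)
    case 0
    have "Z \<noteq> {}"
    proof
      assume "Z = {}"
      then have "\<forall>i\<in>{0..n}. unit_series = 0"
        using unit_series_in_\<Lambda> \<Lambda>_in_F by (intro indep[of "\<lambda>_. unit_series"]) auto
      then show False using unit_series_nonzero by auto
    qed
    then obtain z where z: "z \<in> Z" by blast
    have "minor (Suc 0) (\<lambda>s. s) (\<lambda>r. h z) = unit_series"
      unfolding minor_last_row by (simp add: h_def)
    then show ?case using z unit_series_nonzero by (intro exI[of _ "\<lambda>_. z"]) simp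
  next
    case (Suc k)
    then obtain zs where zs: "\<forall>r<Suc k. zs r \<in> Z" and nz: "minor (Suc k) (\<lambda>s. s) (\<lambda>r. h (zs r)) \<noteq> 0"
      by auto
    define coef where "coef j = (if j \<le> Suc k then
      (-1) ^ (Suc k + j) * minor (Suc k) (insert_index j) (\<lambda>r. h (zs r)) else 0)" for j
    have coefF: "coef \<in> {0..n} \<rightarrow> F"
    proof
      fix j assume "j \<in> {0..n}"
      have "minor (Suc k) (insert_index j) (\<lambda>r. h (zs r)) \<in> F" if "j \<le> Suc k"
        unfolding minor_def
      proof (rule det_in_F)
        fix r s assume "r < Suc k" "s < Suc k"
        then show "h (zs r) (insert_index j s) \<in> F"
          using zs Suc.prems by (intro hF) (auto simp: insert_index_def)
      qed simp
      then show "coef j \<in> F" using F_uminus by (cases "even (Suc k + j)") (auto simp: coef_def)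
    qed
    have "coef (Suc k) = minor (Suc k) (\<lambda>s. s) (\<lambda>r. h (zs r))"
    proof -
      have "minor (Suc k) (insert_index (Suc k)) (\<lambda>r. h (zs r)) = minor (Suc k) (\<lambda>s. s) (\<lambda>r. h (zs r))"
        by (rule minor_cong) (simp add: insert_index_def)
      then show ?thesis by (simp add: coef_def)
    qed
    then have "coef (Suc k) \<noteq> 0" using nz by simp
    moreover have "Suc k \<in> {0..n}" using Suc.prems by simp
    ultimately obtain z where z: "z \<in> Z" "affine_comb n coef (f z) \<noteq> 0"
      using indep[OF coefF] by blast
    let ?zs = "zs(Suc k := z)"
    have "minor (Suc (Suc k)) (\<lambda>s. s) (\<lambda>r. h (?zs r)) = (\<Sum>j<Suc (Suc k). h z j * coef j)"
      proof (subst minor_last_row, rule sum.cong)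
      fix j assume j: "j \<in> {..<Suc (Suc k)}"
      have "minor (Suc k) (insert_index j) (\<lambda>r. h (?zs r)) = minor (Suc k) (insert_index j) (\<lambda>r. h (zs r))"
        by (rule minor_cong) auto
      then show "h (?zs (Suc k)) j * ((-1) ^ (Suc k + j) * minor (Suc k) (\<lambda>s. insert_index j s) (\<lambda>r. h (?zs r)))
        = h z j * coef j" using j by (simp add: coef_def)
    qed simp
    also have "\<dots> = (\<Sum>j\<in>{0..n}. h z j * coef j)"
      using Suc.prems by (intro sum.mono_neutral_left) (auto simp: coef_def)
    also have "\<dots> = affine_comb n coef (f z)" by (rule affine[OF coefF])
    finally have "minor (Suc (Suc k)) (\<lambda>s. s) (\<lambda>r. h (?zs r)) \<noteq> 0" using z by simp
    moreover have "\<forall>r<Suc (Suc k). ?zs r \<in> Z" using zs z by (auto simp: less_Suc_eq)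
    ultimately show ?case by blast
  qed
  from this[of n] obtain zs where zs: "\<And>r. r < Suc n \<Longrightarrow> zs r \<in> Z"
    and nz: "minor (Suc n) (\<lambda>s. s) (\<lambda>r. h (zs r)) \<noteq> 0" by auto
  define A where "A = mat (Suc n) (Suc n) (\<lambda>(r, s). h (zs r) s)"
  have A: "A \<in> carrier_mat (Suc n) (Suc n)" by (simp add: A_def)
  have detA: "det A \<noteq> 0" using nz by (simp add: A_def minor_def)
  have detF: "det A \<in> F" unfolding A_def by (rule det_in_F) (use zs hF in auto)
  define m where "m = Max ((\<lambda>(i, r). fls_abs (adj_mat A $$ (i, r))) ` ({..n} \<times> {..n}))"
  have m: "fls_abs (adj_mat A $$ (i, r)) \<le> m" if "i \<le> n" "r \<le> n" for i r
  proof -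
    have "fls_abs (adj_mat A $$ (i, r)) \<in> (\<lambda>(i, r). fls_abs (adj_mat A $$ (i, r))) ` ({..n} \<times> {..n})"
      using that by force
    then show ?thesis unfolding m_def by (intro Max_ge) auto
  qed
  have m0: "0 \<le> m" using m[of 0 0] fls_abs_nonneg order_trans by blast
  define b where "b = fls_abs (det A) / (1 + m)"
  have dpos: "0 < fls_abs (det A)" using detA by (simp add: less_le)
  have b: "0 < b" using dpos m0 by (simp add: b_def)
  have mb: "m * b < fls_abs (det A)"
    unfolding b_def using dpos m0 by (simp add: field_simps)
  have "\<exists>z\<in>Z. b \<le> fls_abs (affine_comb n coef (f z))"
    if coef: "coef \<in> {0..n} \<rightarrow> F" and i: "i \<in> {1..n}" "1 \<le> fls_abs (coef i)" for coef i
  proof (rule ccontr)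
    assume "\<not> ?thesis"
    then have less: "fls_abs (affine_comb n coef (f z)) < b" if "z \<in> Z" for z using that by force
    have adj: "(\<Sum>r<Suc n. adj_mat A $$ (i, r) * h (zs r) s) = (if s = i then det A else 0)"
      if s: "s < Suc n" for s
    proof -
      have "(adj_mat A * A) $$ (i, s) = (det A \<cdot>\<^sub>m 1\<^sub>m (Suc n)) $$ (i, s)"
        using adj_mat(3)[OF A] by simp
      moreover have "adj_mat A \<in> carrier_mat (Suc n) (Suc n)" using adj_mat(1)[OF A] .
      moreover have "A $$ (r, s) = h (zs r) s" if "r < Suc n" for r using that s by (simp add: A_def)
      ultimately show ?thesis using s i A by (auto simp: scalar_prod_def lessThan_atLeast0)
    qed
    have "(\<Sum>r<Suc n. adj_mat A $$ (i, r) * affine_comb n coef (f (zs r)))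
      = (\<Sum>r<Suc n. \<Sum>s<Suc n. adj_mat A $$ (i, r) * h (zs r) s * coef s)"
    proof (rule sum.cong)
      fix r
      have "affine_comb n coef (f (zs r)) = (\<Sum>s<Suc n. h (zs r) s * coef s)"
        unfolding affine[OF coef, symmetric] by (rule sum.cong) auto
      then show "adj_mat A $$ (i, r) * affine_comb n coef (f (zs r))
          = (\<Sum>s<Suc n. adj_mat A $$ (i, r) * h (zs r) s * coef s)"
        by (simp only: sum_distrib_left mult.assoc)
    qed simp
    also have "\<dots> = (\<Sum>s<Suc n. (\<Sum>r<Suc n. adj_mat A $$ (i, r) * h (zs r) s) * coef s)"
      by (subst sum.swap) (simp only: sum_distrib_right)
    also have "\<dots> = (\<Sum>s<Suc n. if s = i then det A * coef s else 0)"
      using adj by (intro sum.cong) auto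
    also have "\<dots> = det A * coef i" using i by simp
    finally have cramer: "(\<Sum>r<Suc n. adj_mat A $$ (i, r) * affine_comb n coef (f (zs r))) = det A * coef i" .
    have "fls_abs (\<Sum>r<Suc n. adj_mat A $$ (i, r) * affine_comb n coef (f (zs r))) < fls_abs (det A)"
    proof (rule fls_abs_sum_less[OF _ dpos])
      fix r assume r: "r \<in> {..<Suc n}"
      have "fls_abs (adj_mat A $$ (i, r) * affine_comb n coef (f (zs r)))
          \<le> fls_abs (adj_mat A $$ (i, r)) * fls_abs (affine_comb n coef (f (zs r)))"
        by (rule fls_abs_mult_le)
      also have "\<dots> \<le> m * b"
        using m[of i r] less[of "zs r"] zs r i m0 by (intro mult_mono) auto
      finally show "fls_abs (adj_mat A $$ (i, r) * affine_comb n coef (f (zs r))) < fls_abs (det A)"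
        using mb by linarith
    qed
    moreover have "coef i \<in> F" using coef i by auto
    ultimately have "fls_abs (det A) * fls_abs (coef i) < fls_abs (det A)"
      unfolding cramer using fls_abs_mult[OF detF] by simp
    moreover have "fls_abs (det A) * 1 \<le> fls_abs (det A) * fls_abs (coef i)"
      using i(2) by (intro mult_left_mono) auto
    ultimately show False by simp
  qed
  then show ?thesis using b by blast
qed

end

section \<open>Dirichlet improvable vectors on a good nonplanar map\<close>

context series_space
begin

lemma openin_affine_less:
  assumes \<delta>: "0 < \<delta>"
  shows "openin X {y \<in> S. fls_abs (affine_comb d coef y) < \<delta>}"
  unfolding openin_iff_lball[of _ 0]
proof (intro conjI ballI)
  fix y assume y: "y \<in> {y \<in> S. fls_abs (affine_comb d coef y) < \<delta>}"
  define b where "b = 1 + (\<Sum>i=1..d. fls_abs (coef i))"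
  have b: "fls_abs (coef i) < b" if "i \<in> {1..d}" for i
  proof -
    have "fls_abs (coef i) \<le> (\<Sum>i=1..d. fls_abs (coef i))" using that by (intro member_le_sum) auto
    then show ?thesis by (simp add: b_def)
  qed
  have b0: "0 < b" unfolding b_def by (intro add_pos_nonneg sum_nonneg) auto
  obtain k where k: "k \<le> 0" "exp (real_of_int k) \<le> \<delta> / b" using exp_le_ex[of "\<delta> / b" 0] \<delta> b0 by auto
  have "fls_abs (affine_comb d coef z) < \<delta>" if z: "z \<in> lball y k" for z
  proof -
    have "fls_abs (\<Sum>i=1..d. coef i * (z i - y i)) < \<delta>"
    proof (rule fls_abs_sum_less[OF _ \<delta>])
      fix i assume i: "i \<in> {1..d}"
      have "vec_dist d y z < exp (real_of_int k)"
        using z by (simp add: lball_def vec_ball_eq)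
      then have "fls_abs (z i - y i) < exp (real_of_int k)"
        using i by (simp add: vec_dist_less_iff fls_abs_commute)
      then have less: "fls_abs (z i - y i) < \<delta> / b" using k by linarith
      have "fls_abs (coef i * (z i - y i)) \<le> fls_abs (coef i) * fls_abs (z i - y i)" by (rule fls_abs_mult_le)
      also have "\<dots> \<le> b * fls_abs (z i - y i)" using b[OF i] by (intro mult_right_mono) auto
      also have "\<dots> < b * (\<delta> / b)" using less b0 by (intro mult_strict_left_mono)
      finally show "fls_abs (coef i * (z i - y i)) < \<delta>" using b0 by simp
    qed
    moreover have "affine_comb d coef z = affine_comb d coef y + (\<Sum>i=1..d. coef i * (z i - y i))"
      by (simp add: affine_comb_def right_diff_distrib sum_subtractf)
    ultimately show ?thesis
      using y by (simp only:) (intro order_le_less_trans[OF fls_abs_add_le], simp)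
  qed
  then show "\<exists>k\<le>0. lball y k \<subseteq> {y \<in> S. fls_abs (affine_comb d coef y) < \<delta>}"
    using k lball_subset by blast
qed auto

end

locale good_nonplanar_map = radon_series_space K d \<nu>
  for K :: "'k::comm_ring_1 set" and d :: nat and \<nu> :: "(nat \<Rightarrow> 'k fls) measure" +
  fixes n :: nat and U :: "(nat \<Rightarrow> 'k fls) set" and f :: "(nat \<Rightarrow> 'k fls) \<Rightarrow> nat \<Rightarrow> 'k fls"
    and C \<alpha> D :: real
  assumes n_pos: "1 \<le> n" and C_pos: "0 < C" and \<alpha>_pos: "0 < \<alpha>" and D_pos: "0 < D"
    and openU: "openin X U"
    and federer: "federer K d \<nu> U D"
    and cont: "continuous_map (subtopology X U) (vec_top K n) f"
    and good: "good_map K d n \<nu> U C \<alpha> f"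
    and nonplanar: "nonplanar K d n \<nu> U f"
begin

sublocale target: series_space K n
  by unfold_locales (rule n_pos)

lemma U_subset: "U \<subseteq> S"
  using openU openin_subset by fastforce

lemma f_in: "x \<in> U \<Longrightarrow> f x \<in> vec_space K n"
  using cont U_subset by (auto simp: continuous_map_def)

lemma f_coord: "x \<in> U \<Longrightarrow> \<forall>i\<in>{1..n}. f x i \<in> F"
  using f_in[of x] by (auto simp: vec_space_def)

lemma openin_affine_f_less:
  assumes "0 < \<delta>"
  shows "openin X {x \<in> U. fls_abs (affine_comb n coef (f x)) < \<delta>}"
proof -
  have "openin (subtopology X U)
    {x \<in> topspace (subtopology X U). f x \<in> {y \<in> vec_space K n. fls_abs (affine_comb n coef y) < \<delta>}}"
    by (rule openin_continuous_map_preimage[OF cont target.openin_affine_less[OF assms]])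
  also have "{x \<in> topspace (subtopology X U). f x \<in> {y \<in> vec_space K n. fls_abs (affine_comb n coef y) < \<delta>}}
    = {x \<in> U. fls_abs (affine_comb n coef (f x)) < \<delta>}"
    using U_subset f_in by auto
  finally show ?thesis using openU openin_trans_full by blast
qed

text \<open>
  As \<open>e \<le> 3\<close>, a ball of a third of the radius \<open>e\<^sup>k\<^sup>+\<^sup>1\<close> is contained in the ball of radius \<open>e\<^sup>k\<close>.
\<close>

lemma emeasure_lball_doubling:
  assumes y: "y \<in> supp" and sub: "lball y (k + 1) \<subseteq> U"
  shows "emeasure \<nu> (lball y (k + 1)) \<le> ennreal D * emeasure \<nu> (lball y k)"
proof -
  define r where "r = exp (real_of_int (k + 1)) / 3"
  have r: "0 < r" by (simp add: r_def)
  have "exp (real_of_int (k + 1)) = exp 1 * exp (real_of_int k)" by (simp add: exp_add)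
  also have "\<dots> \<le> 3 * exp (real_of_int k)" using exp_le by (intro mult_right_mono) auto
  finally have "r \<le> exp (real_of_int k)" by (simp add: r_def)
  then have small: "vec_ball K d y r \<subseteq> lball y k"
    unfolding lball_def vec_ball_eq by (rule M.mball_subset_concentric)
  have big: "vec_ball K d y (3 * r) = lball y (k + 1)" by (simp add: r_def lball_def)
  let ?a = "emeasure \<nu> (lball y (k + 1))" and ?b = "emeasure \<nu> (vec_ball K d y r)"
  have "?b \<noteq> 0"
  proof -
    have "openin X (vec_ball K d y r)" "y \<in> vec_ball K d y r"
      using r y supp_subset by (auto simp: X_eq vec_ball_eq)
    then have "0 < ?b" using y by (auto simp: measure_supp_def)
    then show ?thesis by simp
  qed
  moreover have le: "?b \<le> emeasure \<nu> (lball y k)" using small by (intro emeasure_mono) auto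
  moreover have "?b \<noteq> top_class.top" using le lball_finite[of y k] by (auto simp: top_unique)
  ultimately have "?b * (?a / ?b) = ?a"
    unfolding ennreal_times_divide by (subst mult.commute) (rule mult_divide_eq_ennreal)
  moreover have "?a / ?b \<le> ennreal D"
    using federer y r sub unfolding federer_def big[symmetric] by blast
  ultimately have "?a \<le> ?b * ennreal D" by (metis mult_left_mono zero_le)
  then have "?a \<le> ennreal D * ?b" by (simp only: mult.commute)
  also have "\<dots> \<le> ennreal D * emeasure \<nu> (lball y k)" using le by (intro mult_left_mono) auto
  finally show ?thesis .
qed

lemma openin_covol_less:
  assumes V: "V \<in> rational_spaces n" and \<delta>: "0 < \<delta>"
  shows "openin X {x \<in> U. covol n t V (f x) < \<delta>}"
proof -
  let ?k = "rank_of n V" and ?M = "basis_of n V"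
  let ?g = "\<lambda>c x. exp (\<Sum>s<?k. weight t (c s)) * fls_abs (minor ?k c (\<lambda>r. shear n (f x) (?M r)))"
  have "{x \<in> U. covol n t V (f x) < \<delta>} = (\<Inter>c\<in>col_choices n ?k. {x \<in> U. ?g c x < \<delta>})"
    using col_choices_nonempty unfolding covol_def vol_less_iff by auto
  also have "openin X \<dots>"
  proof (rule openin_INT2)
    fix c assume c: "c \<in> col_choices n ?k"
    have "integral_rows n ?k ?M" using primitive_basis(2)[OF V] by (simp add: independent_rows_def)
    then obtain coef where coef: "\<And>y. minor ?k c (\<lambda>r. shear n y (?M r)) = affine_comb n coef y"
      using minor_shear_affine[OF primitive_basis(1)[OF V] _ c] by blast
    let ?w = "\<Sum>s<?k. weight t (c s)"
    have "openin X {x \<in> U. fls_abs (affine_comb n coef (f x)) < \<delta> * exp (- ?w)}"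
      using \<delta> by (intro openin_affine_f_less) auto
    then show "openin X {x \<in> U. ?g c x < \<delta>}" unfolding coef exp_mult_less_iff .
  qed (use finite_col_choices col_choices_nonempty in auto)
  finally show ?thesis .
qed

text \<open>
  At the point \<open>z\<close> some weighted minor is at least \<open>1\<close>. Where the covolume is less than \<open>\<epsilon>\<close>, so is
  this minor, and it is a constant multiple of a good affine form in \<open>f\<close>.
\<close>

lemma covol_good:
  assumes V: "V \<in> rational_spaces n" and \<epsilon>: "0 < \<epsilon>" and y: "y \<in> supp" and sub: "lball y k \<subseteq> U"
    and z: "z \<in> lball y k \<inter> supp" "1 \<le> covol n t V (f z)"
  shows "emeasure \<nu> {x \<in> lball y k. covol n t V (f x) < \<epsilon>}
    \<le> ennreal (C * \<epsilon> powr \<alpha>) * emeasure \<nu> (lball y k)"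
proof -
  let ?k = "rank_of n V" and ?M = "basis_of n V"
  let ?g = "\<lambda>c x. exp (\<Sum>s<?k. weight t (c s)) * fls_abs (minor ?k c (\<lambda>r. shear n (f x) (?M r)))"
  obtain c where c: "c \<in> col_choices n ?k" and large: "1 \<le> ?g c z"
    using z(2) unfolding covol_def vol_ge_iff by blast
  have "integral_rows n ?k ?M" using primitive_basis(2)[OF V] by (simp add: independent_rows_def)
  then obtain coef where coefF: "coef \<in> {0..n} \<rightarrow> F"
    and coef: "\<And>y. minor ?k c (\<lambda>r. shear n y (?M r)) = affine_comb n coef y"
    using minor_shear_affine[OF primitive_basis(1)[OF V] _ c] by blast
  define w where "w = (\<Sum>s<?k. weight t (c s))"
  define g where "g x = affine_comb n coef (f x)" for x
  let ?B = "vec_ball K d y (exp (real_of_int k))"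
  have B: "?B = lball y k" by (simp add: lball_def)
  define s where "s = sup_on_supp X \<nu> ?B g"
  have "\<not> exp w * fls_abs (g z) < 1" using large by (simp add: coef w_def g_def)
  then have gz: "exp (- w) \<le> fls_abs (g z)" unfolding exp_mult_less_iff by simp
  have "ennreal (fls_abs (g z)) \<le> s"
    unfolding s_def sup_on_supp_def B using z(1) by (rule SUP_upper)
  then have s: "ennreal (exp (- w)) \<le> s" using gz ennreal_leI order_trans by blast
  then have s0: "s \<noteq> 0" by (auto simp: ennreal_eq_0_iff not_le)
  have ratio: "enn2real (ennreal (\<epsilon> * exp (- w)) / s) \<le> \<epsilon>"
  proof (cases s)
    case (real r)
    then have r: "exp (- w) \<le> r" using s by (simp add: ennreal_le_iff)
    then have r0: "0 < r" using exp_gt_zero less_le_trans by blast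
    have "ennreal (\<epsilon> * exp (- w)) / s = ennreal (\<epsilon> * exp (- w) / r)"
      using real r0 \<epsilon> by (simp add: divide_ennreal)
    moreover have "\<epsilon> * exp (- w) / r \<le> \<epsilon>"
      using r r0 \<epsilon> by (simp add: divide_le_eq mult_left_mono)
    ultimately show ?thesis using r0 \<epsilon> by simp
  next
    case top
    then show ?thesis using \<epsilon> by simp
  qed
  have "{x \<in> lball y k. covol n t V (f x) < \<epsilon>} \<subseteq> {x \<in> ?B. fls_abs (g x) < \<epsilon> * exp (- w)}"
  proof
    fix x assume x: "x \<in> {x \<in> lball y k. covol n t V (f x) < \<epsilon>}"
    then have "?g c x < \<epsilon>" using c unfolding covol_def vol_less_iff by blast
    then have "exp w * fls_abs (g x) < \<epsilon>" by (simp add: coef w_def g_def)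
    then show "x \<in> {x \<in> ?B. fls_abs (g x) < \<epsilon> * exp (- w)}" using x B by (simp add: exp_mult_less_iff)
  qed
  moreover have "{x \<in> ?B. fls_abs (g x) < \<epsilon> * exp (- w)} \<in> sets \<nu>"
  proof -
    have "{x \<in> ?B. fls_abs (g x) < \<epsilon> * exp (- w)} = lball y k \<inter> {x \<in> U. fls_abs (g x) < \<epsilon> * exp (- w)}"
      using B sub by blast
    moreover have "openin X {x \<in> U. fls_abs (g x) < \<epsilon> * exp (- w)}"
      unfolding g_def using \<epsilon> by (intro openin_affine_f_less) auto
    ultimately show ?thesis using open_sets by simp
  qed
  ultimately have "emeasure \<nu> {x \<in> lball y k. covol n t V (f x) < \<epsilon>}
      \<le> emeasure \<nu> {x \<in> ?B. fls_abs (g x) < \<epsilon> * exp (- w)}"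
    by (rule emeasure_mono)
  also have "\<dots> \<le> ennreal (C * enn2real (ennreal (\<epsilon> * exp (- w)) / s) powr \<alpha>) * emeasure \<nu> ?B"
  proof -
    have "good_fun K d \<nu> U C \<alpha> g" using good coefF unfolding good_map_def g_def by blast
    then have bound: "\<forall>r>0. vec_ball K d y r \<subseteq> U \<longrightarrow> (\<forall>\<epsilon>>0.
        emeasure \<nu> {z \<in> vec_ball K d y r. fls_abs (g z) < \<epsilon>} \<le>
        (let s = sup_on_supp X \<nu> (vec_ball K d y r) g in if s = 0 then \<infinity>
         else ennreal (C * enn2real (ennreal \<epsilon> / s) powr \<alpha>) * emeasure \<nu> (vec_ball K d y r)))"
      using y unfolding good_fun_def by blast
    have "emeasure \<nu> {z \<in> ?B. fls_abs (g z) < \<epsilon> * exp (- w)} \<le>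
        (let s = sup_on_supp X \<nu> ?B g in if s = 0 then \<infinity>
         else ennreal (C * enn2real (ennreal (\<epsilon> * exp (- w)) / s) powr \<alpha>) * emeasure \<nu> ?B)"
      by (rule bound[rule_format]) (use sub B \<epsilon> in auto)
    then show ?thesis using s0 unfolding s_def[symmetric] Let_def by (simp only: if_False)
  qed
  also have "\<dots> \<le> ennreal (C * \<epsilon> powr \<alpha>) * emeasure \<nu> ?B"
    using ratio C_pos \<alpha>_pos by (intro mult_right_mono ennreal_leI mult_left_mono powr_mono2) auto
  finally show ?thesis unfolding B .
qed

text \<open>
  The bound \<open>b\<close> for affine forms depends on the ball but not on \<open>t\<close>. The largest entry \<open>t\<^sub>m\<close> with a
  positive index is at least \<open>t_norm n t / n\<close>, since \<open>t\<^sub>0\<close> is the sum of these entries; so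
  \<open>e\<^bsup>t\<^sub>m\<^esup> b \<ge> 1\<close> as soon as \<open>t_norm n t\<close> is large.
\<close>

lemma covol_large:
  assumes y: "y \<in> supp" and sub: "lball y k \<subseteq> U"
  shows "\<exists>s::nat. \<forall>t\<in>a_plus n. s < t_norm n t \<longrightarrow>
    (\<forall>V\<in>rational_spaces n. \<exists>z\<in>lball y k \<inter> supp. 1 \<le> covol n t V (f z))"
proof -
  let ?Z = "lball y k \<inter> supp"
  have "\<exists>b>0. \<forall>coef\<in>{0..n} \<rightarrow> F. (\<exists>i\<in>{1..n}. 1 \<le> fls_abs (coef i)) \<longrightarrow>
    (\<exists>z\<in>?Z. b \<le> fls_abs (affine_comb n coef (f z)))"
  proof (rule affine_forms_bounded_below)
    show "f z i \<in> F" if "z \<in> ?Z" "i \<in> {1..n}" for z i using f_coord that sub by blast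
    show "\<forall>i\<in>{0..n}. coef i = 0"
      if "coef \<in> {0..n} \<rightarrow> F" "\<forall>z\<in>?Z. affine_comb n coef (f z) = 0" for coef
      using nonplanar that y sub exp_gt_zero unfolding nonplanar_def lball_def by blast
  qed
  then obtain b where b: "0 < b" and bound: "\<And>coef. coef \<in> {0..n} \<rightarrow> F \<Longrightarrow>
      (\<exists>i\<in>{1..n}. 1 \<le> fls_abs (coef i)) \<Longrightarrow> (\<exists>z\<in>?Z. b \<le> fls_abs (affine_comb n coef (f z)))" by blast
  obtain N :: nat where N: "- ln b \<le> real N" using real_arch_simple by blast
  have "1 / b = exp (- ln b)" using b by (simp add: exp_minus inverse_eq_divide)
  also have "\<dots> \<le> exp (real N)" using N by simp
  finally have Nb: "1 \<le> exp (real N) * b" using b by (simp add: divide_le_eq)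
  have "\<exists>z\<in>?Z. 1 \<le> covol n t V (f z)"
    if t: "t \<in> a_plus n" "n * N < t_norm n t" and V: "V \<in> rational_spaces n" for t V
  proof -
    have t0: "t 0 = (\<Sum>i=1..n. t i)" using t by (simp add: a_plus_def)
    have "Max (t ` {1..n}) \<in> t ` {1..n}" using n_pos by (intro Max_in) auto
    then obtain m where m: "m \<in> {1..n}" "t m = Max (t ` {1..n})" by auto
    have tm: "t i \<le> t m" if "i \<in> {1..n}" for i using that unfolding m(2) by (intro Max_ge) auto
    have "(\<Sum>i=1..n. t i) \<le> of_nat (card {1..n}) * t m" by (rule sum_bounded_above) (rule tm)
    then have "t 0 \<le> n * t m" using t0 by simp
    moreover have "t i \<le> n * t m" if "i \<in> {1..n}" for i
      using tm[OF that] n_pos by (metis le_trans mult_le_mono1 nat_mult_1)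
    ultimately have all: "t i \<le> n * t m" if "i \<in> {0..n}" for i using that by (cases "i = 0") auto
    have "t_norm n t \<le> n * t m" unfolding t_norm_def using all by (subst Max_le_iff) auto
    then have "n * N < n * t m" using t(2) by linarith
    then have "N < t m" by simp
    then have "exp (real N) \<le> exp (real (t m))" by simp
    then have tb: "1 \<le> exp (real (t m)) * b" using Nb b by (meson mult_right_mono less_imp_le order_trans)
    have "y \<in> ?Z" using y supp_subset centre_in_lball by blast
    from vol_lower_bound[OF primitive_basis(1,2)[OF V] t0 m(1)] show ?thesis
    proof (elim disjE bexE conjE)
      assume "\<forall>y. 1 \<le> vol n (rank_of n V) (basis_of n V) t y"
      then show ?thesis using \<open>y \<in> ?Z\<close> unfolding covol_def by blast
    next
      fix coef i
      assume coef: "coef \<in> {0..n} \<rightarrow> F" and i: "i \<in> {1..n}" "1 \<le> fls_abs (coef i)"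
        and le: "\<forall>y. exp (real (t m)) * fls_abs (affine_comb n coef y) \<le> vol n (rank_of n V) (basis_of n V) t y"
      obtain z where z: "z \<in> ?Z" "b \<le> fls_abs (affine_comb n coef (f z))" using bound[OF coef] i by blast
      have "1 \<le> exp (real (t m)) * b" by (rule tb)
      also have "\<dots> \<le> exp (real (t m)) * fls_abs (affine_comb n coef (f z))"
        using z by (intro mult_left_mono) auto
      also have "\<dots> \<le> covol n t V (f z)" using le by (simp add: covol_def)
      finally show ?thesis using z by blast
    qed
  qed
  then show ?thesis by (intro exI[of _ "n * N"]) blast
qed

definition short_set :: "real \<Rightarrow> (nat \<Rightarrow> nat) \<Rightarrow> (nat \<Rightarrow> 'k fls) set" where
  "short_set \<epsilon> t = {x \<in> U. \<exists>v. short_vector n \<epsilon> t (f x) v}"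

lemma openin_short_set:
  assumes \<epsilon>: "0 < \<epsilon>"
  shows "openin X (short_set \<epsilon> t)"
proof -
  let ?I = "{v. (\<forall>j\<le>n. v j \<in> \<Lambda>) \<and> (\<exists>j\<le>n. v j \<noteq> 0)}"
  let ?A = "\<lambda>v j. {x \<in> U. exp (weight t j) * fls_abs (shear n (f x) v j) < \<epsilon>}"
  have "short_set \<epsilon> t = (\<Union>v\<in>?I. \<Inter>j\<in>{..n}. ?A v j)"
    unfolding short_set_def short_vector_def by auto
  also have "openin X \<dots>"
  proof (intro openin_Union ballI, clarify)
    fix v
    show "openin X (\<Inter>j\<in>{..n}. ?A v j)"
    proof (rule openin_INT2)
      fix j
      show "openin X (?A v j)"
      proof (cases "j = 0")
        case True
        have "shear n y v 0 = affine_comb n v y" for y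
          by (simp add: shear_def affine_comb_def mult.commute)
        then show ?thesis unfolding True exp_mult_less_iff
          using \<epsilon> openin_affine_f_less[of "\<epsilon> * exp (- weight t 0)" v] by simp
      next
        case False
        then have "?A v j = (if exp (weight t j) * fls_abs (v j) < \<epsilon> then U else {})"
          by (simp add: shear_def)
        then show ?thesis using openU by simp
      qed
    qed auto
  qed
  finally show ?thesis .
qed

text \<open>
  Nondivergence is applied to the covolumes at \<open>f x\<close> of all rational subspaces, with comparability by
  inclusion: a point with a short vector is not marked.
\<close>

lemma short_set_measure:
  assumes y: "y \<in> supp" and sub: "lball y k \<subseteq> U" and \<epsilon>: "0 < \<epsilon>" "\<epsilon> \<le> 1"
  shows "\<exists>s::nat. \<forall>t\<in>a_plus n. s < t_norm n t \<longrightarrow> emeasure \<nu> (short_set \<epsilon> t \<inter> lball y k)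
    \<le> ennreal (C * \<epsilon> powr \<alpha> * (\<Sum>i=1..Suc n. D ^ i)) * emeasure \<nu> (lball y k)"
proof -
  obtain s :: nat where s: "\<And>t V. t \<in> a_plus n \<Longrightarrow> s < t_norm n t \<Longrightarrow> V \<in> rational_spaces n \<Longrightarrow>
    \<exists>z\<in>lball y k \<inter> supp. 1 \<le> covol n t V (f z)" using covol_large[OF y sub] by blast
  have "emeasure \<nu> (short_set \<epsilon> t \<inter> lball y k)
      \<le> ennreal (C * \<epsilon> powr \<alpha> * (\<Sum>i=1..Suc n. D ^ i)) * emeasure \<nu> (lball y k)"
    if t: "t \<in> a_plus n" "s < t_norm n t" for t
  proof -
    let ?\<psi> = "\<lambda>V x. covol n t V (f x)"
    have "\<exists>N\<in>sets \<nu>. {x \<in> lball y k \<inter> supp. \<not> marked comparable ?\<psi> \<epsilon> (rational_spaces n) x} \<subseteq> N \<and>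
      emeasure \<nu> N \<le> ennreal (C * \<epsilon> powr \<alpha> * (\<Sum>i=1..Suc n. D ^ i)) * emeasure \<nu> (lball y k)"
    proof (rule nondivergence)
      show "0 \<le> C * \<epsilon> powr \<alpha>" using C_pos by simp
      show "openin X {x \<in> U. covol n t V (f x) < \<delta>}" if "V \<in> rational_spaces n" "0 < \<delta>" for V \<delta>
        using openin_covol_less that by blast
      show "card \<Sigma> \<le> Suc n" if "\<Sigma> \<subseteq> rational_spaces n" "clique comparable \<Sigma>" for \<Sigma>
        using card_flag_le that by blast
      show "emeasure \<nu> {x \<in> lball y k. covol n t V (f x) < \<epsilon>}
          \<le> ennreal (C * \<epsilon> powr \<alpha>) * emeasure \<nu> (lball y k)"
        if "V \<in> rational_spaces n" "y \<in> supp" "lball y k \<subseteq> U" "z \<in> lball y k \<inter> supp" "1 \<le> covol n t V (f z)"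
        for V y k z using covol_good[OF that(1) \<epsilon>(1) that(2-5)] .
      show "\<exists>z\<in>lball y k \<inter> supp. 1 \<le> covol n t V (f z)" if "V \<in> rational_spaces n" for V
        using s[OF t that] .
    qed (use D_pos \<epsilon> y sub emeasure_lball_doubling in auto)
    then obtain N where N: "N \<in> sets \<nu>"
      "{x \<in> lball y k \<inter> supp. \<not> marked comparable ?\<psi> \<epsilon> (rational_spaces n) x} \<subseteq> N"
      "emeasure \<nu> N \<le> ennreal (C * \<epsilon> powr \<alpha> * (\<Sum>i=1..Suc n. D ^ i)) * emeasure \<nu> (lball y k)" by blast
    have "short_set \<epsilon> t \<inter> lball y k \<subseteq> N \<union> (S - supp)"
    proof
      fix x assume x: "x \<in> short_set \<epsilon> t \<inter> lball y k"
      then obtain v where xU: "x \<in> U" and v: "short_vector n \<epsilon> t (f x) v" by (auto simp: short_set_def)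
      have "\<not> marked comparable (covol n t) \<epsilon> (rational_spaces n) (f x)"
        using no_short_vector_if_marked[OF f_coord[OF xU] \<epsilon>] v by blast
      then have "\<not> marked comparable ?\<psi> \<epsilon> (rational_spaces n) x" by (simp add: marked_def)
      then show "x \<in> N \<union> (S - supp)" using N(2) x lball_subset by blast
    qed
    then have "emeasure \<nu> (short_set \<epsilon> t \<inter> lball y k) \<le> emeasure \<nu> (N \<union> (S - supp))"
      using N null_outside_supp by (intro emeasure_mono) auto
    also have "\<dots> = emeasure \<nu> N" using N null_outside_supp by (intro emeasure_Un_null_set)
    finally show ?thesis using N(3) by (rule order_trans)
  qed
  then show ?thesis by blast
qed

lemma weight_0_less: "exp (weight t 0) * a < e \<longleftrightarrow> a < e / exp (real (t 0))"
  by (simp add: weight_def pos_less_divide_eq mult.commute)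

lemma weight_pos_less: "0 < j \<Longrightarrow> exp (weight t j) * a < e \<longleftrightarrow> a < e * exp (real (t j))"
  by (simp add: weight_def exp_mult_less_iff)

text \<open>
  The vector \<open>(p, q)\<close> of the definition corresponds to the lattice vector \<open>(-p, q)\<close>.
\<close>

lemma improvable_iff_short_set:
  assumes x: "x \<in> U"
  shows "f x \<in> dirichlet_improvable K n \<epsilon> T \<longleftrightarrow>
    (\<exists>m::nat. \<forall>t\<in>T. m < t_norm n t \<longrightarrow> x \<in> short_set \<epsilon> t)"
proof -
  let ?approx = "\<lambda>t. \<exists>p\<in>\<Lambda>. \<exists>q\<in>{1..n} \<rightarrow> \<Lambda>. (p \<noteq> 0 \<or> (\<exists>j\<in>{1..n}. q j \<noteq> 0)) \<and>
    fls_abs ((\<Sum>j=1..n. f x j * q j) - p) < \<epsilon> / exp (real (t 0)) \<and>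
    (\<forall>j\<in>{1..n}. fls_abs (q j) < \<epsilon> * exp (real (t j)))"
  have approx: "?approx t \<longleftrightarrow> x \<in> short_set \<epsilon> t" for t
  proof
    assume "?approx t"
    then obtain p q where p: "p \<in> \<Lambda>" and q: "q \<in> {1..n} \<rightarrow> \<Lambda>" and nz: "p \<noteq> 0 \<or> (\<exists>j\<in>{1..n}. q j \<noteq> 0)"
      and p_less: "fls_abs ((\<Sum>j=1..n. f x j * q j) - p) < \<epsilon> / exp (real (t 0))"
      and q_less: "\<forall>j\<in>{1..n}. fls_abs (q j) < \<epsilon> * exp (real (t j))" by blast
    let ?v = "\<lambda>j. if j = 0 then - p else q j"
    have "short_vector n \<epsilon> t (f x) ?v"
      unfolding short_vector_def
    proof (intro conjI allI impI)
      show "?v j \<in> \<Lambda>" if "j \<le> n" for j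
        using that \<Lambda>_uminus[OF p] funcset_mem[OF q, of j] by simp
      show "\<exists>j\<le>n. ?v j \<noteq> 0"
      proof (cases "p = 0")
        case True
        then obtain j where "j \<in> {1..n}" "q j \<noteq> 0" using nz by blast
        then show ?thesis by (intro exI[of _ j]) simp
      next
        case False
        then show ?thesis by (intro exI[of _ 0]) simp
      qed
      show "exp (weight t j) * fls_abs (shear n (f x) ?v j) < \<epsilon>" if "j \<le> n" for j
      proof (cases "j = 0")
        case True
        have "(\<Sum>i=1..n. f x i * ?v i) = (\<Sum>i=1..n. f x i * q i)" by (rule sum.cong) auto
        then have "shear n (f x) ?v 0 = (\<Sum>i=1..n. f x i * q i) - p" by (simp add: shear_def)
        then show ?thesis using p_less True by (simp add: weight_0_less)
      next
        case False
        then show ?thesis using q_less that by (simp add: weight_pos_less shear_def)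
      qed
    qed
    then show "x \<in> short_set \<epsilon> t" using x by (auto simp: short_set_def)
  next
    assume "x \<in> short_set \<epsilon> t"
    then obtain v where v: "\<forall>j\<le>n. v j \<in> \<Lambda>" "\<exists>j\<le>n. v j \<noteq> 0"
      and less: "\<And>j. j \<le> n \<Longrightarrow> exp (weight t j) * fls_abs (shear n (f x) v j) < \<epsilon>"
      unfolding short_set_def short_vector_def by blast
    have "- v 0 \<noteq> 0 \<or> (\<exists>j\<in>{1..n}. v j \<noteq> 0)"
    proof -
      obtain j where "j \<le> n" "v j \<noteq> 0" using v(2) by blast
      then show ?thesis by (cases "j = 0") auto
    qed
    moreover have "fls_abs ((\<Sum>j=1..n. f x j * v j) - (- v 0)) < \<epsilon> / exp (real (t 0))"
      using less[of 0] by (simp add: weight_0_less shear_def add.commute)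
    moreover have "fls_abs (v j) < \<epsilon> * exp (real (t j))" if "j \<in> {1..n}" for j
      using less[of j] that by (simp add: weight_pos_less shear_def)
    moreover have "- v 0 \<in> \<Lambda>" "v \<in> {1..n} \<rightarrow> \<Lambda>" using v(1) by (auto intro: \<Lambda>_uminus)
    ultimately show "?approx t" by (intro bexI[of _ "- v 0"] bexI[of _ v] conjI ballI)
  qed
  have "f x \<in> dirichlet_improvable K n \<epsilon> T \<longleftrightarrow>
      (\<exists>s>0. \<forall>t\<in>T. s < real (t_norm n t) \<longrightarrow> ?approx t)"
    using f_in[OF x] by (simp add: dirichlet_improvable_def)
  also have "\<dots> \<longleftrightarrow> (\<exists>s>0::real. \<forall>t\<in>T. s < real (t_norm n t) \<longrightarrow> x \<in> short_set \<epsilon> t)"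
    unfolding approx ..
  also have "\<dots> \<longleftrightarrow> (\<exists>m::nat. \<forall>t\<in>T. m < t_norm n t \<longrightarrow> x \<in> short_set \<epsilon> t)"
  proof
    assume "\<exists>s>0::real. \<forall>t\<in>T. s < real (t_norm n t) \<longrightarrow> x \<in> short_set \<epsilon> t"
    then obtain s :: real where s: "\<forall>t\<in>T. s < real (t_norm n t) \<longrightarrow> x \<in> short_set \<epsilon> t" by blast
    obtain m :: nat where m: "s \<le> real m" using real_arch_simple by blast
    have "x \<in> short_set \<epsilon> t" if "t \<in> T" "m < t_norm n t" for t
    proof -
      have "s < real (t_norm n t)" using m that by linarith
      then show ?thesis using s that by blast
    qed
    then show "\<exists>m::nat. \<forall>t\<in>T. m < t_norm n t \<longrightarrow> x \<in> short_set \<epsilon> t" by blast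
  next
    assume "\<exists>m::nat. \<forall>t\<in>T. m < t_norm n t \<longrightarrow> x \<in> short_set \<epsilon> t"
    then obtain m :: nat where m: "\<forall>t\<in>T. m < t_norm n t \<longrightarrow> x \<in> short_set \<epsilon> t" by blast
    have "x \<in> short_set \<epsilon> t" if "t \<in> T" "real (Suc m) < real (t_norm n t)" for t
      using m that by simp
    then show "\<exists>s>0::real. \<forall>t\<in>T. s < real (t_norm n t) \<longrightarrow> x \<in> short_set \<epsilon> t"
      by (intro exI[of _ "real (Suc m)"]) simp
  qed
  finally show ?thesis .
qed

text \<open>
  \<open>A m\<close> collects the points that have short vectors for all \<open>t\<close> of norm greater than \<open>m\<close>. For each
  ball there is a \<open>t \<in> T\<close> that is large for this ball and of norm greater than \<open>m\<close>, so \<open>A m\<close> fills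
  at most half of the ball.
\<close>

lemma improvable_null:
  assumes \<epsilon>: "0 < \<epsilon>" "\<epsilon> \<le> 1" and small: "C * \<epsilon> powr \<alpha> * (\<Sum>i=1..Suc n. D ^ i) \<le> 1 / 2"
    and T: "T \<subseteq> a_plus n" "\<And>s. \<exists>t\<in>T. s < t_norm n t"
  shows "{x \<in> U. f x \<in> dirichlet_improvable K n \<epsilon> T} \<in> null_sets \<nu>"
proof -
  define A where "A m = {x \<in> U. \<forall>t\<in>T. m < t_norm n t \<longrightarrow> x \<in> short_set \<epsilon> t}" for m
  have "A m \<in> null_sets \<nu>" for m
  proof (rule null_set_if_sparse[OF openU])
    let ?T = "{t \<in> T. m < t_norm n t}"
    have "countable ({0..n} \<rightarrow>\<^sub>E (UNIV :: nat set))" by (intro countable_PiE) auto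
    then have "countable ?T" by (rule countable_subset[rotated]) (use T(1) in \<open>auto simp: a_plus_def\<close>)
    moreover have "?T \<noteq> {}" using T(2) by blast
    ultimately have "(\<Inter>t\<in>?T. short_set \<epsilon> t) \<in> sets \<nu>"
      using open_sets openin_short_set[OF \<epsilon>(1)] by (intro sets.countable_INT') auto
    moreover have "A m = (\<Inter>t\<in>?T. short_set \<epsilon> t)"
      using \<open>?T \<noteq> {}\<close> by (auto simp: A_def short_set_def)
    ultimately show "A m \<in> sets \<nu>" by simp
    show "A m \<subseteq> U" by (auto simp: A_def)
    fix y k assume y: "y \<in> supp" and sub: "lball y k \<subseteq> U"
    obtain s :: nat where s: "\<And>t. t \<in> a_plus n \<Longrightarrow> s < t_norm n t \<Longrightarrow>
      emeasure \<nu> (short_set \<epsilon> t \<inter> lball y k)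
      \<le> ennreal (C * \<epsilon> powr \<alpha> * (\<Sum>i=1..Suc n. D ^ i)) * emeasure \<nu> (lball y k)"
      using short_set_measure[OF y sub \<epsilon>] by blast
    obtain t where t: "t \<in> T" "max s m < t_norm n t" using T(2) by blast
    have "emeasure \<nu> (A m \<inter> lball y k) \<le> emeasure \<nu> (short_set \<epsilon> t \<inter> lball y k)"
      using t open_sets[OF openin_short_set[OF \<epsilon>(1)]] by (intro emeasure_mono) (auto simp: A_def)
    also have "\<dots> \<le> ennreal (C * \<epsilon> powr \<alpha> * (\<Sum>i=1..Suc n. D ^ i)) * emeasure \<nu> (lball y k)"
      using t T by (intro s) auto
    also have "\<dots> \<le> ennreal (1 / 2) * emeasure \<nu> (lball y k)"
      using small by (intro mult_right_mono ennreal_leI) auto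
    finally show "emeasure \<nu> (A m \<inter> lball y k) \<le> ennreal (1 / 2) * emeasure \<nu> (lball y k)" .
  qed
  then have "(\<Union>m. A m) \<in> null_sets \<nu>" by (rule null_sets_UN)
  moreover have "{x \<in> U. f x \<in> dirichlet_improvable K n \<epsilon> T} = (\<Union>m. A m)"
    using improvable_iff_short_set by (auto simp: A_def)
  ultimately show ?thesis by simp
qed

end

theorem theorem3p6:
  fixes n :: nat and C \<alpha> D :: real
  assumes "1 \<le> n" and "0 < C" and "0 < \<alpha>" and "0 < D"
  shows "\<exists>\<epsilon>\<^sub>0>0.
    \<forall>(K :: 'k::comm_ring_1 set) (d :: nat) (\<nu> :: (nat \<Rightarrow> 'k fls) measure) U
      (f :: (nat \<Rightarrow> 'k fls) \<Rightarrow> (nat \<Rightarrow> 'k fls)).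
      finite_field_on K \<and> 1 \<le> d \<and>
      radon_measure (vec_top K d) \<nu> \<and>
      openin (vec_top K d) U \<and> 0 < emeasure \<nu> U \<and>
      federer K d \<nu> U D \<and>
      continuous_map (subtopology (vec_top K d) U) (vec_top K n) f \<and>
      good_map K d n \<nu> U C \<alpha> f \<and>
      nonplanar K d n \<nu> U f \<longrightarrow>
      (\<forall>\<epsilon>::real. 0 < \<epsilon> \<and> \<epsilon> \<le> 1 / exp 1 \<and> \<epsilon> < \<epsilon>\<^sub>0 \<longrightarrow>
        (\<forall>\<T>. \<T> \<subseteq> a_plus n \<and> (\<forall>s. \<exists>t\<in>\<T>. s < t_norm n t) \<longrightarrow>
          {x \<in> U. f x \<in> dirichlet_improvable K n \<epsilon> \<T>} \<in> null_sets \<nu>))"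
proof -
  define c where "c = C * (\<Sum>i=1..Suc n. D ^ i)"
  have c: "0 < c" unfolding c_def using assms by (intro mult_pos_pos sum_pos) auto
  define \<epsilon>\<^sub>0 where "\<epsilon>\<^sub>0 = (1 / (2 * c)) powr (1 / \<alpha>)"
  have small: "C * \<epsilon> powr \<alpha> * (\<Sum>i=1..Suc n. D ^ i) \<le> 1 / 2" if "0 < \<epsilon>" "\<epsilon> < \<epsilon>\<^sub>0" for \<epsilon>
  proof -
    have "\<epsilon> powr \<alpha> \<le> \<epsilon>\<^sub>0 powr \<alpha>" using that assms by (intro powr_mono2) auto
    also have "\<dots> = 1 / (2 * c)" using assms c by (simp add: \<epsilon>\<^sub>0_def powr_powr)
    finally have "c * \<epsilon> powr \<alpha> \<le> c * (1 / (2 * c))" using c by (intro mult_left_mono) auto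
    moreover have "c * (1 / (2 * c)) = 1 / 2" using c by simp
    moreover have "C * \<epsilon> powr \<alpha> * (\<Sum>i=1..Suc n. D ^ i) = c * \<epsilon> powr \<alpha>"
      unfolding c_def by (simp only: mult_ac)
    ultimately show ?thesis by linarith
  qed
  show ?thesis
  proof (intro exI[of _ \<epsilon>\<^sub>0] conjI allI impI)
    show "0 < \<epsilon>\<^sub>0" using c by (simp add: \<epsilon>\<^sub>0_def)
    fix K :: "'k set" and d :: nat and \<nu> :: "(nat \<Rightarrow> 'k fls) measure" and U
      and f :: "(nat \<Rightarrow> 'k fls) \<Rightarrow> (nat \<Rightarrow> 'k fls)" and \<epsilon> :: real and \<T> :: "(nat \<Rightarrow> nat) set"
    assume hyps: "finite_field_on K \<and> 1 \<le> d \<and> radon_measure (vec_top K d) \<nu> \<and>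
      openin (vec_top K d) U \<and> 0 < emeasure \<nu> U \<and> federer K d \<nu> U D \<and>
      continuous_map (subtopology (vec_top K d) U) (vec_top K n) f \<and>
      good_map K d n \<nu> U C \<alpha> f \<and> nonplanar K d n \<nu> U f"
      and \<epsilon>: "0 < \<epsilon> \<and> \<epsilon> \<le> 1 / exp 1 \<and> \<epsilon> < \<epsilon>\<^sub>0"
      and T: "\<T> \<subseteq> a_plus n \<and> (\<forall>s. \<exists>t\<in>\<T>. s < t_norm n t)"
    interpret good_nonplanar_map K d \<nu> n U f C \<alpha> D
      by unfold_locales (use hyps assms in auto)
    have "1 / exp 1 \<le> (1 :: real)" by (simp add: divide_le_eq)
    then have "\<epsilon> \<le> 1" using \<epsilon> by linarith
    then show "{x \<in> U. f x \<in> dirichlet_improvable K n \<epsilon> \<T>} \<in> null_sets \<nu>"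
      using \<epsilon> T small by (intro improvable_null) auto
  qed
qed

end
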